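(* Let $(\mathfrak{A},G,\gamma)$ be a $G$-graded unital $C^*$-algebra, with $G$ a compact abelian group and $\mathfrak{A}^G$ nuclear, and let $v:\widehat{G}\times\widehat{G}\to\mathbb{T}$ be a bicharacter. The $C^*$-dynamical system $(\bigotimes_v^{\mathbb{Z}[1/2]}\mathfrak{A},H,\alpha)$ is $H$-abelian if for every $\chi,\eta\in\Delta_v$ either of the following conditions holds: (i) $v(\chi,\eta)=1$; (ii) $v_S(\chi,\eta)\neq1$.
   Context: A $G$-graded unital $C^*$-algebra $(\mathfrak{A},G,\gamma)$ consists of a unital $C^*$-algebra $\mathfrak{A}$, a compact abelian group $G$ with dual $\widehat{G}$, and a pointwise norm continuous group homomorphism $\gamma:G\to{\rm Aut}(\mathfrak{A})$. $\mathfrak{A}^G$ is the fixed-point algebra. An element $a$ is homogeneous of degree $\partial a=\chi\in\widehat{G}$ if $\gamma_g(a)=\chi(g)a$ for all $g$. A bicharacter $v$ is a map $\widehat{G}\times\widehat{G}\to\mathbb{T}$ that is a character in each variable. Set $v_S(\chi,\eta)=v(\chi,\eta)v(\eta,\chi)$ and $\Delta_v=\{\chi\in\widehat{G}:v(\chi,\chi)=1\}$. For a totally ordered set $L$, $\bigotimes_v^{L}\mathfrak{A}$ is the universal unital $C^*$-algebra generated by unital $*$-homomorphic images $i_k(\mathfrak{A})$, $k\in L$, subject to $i_k(a)i_l(b)=v(\partial a,\partial b)i_l(b)i_k(a)$ for homogeneous $a,b\in\mathfrak{A}$ and $k<l$ in $L$. $\mathbb{Z}[1/2]$ is the ordered set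 of dyadic rationals. $H$ is the group of bijections of $\mathbb{Z}[1/2]$ generated by all translations $\widetilde\tau_{k,n}(r)=r+\frac{k}{2^n}$ ($n\in\mathbb{N}$, $k\in\mathbb{Z}$) and all maps $\widetilde\theta_n=\delta_n^{-1}\circ\widetilde\theta_0\circ\delta_n$ ($n\in\mathbb{N}$), where $\delta_n(d)=2^nd$ and $\widetilde\theta_0(d)=d$ for $d\leq-1$, $\widetilde\theta_0(d)=2d+1$ for $-1\leq d\leq0$, $\widetilde\theta_0(d)=d+1$ for $d\geq0$. All elements of $H$ are order preserving, and $H$ acts on $\bigotimes_v^{\mathbb{Z}[1/2]}\mathfrak{A}$ by automorphisms $\alpha_h(i_d(a))=i_{h(d)}(a)$. A $C^*$-dynamical system $(\mathfrak{B},H,\alpha)$ is $H$-abelian if for every $H$-invariant state $\varphi$ with GNS triple $(\pi_\varphi,\mathcal{H}_\varphi,\xi_\varphi)$ the set $E_\varphi\pi_\varphi(\mathfrak{B})E_\varphi$ is commutative. Here $E_\varphi$ is the orthogonal projection onto the vectors fixed by all unitaries $u_h^\varphi$, $h\in H$, defined by $u^\varphi_h\pi_\varphi(x)\xi_\varphi=\pi_\varphi(\alpha_h(x))\xi_\varphi$. *)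

theory Defs
  imports "HOL-Analysis.Analysis" "HOL-Algebra.Bij" "HOL-Algebra.Generated_Groups"
begin

section \<open>Complex vector spaces, C*-algebras and Hilbert spaces as type classes\<close>

class complex_vector = real_vector +
  fixes scaleC :: "complex \<Rightarrow> 'a \<Rightarrow> 'a" (infixr "*\<^sub>C" 75)
  assumes scaleC_add_right: "c *\<^sub>C (x + y) = c *\<^sub>C x + c *\<^sub>C y"
    and scaleC_add_left: "(c + d) *\<^sub>C x = c *\<^sub>C x + d *\<^sub>C x"
    and scaleC_scaleC: "c *\<^sub>C d *\<^sub>C x = (c * d) *\<^sub>C x"
    and scaleC_of_real: "complex_of_real r *\<^sub>C x = r *\<^sub>R x"

instantiation complex :: complex_vector
begin
definition scaleC_complex :: "complex \<Rightarrow> complex \<Rightarrow> complex"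
  where "scaleC_complex c x = c * x"
instance
  by standard (simp_all add: scaleC_complex_def algebra_simps scaleR_conv_of_real)
end

text \<open>(Nonzero) unital complex C*-algebras.\<close>

class cstar_algebra = complex_vector + banach + real_normed_algebra_1 +
  fixes star :: "'a \<Rightarrow> 'a"
  assumes mult_scaleC_left: "(c *\<^sub>C x) * y = c *\<^sub>C (x * y)"
    and mult_scaleC_right: "x * (c *\<^sub>C y) = c *\<^sub>C (x * y)"
    and norm_scaleC: "norm (c *\<^sub>C x) = cmod c * norm x"
    and star_star: "star (star x) = x"
    and star_add: "star (x + y) = star x + star y"
    and star_scaleC: "star (c *\<^sub>C x) = cnj c *\<^sub>C star x"
    and star_mult: "star (x * y) = star y * star x"
    and norm_star_mult: "norm (star x * x) = (norm x)\<^sup>2"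

text \<open>Complex Hilbert spaces; the inner product is linear in the second variable.\<close>

class chilbert_space = complex_vector + real_inner + complete_space +
  fixes cinner :: "'a \<Rightarrow> 'a \<Rightarrow> complex"
  assumes cinner_commute: "cinner x y = cnj (cinner y x)"
    and cinner_add_right: "cinner x (y + z) = cinner x y + cinner x z"
    and cinner_scaleC_right: "cinner x (c *\<^sub>C y) = c * cinner x y"
    and inner_eq_Re_cinner: "inner x y = Re (cinner x y)"

definition clinear :: "('a::complex_vector \<Rightarrow> 'b::complex_vector) \<Rightarrow> bool" where
  "clinear f \<longleftrightarrow> (\<forall>x y. f (x + y) = f x + f y) \<and> (\<forall>c x. f (c *\<^sub>C x) = c *\<^sub>C f x)"

definition unital_star_hom :: "('a::cstar_algebra \<Rightarrow> 'b::cstar_algebra) \<Rightarrow> bool" where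
  "unital_star_hom f \<longleftrightarrow> clinear f \<and> f 1 = 1 \<and>
     (\<forall>x y. f (x * y) = f x * f y) \<and> (\<forall>x. f (star x) = star (f x))"

definition star_automorphism :: "('a::cstar_algebra \<Rightarrow> 'a) \<Rightarrow> bool" where
  "star_automorphism f \<longleftrightarrow> unital_star_hom f \<and> bij f"


section \<open>Gradings and bicharacters\<close>

text \<open>The abelian group G is written additively, its dual is the set of continuous
  characters with pointwise multiplication.\<close>

definition dual_group :: "('g::topological_ab_group_add \<Rightarrow> complex) set" where
  "dual_group = {\<rho>. continuous_on UNIV \<rho> \<and> (\<forall>g. cmod (\<rho> g) = 1) \<and>
                    (\<forall>g h. \<rho> (g + h) = \<rho> g * \<rho> h)}"

definition graded_cstar_algebra ::
  "('g::{topological_ab_group_add,t2_space} \<Rightarrow> 'a::cstar_algebra \<Rightarrow> 'a) \<Rightarrow> bool" where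
  "graded_cstar_algebra \<gamma> \<longleftrightarrow>
     compact (UNIV :: 'g set) \<and>
     (\<forall>g. star_automorphism (\<gamma> g)) \<and>
     (\<forall>g h. \<gamma> (g + h) = \<gamma> g \<circ> \<gamma> h) \<and>
     (\<forall>a. continuous_on UNIV (\<lambda>g. \<gamma> g a))"

definition fixed_point_algebra :: "('g \<Rightarrow> 'a \<Rightarrow> 'a) \<Rightarrow> 'a set" where
  "fixed_point_algebra \<gamma> = {a. \<forall>g. \<gamma> g a = a}"

definition homogeneous ::
  "('g \<Rightarrow> 'a::cstar_algebra \<Rightarrow> 'a) \<Rightarrow> ('g \<Rightarrow> complex) \<Rightarrow> 'a \<Rightarrow> bool" where
  "homogeneous \<gamma> \<rho> a \<longleftrightarrow> (\<forall>g. \<gamma> g a = \<rho> g *\<^sub>C a)"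

definition bicharacter ::
  "(('g::topological_ab_group_add \<Rightarrow> complex) \<Rightarrow> ('g \<Rightarrow> complex) \<Rightarrow> complex) \<Rightarrow> bool" where
  "bicharacter v \<longleftrightarrow>
     (\<forall>\<rho>\<in>dual_group. \<forall>\<eta>\<in>dual_group. cmod (v \<rho> \<eta>) = 1) \<and>
     (\<forall>\<rho>\<in>dual_group. \<forall>\<rho>'\<in>dual_group. \<forall>\<eta>\<in>dual_group.
        v (\<lambda>g. \<rho> g * \<rho>' g) \<eta> = v \<rho> \<eta> * v \<rho>' \<eta> \<and>
        v \<eta> (\<lambda>g. \<rho> g * \<rho>' g) = v \<eta> \<rho> * v \<eta> \<rho>')"

definition symmetrized ::
  "(('g \<Rightarrow> complex) \<Rightarrow> ('g \<Rightarrow> complex) \<Rightarrow> complex) \<Rightarrow> ('g \<Rightarrow> complex) \<Rightarrow> ('g \<Rightarrow> complex) \<Rightarrow> complex"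
  where "symmetrized v \<rho> \<eta> = v \<rho> \<eta> * v \<eta> \<rho>"

definition Delta ::
  "(('g::topological_ab_group_add \<Rightarrow> complex) \<Rightarrow> ('g \<Rightarrow> complex) \<Rightarrow> complex) \<Rightarrow> ('g \<Rightarrow> complex) set"
  where "Delta v = {\<rho>\<in>dual_group. v \<rho> \<rho> = 1}"


section \<open>Nuclearity\<close>

text \<open>Nuclearity is taken in the sense of Brown and Ozawa (C*-Algebras and
  Finite-Dimensional Approximations, Definition 2.3.1): the identity map is a point-norm
  limit of contractive completely positive maps factoring through matrix algebras.
  It is stated for a closed *-subalgebra D of a C*-algebra, so that it applies to the
  fixed-point algebra.  A complex n by n matrix is a function on indices that vanishes
  outside of the index range.\<close>

type_synonym cmat = "nat \<Rightarrow> nat \<Rightarrow> complex"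

definition cmats :: "nat \<Rightarrow> cmat set" where
  "cmats n = {T. \<forall>s t. \<not> (s < n \<and> t < n) \<longrightarrow> T s t = 0}"

text \<open>Operator norm with respect to the Euclidean norm.\<close>

definition cmat_norm :: "nat \<Rightarrow> cmat \<Rightarrow> real" where
  "cmat_norm n T = Sup {L2_set (\<lambda>s. cmod (\<Sum>t<n. T s t * x t)) {..<n} | x :: nat \<Rightarrow> complex.
                          L2_set (\<lambda>t. cmod (x t)) {..<n} \<le> 1}"

text \<open>Positivity in the m by m matrices over D, respectively over the n by n complex
  matrices, means being of the form Y* Y.\<close>

definition positive_over :: "'a::cstar_algebra set \<Rightarrow> nat \<Rightarrow> (nat \<Rightarrow> nat \<Rightarrow> 'a) \<Rightarrow> bool" where
  "positive_over D m X \<longleftrightarrow> (\<exists>Y. (\<forall>i<m. \<forall>j<m. Y i j \<in> D) \<and>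
     (\<forall>i<m. \<forall>j<m. X i j = (\<Sum>k<m. star (Y k i) * Y k j)))"

definition positive_over_cmats :: "nat \<Rightarrow> nat \<Rightarrow> (nat \<Rightarrow> nat \<Rightarrow> cmat) \<Rightarrow> bool" where
  "positive_over_cmats n m X \<longleftrightarrow> (\<exists>Y :: nat \<Rightarrow> nat \<Rightarrow> cmat.
     (\<forall>i<m. \<forall>j<m. Y i j \<in> cmats n) \<and>
     (\<forall>i<m. \<forall>j<m. X i j = (\<lambda>s t. \<Sum>k<m. \<Sum>r<n. cnj (Y k i r s) * Y k j r t)))"

definition ccp_to_cmats :: "'a::cstar_algebra set \<Rightarrow> nat \<Rightarrow> ('a \<Rightarrow> cmat) \<Rightarrow> bool" where
  "ccp_to_cmats D n \<Phi> \<longleftrightarrow>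
     \<Phi> ` D \<subseteq> cmats n \<and>
     (\<forall>a\<in>D. \<forall>b\<in>D. \<Phi> (a + b) = (\<lambda>s t. \<Phi> a s t + \<Phi> b s t)) \<and>
     (\<forall>c. \<forall>a\<in>D. \<Phi> (c *\<^sub>C a) = (\<lambda>s t. c * \<Phi> a s t)) \<and>
     (\<forall>a\<in>D. cmat_norm n (\<Phi> a) \<le> norm a) \<and>
     (\<forall>m X. positive_over D m X \<longrightarrow> positive_over_cmats n m (\<lambda>i j. \<Phi> (X i j)))"

definition ccp_from_cmats :: "'a::cstar_algebra set \<Rightarrow> nat \<Rightarrow> (cmat \<Rightarrow> 'a) \<Rightarrow> bool" where
  "ccp_from_cmats D n \<Psi> \<longleftrightarrow>
     \<Psi> ` cmats n \<subseteq> D \<and>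
     (\<forall>S\<in>cmats n. \<forall>T\<in>cmats n. \<Psi> (\<lambda>s t. S s t + T s t) = \<Psi> S + \<Psi> T) \<and>
     (\<forall>c. \<forall>T\<in>cmats n. \<Psi> (\<lambda>s t. c * T s t) = c *\<^sub>C \<Psi> T) \<and>
     (\<forall>T\<in>cmats n. norm (\<Psi> T) \<le> cmat_norm n T) \<and>
     (\<forall>m X. positive_over_cmats n m X \<longrightarrow> positive_over D m (\<lambda>i j. \<Psi> (X i j)))"

definition nuclear :: "'a::cstar_algebra set \<Rightarrow> bool" where
  "nuclear D \<longleftrightarrow> (\<forall>F \<epsilon>. finite F \<and> F \<subseteq> D \<and> \<epsilon> > 0 \<longrightarrow>
     (\<exists>n \<Phi> \<Psi>. ccp_to_cmats D n \<Phi> \<and> ccp_from_cmats D n \<Psi> \<and>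
        (\<forall>a\<in>F. norm (\<Psi> (\<Phi> a) - a) < \<epsilon>)))"


section \<open>The universal braided tensor product\<close>

text \<open>The free unital complex *-algebra on the symbols (k, a), k in L, a in A, with involution
  (k, a)* = (k, star a): finitely supported complex functions on words, with convolution as
  product.  The word w is represented by its indicator function, the unit is the empty
  word.\<close>

type_synonym ('k, 'a) free = "('k \<times> 'a) list \<Rightarrow> complex"

definition free_carrier :: "'k set \<Rightarrow> ('k, 'a) free set" where
  "free_carrier L = {f. finite {w. f w \<noteq> 0} \<and> (\<forall>w. f w \<noteq> 0 \<longrightarrow> fst ` set w \<subseteq> L)}"

definition free_word :: "('k \<times> 'a) list \<Rightarrow> ('k, 'a) free" where
  "free_word w = (\<lambda>u. if u = w then 1 else 0)"

definition free_add :: "('k, 'a) free \<Rightarrow> ('k, 'a) free \<Rightarrow> ('k, 'a) free" where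
  "free_add f g = (\<lambda>w. f w + g w)"

definition free_scale :: "complex \<Rightarrow> ('k, 'a) free \<Rightarrow> ('k, 'a) free" where
  "free_scale c f = (\<lambda>w. c * f w)"

definition free_mult :: "('k, 'a) free \<Rightarrow> ('k, 'a) free \<Rightarrow> ('k, 'a) free" where
  "free_mult f g = (\<lambda>w. \<Sum>j\<le>length w. f (take j w) * g (drop j w))"

definition free_star :: "('k, 'a::cstar_algebra) free \<Rightarrow> ('k, 'a) free" where
  "free_star f = (\<lambda>w. cnj (f (rev (map (\<lambda>(k, a). (k, star a)) w))))"

definition free_eval ::
  "('k \<Rightarrow> 'a \<Rightarrow> 'b::cstar_algebra) \<Rightarrow> ('k, 'a) free \<Rightarrow> 'b" where
  "free_eval i f = (\<Sum>w | f w \<noteq> 0. f w *\<^sub>C prod_list (map (\<lambda>(k, a). i k a) w))"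

text \<open>Pairs (f, g) of elements of the free *-algebra that are to be identified.\<close>

inductive braided_relation ::
  "('g::topological_ab_group_add \<Rightarrow> 'a::cstar_algebra \<Rightarrow> 'a) \<Rightarrow>
   (('g \<Rightarrow> complex) \<Rightarrow> ('g \<Rightarrow> complex) \<Rightarrow> complex) \<Rightarrow> 'k::linorder set \<Rightarrow>
   ('k, 'a) free \<Rightarrow> ('k, 'a) free \<Rightarrow> bool"
  for \<gamma> v L where
    rel_add: "k \<in> L \<Longrightarrow> braided_relation \<gamma> v L
      (free_word [(k, a + b)]) (free_add (free_word [(k, a)]) (free_word [(k, b)]))"
  | rel_scale: "k \<in> L \<Longrightarrow> braided_relation \<gamma> v L
      (free_word [(k, c *\<^sub>C a)]) (free_scale c (free_word [(k, a)]))"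
  | rel_mult: "k \<in> L \<Longrightarrow> braided_relation \<gamma> v L
      (free_word [(k, a * b)]) (free_word [(k, a), (k, b)])"
  | rel_unit: "k \<in> L \<Longrightarrow> braided_relation \<gamma> v L (free_word [(k, 1)]) (free_word [])"
  | rel_braid: "\<lbrakk>k \<in> L; l \<in> L; k < l; \<rho> \<in> dual_group; \<eta> \<in> dual_group;
        homogeneous \<gamma> \<rho> a; homogeneous \<gamma> \<eta> b\<rbrakk> \<Longrightarrow> braided_relation \<gamma> v L
      (free_word [(k, a), (l, b)]) (free_scale (v \<rho> \<eta>) (free_word [(l, b), (k, a)]))"

text \<open>C*-seminorms on the free *-algebra that are compatible with the relations.  Their
  separated completions are exactly the C*-algebras generated by families of unital
  *-homomorphic images of A satisfying the braided commutation relations.\<close>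

definition braided_seminorm ::
  "('g::topological_ab_group_add \<Rightarrow> 'a::cstar_algebra \<Rightarrow> 'a) \<Rightarrow>
   (('g \<Rightarrow> complex) \<Rightarrow> ('g \<Rightarrow> complex) \<Rightarrow> complex) \<Rightarrow> 'k::linorder set \<Rightarrow>
   (('k, 'a) free \<Rightarrow> real) \<Rightarrow> bool" where
  "braided_seminorm \<gamma> v L N \<longleftrightarrow>
     (\<forall>f\<in>free_carrier L. 0 \<le> N f) \<and>
     (\<forall>f\<in>free_carrier L. \<forall>g\<in>free_carrier L. N (free_add f g) \<le> N f + N g) \<and>
     (\<forall>c. \<forall>f\<in>free_carrier L. N (free_scale c f) = cmod c * N f) \<and>
     (\<forall>f\<in>free_carrier L. \<forall>g\<in>free_carrier L. N (free_mult f g) \<le> N f * N g) \<and>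
     (\<forall>f\<in>free_carrier L. N (free_mult (free_star f) f) = (N f)\<^sup>2) \<and>
     (\<forall>f g. braided_relation \<gamma> v L f g \<longrightarrow> N (free_add f (free_scale (- 1) g)) = 0)"

text \<open>The type of B together with the family i is the universal unital C*-algebra over the
  index set L, i.e. the completion of the free *-algebra modulo the relations with respect
  to the greatest C*-seminorm.  The values of i outside L are irrelevant.\<close>

definition braided_tensor_product ::
  "('g::topological_ab_group_add \<Rightarrow> 'a::cstar_algebra \<Rightarrow> 'a) \<Rightarrow>
   (('g \<Rightarrow> complex) \<Rightarrow> ('g \<Rightarrow> complex) \<Rightarrow> complex) \<Rightarrow> 'k::linorder set \<Rightarrow>
   ('k \<Rightarrow> 'a \<Rightarrow> 'b::cstar_algebra) \<Rightarrow> bool" where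
  "braided_tensor_product \<gamma> v L i \<longleftrightarrow>
     (\<forall>k\<in>L. unital_star_hom (i k)) \<and>
     (\<forall>k\<in>L. \<forall>l\<in>L. k < l \<longrightarrow> (\<forall>\<rho>\<in>dual_group. \<forall>\<eta>\<in>dual_group. \<forall>a b.
        homogeneous \<gamma> \<rho> a \<and> homogeneous \<gamma> \<eta> b \<longrightarrow> i k a * i l b = v \<rho> \<eta> *\<^sub>C (i l b * i k a))) \<and>
     closure (free_eval i ` free_carrier L) = UNIV \<and>
     (\<forall>N. braided_seminorm \<gamma> v L N \<longrightarrow> (\<forall>f\<in>free_carrier L. N f \<le> norm (free_eval i f)))"


section \<open>The group of dyadic bijections\<close>

definition dyadic_rationals :: "rat set" where
  "dyadic_rationals = {of_int k / 2 ^ n | (k :: int) (n :: nat). True}"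

definition dyadic_translation :: "int \<Rightarrow> nat \<Rightarrow> rat \<Rightarrow> rat" where
  "dyadic_translation k n = (\<lambda>r\<in>dyadic_rationals. r + of_int k / 2 ^ n)"

definition theta0 :: "rat \<Rightarrow> rat" where
  "theta0 d = (if d \<le> - 1 then d else if d \<le> 0 then 2 * d + 1 else d + 1)"

definition dyadic_theta :: "nat \<Rightarrow> rat \<Rightarrow> rat" where
  "dyadic_theta n = (\<lambda>d\<in>dyadic_rationals. theta0 (2 ^ n * d) / 2 ^ n)"

definition dyadic_generators :: "(rat \<Rightarrow> rat) set" where
  "dyadic_generators = {dyadic_translation k n | k n. True} \<union> range dyadic_theta"

definition dyadic_group :: "(rat \<Rightarrow> rat) monoid" where
  "dyadic_group =
     (BijGroup dyadic_rationals)\<lparr>carrier := generate (BijGroup dyadic_rationals) dyadic_generators\<rparr>"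

lemma dyadic_rationals_add: "x \<in> dyadic_rationals \<Longrightarrow> y \<in> dyadic_rationals \<Longrightarrow> x + y \<in> dyadic_rationals"
proof -
  assume "x \<in> dyadic_rationals" "y \<in> dyadic_rationals"
  then obtain k n l m where xy: "x = of_int k / 2 ^ n" "y = of_int l / 2 ^ m"
    unfolding dyadic_rationals_def by blast
  have "x + y = of_int (k * 2 ^ m + l * 2 ^ n) / 2 ^ (n + m)"
    unfolding xy by (simp add: field_simps power_add)
  then show ?thesis unfolding dyadic_rationals_def by blast
qed

lemma dyadic_rationals_scale: "x \<in> dyadic_rationals \<Longrightarrow> of_int k * x / 2 ^ m \<in> dyadic_rationals"
proof -
  assume "x \<in> dyadic_rationals"
  then obtain l n where x: "x = of_int l / 2 ^ n" unfolding dyadic_rationals_def by blast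
  have "of_int k * x / 2 ^ m = of_int (k * l) / 2 ^ (n + m)"
    unfolding x by (simp add: power_add)
  then show ?thesis unfolding dyadic_rationals_def by blast
qed

lemma dyadic_rationals_of_int: "of_int k \<in> dyadic_rationals"
proof -
  have "(of_int k :: rat) = of_int k / 2 ^ 0" by simp
  then show ?thesis unfolding dyadic_rationals_def by blast
qed

lemma dyadic_translation_Bij: "dyadic_translation k n \<in> Bij dyadic_rationals"
proof -
  have mem: "of_int j / 2 ^ n \<in> dyadic_rationals" for j unfolding dyadic_rationals_def by blast
  have "bij_betw (dyadic_translation k n) dyadic_rationals dyadic_rationals"
    by (rule bij_betw_byWitness[where f' = "\<lambda>r. r + of_int (- k) / 2 ^ n"])
       (use dyadic_rationals_add[OF _ mem[of k]] dyadic_rationals_add[OF _ mem[of "- k"]] in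
         \<open>auto simp: dyadic_translation_def\<close>)
  then show ?thesis by (simp add: Bij_def dyadic_translation_def)
qed

lemma dyadic_theta_Bij: "dyadic_theta n \<in> Bij dyadic_rationals"
proof -
  define inv0 :: "rat \<Rightarrow> rat"
    where "inv0 d = (if d \<le> - 1 then d else if d \<le> 1 then (d - 1) / 2 else d - 1)" for d
  have inv0: "inv0 (theta0 d) = d" "theta0 (inv0 d) = d" for d
    by (auto simp: inv0_def theta0_def field_simps)
  have up: "2 ^ n * d \<in> dyadic_rationals" if "d \<in> dyadic_rationals" for d
    using dyadic_rationals_scale[OF that, of "2 ^ n" 0] by simp
  have down: "d / 2 ^ n \<in> dyadic_rationals" if "d \<in> dyadic_rationals" for d
    using dyadic_rationals_scale[OF that, of 1 n] by simp
  have th: "theta0 d \<in> dyadic_rationals" "inv0 d \<in> dyadic_rationals" if "d \<in> dyadic_rationals" for d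
  proof -
    have d1: "d + 1 \<in> dyadic_rationals" "2 * d + 1 \<in> dyadic_rationals" "d - 1 \<in> dyadic_rationals"
      using dyadic_rationals_add[OF that dyadic_rationals_of_int[of 1]] dyadic_rationals_add[OF that dyadic_rationals_of_int[of "- 1"]]
        dyadic_rationals_add[OF dyadic_rationals_scale[OF that, of 2 0] dyadic_rationals_of_int[of 1]] by auto
    have "(d - 1) / 2 \<in> dyadic_rationals" using dyadic_rationals_scale[OF d1(3), of 1 1] by simp
    with d1 that show "theta0 d \<in> dyadic_rationals" "inv0 d \<in> dyadic_rationals"
      by (auto simp: theta0_def inv0_def)
  qed
  have "bij_betw (dyadic_theta n) dyadic_rationals dyadic_rationals"
    by (rule bij_betw_byWitness[where f' = "\<lambda>d. inv0 (2 ^ n * d) / 2 ^ n"])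
       (auto simp: dyadic_theta_def inv0 intro!: th down up)
  then show ?thesis by (simp add: Bij_def dyadic_theta_def)
qed

lemma dyadic_generators_subset: "dyadic_generators \<subseteq> carrier (BijGroup dyadic_rationals)"
  by (auto simp: dyadic_generators_def BijGroup_def dyadic_translation_Bij dyadic_theta_Bij)


section \<open>Invariant states and H-abelian dynamical systems\<close>

definition cstar_dynamical_system ::
  "('h, 'm) monoid_scheme \<Rightarrow> ('h \<Rightarrow> 'b::cstar_algebra \<Rightarrow> 'b) \<Rightarrow> bool" where
  "cstar_dynamical_system H \<alpha> \<longleftrightarrow> group H \<and>
     (\<forall>h\<in>carrier H. star_automorphism (\<alpha> h)) \<and>
     (\<forall>h\<in>carrier H. \<forall>k\<in>carrier H. \<alpha> (h \<otimes>\<^bsub>H\<^esub> k) = \<alpha> h \<circ> \<alpha> k)"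

definition state :: "('b::cstar_algebra \<Rightarrow> complex) \<Rightarrow> bool" where
  "state \<phi> \<longleftrightarrow> clinear \<phi> \<and> \<phi> 1 = 1 \<and>
     (\<forall>x. Im (\<phi> (star x * x)) = 0 \<and> 0 \<le> Re (\<phi> (star x * x)))"

definition invariant_state ::
  "('h, 'm) monoid_scheme \<Rightarrow> ('h \<Rightarrow> 'b::cstar_algebra \<Rightarrow> 'b) \<Rightarrow> ('b \<Rightarrow> complex) \<Rightarrow> bool" where
  "invariant_state H \<alpha> \<phi> \<longleftrightarrow> state \<phi> \<and> (\<forall>h\<in>carrier H. \<forall>x. \<phi> (\<alpha> h x) = \<phi> x)"

definition star_representation ::
  "('b::cstar_algebra \<Rightarrow> 'v::chilbert_space \<Rightarrow> 'v) \<Rightarrow> bool" where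
  "star_representation \<pi> \<longleftrightarrow>
     (\<forall>x. clinear (\<pi> x) \<and> bounded_linear (\<pi> x)) \<and>
     (\<forall>x y \<zeta>. \<pi> (x + y) \<zeta> = \<pi> x \<zeta> + \<pi> y \<zeta>) \<and>
     (\<forall>c x \<zeta>. \<pi> (c *\<^sub>C x) \<zeta> = c *\<^sub>C \<pi> x \<zeta>) \<and>
     (\<forall>x y \<zeta>. \<pi> (x * y) \<zeta> = \<pi> x (\<pi> y \<zeta>)) \<and>
     (\<forall>x \<zeta> \<eta>. cinner (\<pi> (star x) \<zeta>) \<eta> = cinner \<zeta> (\<pi> x \<eta>))"

definition gns_triple ::
  "('b::cstar_algebra \<Rightarrow> complex) \<Rightarrow> ('b \<Rightarrow> 'v::chilbert_space \<Rightarrow> 'v) \<Rightarrow> 'v \<Rightarrow> bool" where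
  "gns_triple \<phi> \<pi> \<xi> \<longleftrightarrow> star_representation \<pi> \<and> closure (range (\<lambda>x. \<pi> x \<xi>)) = UNIV \<and>
     (\<forall>x. \<phi> x = cinner \<xi> (\<pi> x \<xi>))"

definition unitary :: "('v::chilbert_space \<Rightarrow> 'v) \<Rightarrow> bool" where
  "unitary U \<longleftrightarrow> clinear U \<and> surj U \<and> (\<forall>\<zeta> \<eta>. cinner (U \<zeta>) (U \<eta>) = cinner \<zeta> \<eta>)"

definition gns_unitary ::
  "('b::cstar_algebra \<Rightarrow> 'v::chilbert_space \<Rightarrow> 'v) \<Rightarrow> 'v \<Rightarrow> ('b \<Rightarrow> 'b) \<Rightarrow> 'v \<Rightarrow> 'v" where
  "gns_unitary \<pi> \<xi> \<theta> = (THE U. unitary U \<and> (\<forall>x. U (\<pi> x \<xi>) = \<pi> (\<theta> x) \<xi>))"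

text \<open>Meaningful for closed complex subspaces M.\<close>

definition orthogonal_projection :: "'v::chilbert_space set \<Rightarrow> 'v \<Rightarrow> 'v" where
  "orthogonal_projection M \<zeta> = (THE \<eta>. \<eta> \<in> M \<and> (\<forall>\<mu>\<in>M. cinner \<mu> (\<zeta> - \<eta>) = 0))"

definition gns_invariant_projection ::
  "('h, 'm) monoid_scheme \<Rightarrow> ('h \<Rightarrow> 'b::cstar_algebra \<Rightarrow> 'b) \<Rightarrow>
   ('b \<Rightarrow> 'v::chilbert_space \<Rightarrow> 'v) \<Rightarrow> 'v \<Rightarrow> 'v \<Rightarrow> 'v" where
  "gns_invariant_projection H \<alpha> \<pi> \<xi> =
     orthogonal_projection {\<zeta>. \<forall>h\<in>carrier H. gns_unitary \<pi> \<xi> (\<alpha> h) \<zeta> = \<zeta>}"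

text \<open>The type argument is the underlying type of the Hilbert spaces of the GNS triples.  It
  depends on the state, so the property is to be asserted for a type variable: a system is
  H-abelian if the predicate holds for all Hilbert space types.\<close>

definition H_abelian ::
  "'v::chilbert_space itself \<Rightarrow> ('h, 'm) monoid_scheme \<Rightarrow>
   ('h \<Rightarrow> 'b::cstar_algebra \<Rightarrow> 'b) \<Rightarrow> bool" where
  "H_abelian (_ :: 'v itself) H \<alpha> \<longleftrightarrow>
     (\<forall>\<phi> (\<pi> :: 'b \<Rightarrow> 'v \<Rightarrow> 'v) \<xi>. invariant_state H \<alpha> \<phi> \<and> gns_triple \<phi> \<pi> \<xi> \<longrightarrow>
        (let E = gns_invariant_projection H \<alpha> \<pi> \<xi> in
           \<forall>x y. (E \<circ> \<pi> x \<circ> E) \<circ> (E \<circ> \<pi> y \<circ> E) = (E \<circ> \<pi> y \<circ> E) \<circ> (E \<circ> \<pi> x \<circ> E)))"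

end

theory Submission
  imports Defs
begin

text \<open>
  Let E be the projection of a GNS space onto the H-fixed vectors.  By the mean ergodic theorem E is
  approximated strongly by averages of the unitaries u h.  Let x and y be words in homogeneous
  elements, of total degrees \<chi> and \<eta>.  In the expression E x E y E replace E by averages on both
  sides of a far right translation; then all positions of the translate of y lie to the right of
  those of the translate of x, so the two can be interchanged at the cost of the factor v \<chi> \<eta>, and
  E x E y E = v \<chi> \<eta> E y E x E.  Applied to x* and x this says that two positive operators differ by
  the factor cnj (v \<chi> \<chi>), so E x E = 0 unless \<chi> lies in \<Delta>.  For \<chi> and \<eta> in \<Delta> the
  relation, used twice, shows that both products agree if v \<chi> \<eta> = 1, and that both vanish if the
  symmetrised bicharacter is not 1.

  That such words are total rests on the totality of the homogeneous elements, that is, on the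
  Peter-Weyl theorem for the compact abelian group G: an invariant mean arises from averages over
  finite sets of translations, idempotents of the convolution algebra from power iteration, and the
  minimal ones among them are multiples of characters.
\<close>

section \<open>C*-algebras: contractivity of *-homomorphisms\<close>

text \<open>The obstacle is that the mean ergodic theorem gives no control over the averages: those
  approximating E may scatter the positions of the letters arbitrarily, while the defining relations
  speak only about letters whose positions are ordered. Two facts save the argument. Each average
  involves finitely many group elements, so a single translation moves all positions of y beyond
  those of x. And this translation leaves no trace in the limit: it is unitary and fixes the range
  of E, so it may be chosen anew for every pair of averages, without any bound on its size. All this
  takes place in matrix coefficients between fixed vectors, where a group element is absorbed by the
  vector and acts on words alone.

  In the Peter-Weyl part, minimal idempotents exist because the squared L2 norm is at least 1 on
  every nonzero self-adjoint idempotent and additive on orthogonal ones. Means are defined by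
  uniform approximation with finite averages, because invariance, faithfulness and the interchange
  of two means are what convolution requires.\<close>

lemma scaleC_zero_left [simp]: "0 *\<^sub>C x = 0"
  using scaleC_of_real[of 0 x] by simp

lemma scaleC_zero_right [simp]: "c *\<^sub>C 0 = 0"
  using scaleC_add_right[of c 0 0] by simp

lemma scaleC_one [simp]: "1 *\<^sub>C x = x"
  using scaleC_of_real[of 1 x] by simp

lemma scaleC_minus_left: "(- c) *\<^sub>C x = - (c *\<^sub>C x)"
  using scaleC_add_left[of c "- c" x] by (simp add: add_eq_0_iff)

lemma scaleC_minus_right: "c *\<^sub>C (- x) = - (c *\<^sub>C x)"
  using scaleC_add_right[of c x "- x"] by (simp add: add_eq_0_iff)

lemma scaleC_diff_left: "(c - d) *\<^sub>C x = c *\<^sub>C x - d *\<^sub>C x"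
  using scaleC_add_left[of c "- d" x] by (simp add: scaleC_minus_left)

lemma scaleC_diff_right: "c *\<^sub>C (x - y) = c *\<^sub>C x - c *\<^sub>C y"
  using scaleC_add_right[of c x "- y"] by (simp add: scaleC_minus_right)

lemma scaleC_scaleR: "c *\<^sub>C r *\<^sub>R x = r *\<^sub>R c *\<^sub>C x"
  by (metis scaleC_of_real scaleC_scaleC mult.commute)

lemma bounded_linear_scaleC_right: "bounded_linear (\<lambda>x::'a::cstar_algebra. c *\<^sub>C x)"
  by (rule bounded_linear_intro[where K = "cmod c"])
    (simp_all add: scaleC_add_right scaleC_scaleR norm_scaleC mult.commute)

lemma bounded_bilinear_scaleC: "bounded_bilinear (\<lambda>c (x::'a::cstar_algebra). c *\<^sub>C x)"
proof (rule bounded_bilinear.intro)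
  show "(r *\<^sub>R c) *\<^sub>C x = r *\<^sub>R c *\<^sub>C x" for r c and x :: 'a
    by (simp only: scaleR_conv_of_real[of r c] scaleC_scaleC[symmetric] scaleC_of_real)
  show "\<exists>K. \<forall>c (x::'a). norm (c *\<^sub>C x) \<le> norm c * norm x * K"
    by (rule exI[of _ 1]) (simp add: norm_scaleC)
qed (simp_all add: scaleC_add_right scaleC_add_left scaleC_scaleR)

lemmas continuous_on_scaleC [continuous_intros] =
  bounded_bilinear.continuous_on[OF bounded_bilinear_scaleC]

lemma norm_star [simp]: "norm (star x) = norm (x::'a::cstar_algebra)"
proof -
  have le: "norm y \<le> norm (star y)" for y :: 'a
  proof (cases "y = 0")
    case False
    have "norm y * norm y \<le> norm (star y) * norm y"
      using norm_mult_ineq[of "star y" y] by (simp add: norm_star_mult power2_eq_square)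
    with False show ?thesis by simp
  qed simp
  from le[of x] le[of "star x"] show ?thesis by (simp add: star_star)
qed

lemma bounded_linear_star: "bounded_linear (star :: 'a::cstar_algebra \<Rightarrow> 'a)"
  by (rule bounded_linear_intro[where K = 1])
    (simp_all add: star_add star_scaleC flip: scaleC_of_real)

lemma star_one [simp]: "star (1::'a::cstar_algebra) = 1"
  by (metis mult_1_right star_mult star_star)

lemma star_power: "star (x ^ n) = star (x::'a::cstar_algebra) ^ n"
  by (induction n) (simp_all add: star_mult power_commutes)

section \<open>Square roots by the binomial series\<close>

lemma abs_half_gchoose_le: "\<bar>(1/2::real) gchoose n\<bar> \<le> 1"
proof (induction n)
  case (Suc n)
  have "real (Suc n) * ((1/2) gchoose Suc n) = (1/2 - real n) * ((1/2) gchoose n)"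
    using gbinomial_absorb_comp[of "1/2::real" n] gbinomial_absorption[of n "1/2::real"] by metis
  then have "(1/2::real) gchoose Suc n = ((1/2) gchoose n) * ((1/2 - real n) / (real n + 1))"
    by (simp add: field_simps)
  moreover have "\<bar>(1/2 - real n) / (real n + 1)\<bar> \<le> 1" by (auto simp: field_simps abs_le_iff)
  ultimately show ?case using Suc by (simp only: abs_mult mult_le_one abs_ge_zero)
qed simp

text \<open>The root is the binomial series of (1 - s)^(1/2), which
  \<open>abs_half_gchoose_le\<close> dominates by a geometric series. Being a limit of real
  polynomials in s, it is self-adjoint and commutes with everything that commutes with s.\<close>

lemma square_root_one_minus:
  fixes s :: "'a::cstar_algebra"
  assumes s: "norm s < 1" "star s = s"
  obtains b where "b * b = 1 - s" "star b = b" "\<And>y. y * s = s * y \<Longrightarrow> y * b = b * y"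
proof -
  define c where "c n = (- 1) ^ n * ((1/2::real) gchoose n)" for n
  define b where "b = (\<Sum>n. c n *\<^sub>R s ^ n)"
  have "norm (c n *\<^sub>R s ^ n) \<le> norm s ^ n" for n
  proof -
    have "norm (c n *\<^sub>R s ^ n) \<le> 1 * norm (s ^ n)"
      using mult_right_mono[OF abs_half_gchoose_le[of n] norm_ge_zero[of "s ^ n"]]
      by (simp add: c_def abs_mult)
    also have "\<dots> \<le> norm s ^ n" by (simp add: norm_power_ineq)
    finally show ?thesis .
  qed
  then have abs_summable: "summable (\<lambda>n. norm (c n *\<^sub>R s ^ n))"
    by (intro summable_comparison_test'[OF summable_geometric[of "norm s"]]) (use s in auto)
  then have summable: "summable (\<lambda>n. c n *\<^sub>R s ^ n)" by (rule summable_norm_cancel)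
  \<comment> \<open>By Vandermonde's identity the Cauchy square of the coefficients for exponent 1/2
    consists of the coefficients for exponent 1, which vanish from degree 2 on.\<close>
  have coeff: "(\<Sum>i\<le>n. (c i *\<^sub>R s ^ i) * (c (n - i) *\<^sub>R s ^ (n - i))) =
      ((- 1) ^ n * real (1 choose n)) *\<^sub>R s ^ n" for n
  proof -
    have c: "c i * c (n - i) = (- 1) ^ n * (((1/2::real) gchoose i) * ((1/2) gchoose (n - i)))"
      if "i \<le> n" for i
      using power_add[of "- 1 :: real" i "n - i"] that by (simp add: c_def)
    have s: "s ^ i * s ^ (n - i) = s ^ n" if "i \<le> n" for i
      using power_add[of s i "n - i"] that by simp
    have "(\<Sum>i\<le>n. (c i *\<^sub>R s ^ i) * (c (n - i) *\<^sub>R s ^ (n - i))) =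
        ((- 1) ^ n * (\<Sum>i\<in>{0..n}. ((1/2::real) gchoose i) * ((1/2) gchoose (n - i)))) *\<^sub>R s ^ n"
      by (simp add: c s mult.commute sum_distrib_left scaleR_sum_left atLeast0AtMost)
    also have "(\<Sum>i\<in>{0..n}. ((1/2::real) gchoose i) * ((1/2) gchoose (n - i))) = real (1 choose n)"
      unfolding gbinomial_Vandermonde by (simp add: binomial_gbinomial)
    finally show ?thesis .
  qed
  have "(\<lambda>n. ((- 1) ^ n * real (1 choose n)) *\<^sub>R s ^ n) sums
      (\<Sum>n\<in>{0,1}. ((- 1) ^ n * real (1 choose n)) *\<^sub>R s ^ n)"
    by (rule sums_finite) (auto simp: binomial_eq_0)
  moreover have "(\<lambda>n. ((- 1) ^ n * real (1 choose n)) *\<^sub>R s ^ n) sums (b * b)"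
    using Cauchy_product_sums[OF abs_summable abs_summable] by (simp only: coeff b_def)
  ultimately have "b * b = 1 - s" using sums_unique2 by fastforce
  moreover have "star b = b"
    unfolding b_def bounded_linear.suminf[OF bounded_linear_star summable]
    by (simp add: linear_scale[OF bounded_linear.linear[OF bounded_linear_star]] star_power s)
  moreover have "y * b = b * y" if "y * s = s * y" for y
  proof -
    have "y * s ^ n = s ^ n * y" for n using that power_commuting_commutes by metis
    then show ?thesis
      unfolding b_def
      by (simp add: bounded_linear.suminf[OF bounded_linear_mult_left summable]
          bounded_linear.suminf[OF bounded_linear_mult_right summable])
  qed
  ultimately show ?thesis using that by blast
qed

lemma unital_star_homD:
  assumes "unital_star_hom f"
  shows "f (x + y) = f x + f y" "f (c *\<^sub>C x) = c *\<^sub>C f x" "f 1 = 1" "f (x * y) = f x * f y"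
    "f (star x) = star (f x)"
  using assms by (auto simp: unital_star_hom_def clinear_def)

lemma unital_star_hom_linear: "unital_star_hom f \<Longrightarrow> linear f"
  by (rule linearI) (simp_all add: unital_star_homD flip: scaleC_of_real)

text \<open>If c and d commute, are self-adjoint and satisfy c^2 + d^2 = 1, then c + i d is unitary.\<close>

lemma unital_star_hom_norm_le_one:
  assumes f: "unital_star_hom f" and a: "star a = a" "norm a < 1"
  shows "norm (f a) \<le> 1"
proof -
  have "norm (a * a) \<le> norm a * norm a" by (rule norm_mult_ineq)
  also have "\<dots> < 1" using mult_strict_mono'[OF a(2) a(2)] by simp
  finally have na: "norm (a * a) < 1" .
  have sa: "star (a * a) = a * a" by (simp add: star_mult a(1))
  obtain b where b: "b * b = 1 - a * a" "star b = b" "\<And>y. y * (a * a) = (a * a) * y \<Longrightarrow> y * b = b * y"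
    using square_root_one_minus[OF na sa] by metis
  define u where "u = f a + \<i> *\<^sub>C f b"
  have fab: "f a * f b = f b * f a"
    using arg_cong[OF b(3)[of a], of f] by (simp add: unital_star_homD(4)[OF f] mult.assoc)
  have star: "star (f a) = f a" "star (f b) = f b"
    using unital_star_homD(5)[OF f, of a] unital_star_homD(5)[OF f, of b] a b(2) by simp_all
  have su: "star u = f a - \<i> *\<^sub>C f b"
    by (simp add: u_def star_add star_scaleC star scaleC_minus_left)
  have "f b * f b = 1 - f a * f a"
    using arg_cong[OF b(1), of f] linear_diff[OF unital_star_hom_linear[OF f]]
    by (simp add: unital_star_homD[OF f])
  then have "star u * u = 1"
    unfolding su unfolding u_def
    by (simp add: algebra_simps mult_scaleC_left mult_scaleC_right scaleC_scaleC fab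
        scaleC_minus_left scaleC_diff_right)
  then have "(norm u)\<^sup>2 = 1" using norm_star_mult[of u] by simp
  then have "norm u = 1" using power2_eq_1_iff[of "norm u"] norm_ge_zero[of u] by linarith
  moreover have "2 *\<^sub>R f a = u + star u" unfolding su by (simp add: u_def scaleR_2)
  then have "2 * norm (f a) \<le> norm u + norm (star u)"
    using norm_triangle_ineq[of u "star u"] norm_scaleR[of 2 "f a"] by simp
  ultimately show ?thesis by simp
qed

text \<open>Serves estimates that are available on the open unit ball only. The predicate
  \<open>P\<close> allows a restriction to self-adjoint elements, which real scalars
  preserve.\<close>

lemma norm_le_by_scaling:
  assumes "linear f" and f: "\<And>x. P x \<Longrightarrow> norm x < 1 \<Longrightarrow> norm (f x) \<le> K"
    and P: "\<And>r x. P x \<Longrightarrow> P (r *\<^sub>R x)" "P x"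
  shows "norm (f x) \<le> K * norm x"
proof (rule field_le_epsilon)
  fix e :: real assume "0 < e"
  have "norm (f (0 *\<^sub>R x)) \<le> K" by (intro f P) simp
  then have K: "0 \<le> K" using norm_ge_zero order_trans by blast
  \<comment> \<open>A radius slightly above \<open>norm x\<close> puts the rescaled vector strictly
    inside the ball, also for x = 0; dividing by K + 1 keeps the excess K * e / (K + 1) below e,
    also for K = 0.\<close>
  define r where "r = norm x + e / (K + 1)"
  have r: "0 < r" "norm x < r" using \<open>0 < e\<close> K by (auto simp: r_def add_nonneg_pos)
  have "norm ((1 / r) *\<^sub>R x) < 1" using r by simp
  then have "norm (f ((1 / r) *\<^sub>R x)) \<le> K" by (intro f P)
  moreover have "norm (f ((1 / r) *\<^sub>R x)) = norm (f x) / r"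
    unfolding linear_scale[OF \<open>linear f\<close>] using r by simp
  ultimately have "norm (f x) \<le> K * r" using r by (simp add: divide_le_eq)
  also have "\<dots> = K * norm x + e * (K / (K + 1))" by (simp add: r_def algebra_simps)
  also have "e * (K / (K + 1)) \<le> e * 1" using \<open>0 < e\<close> K by (intro mult_left_mono) auto
  finally show "norm (f x) \<le> K * norm x + e" by simp
qed

text \<open>The C*-identity passes from a to \<open>star a * a\<close>, where the estimate for
  self-adjoint elements applies.\<close>

lemma unital_star_hom_norm_le:
  assumes f: "unital_star_hom f"
  shows "norm (f a) \<le> norm a"
proof -
  have "norm (f (star a * a)) \<le> 1 * norm (star a * a)"
    by (rule norm_le_by_scaling[where P = "\<lambda>x. star x = x"])
      (use f in \<open>auto intro: unital_star_hom_linear unital_star_hom_norm_le_one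
        simp: star_mult star_star star_scaleC simp flip: scaleC_of_real\<close>)
  then have "(norm (f a))\<^sup>2 \<le> (norm a)\<^sup>2"
    by (simp add: unital_star_homD[OF f] norm_star_mult)
  then show ?thesis by (rule power2_le_imp_le) simp
qed

lemma unital_star_hom_bounded_linear: "unital_star_hom f \<Longrightarrow> bounded_linear f"
  using unital_star_hom_linear[of f] unital_star_hom_norm_le[of f]
  by (intro bounded_linear_intro[where K = 1]) (auto simp: linear_add linear_scale)

section \<open>The invariant mean on a compact abelian group\<close>

definition avg :: "'g::ab_group_add list \<Rightarrow> ('g \<Rightarrow> 'v::real_vector) \<Rightarrow> 'g \<Rightarrow> 'v" where
  "avg L f x = (1 / real (length L)) *\<^sub>R (\<Sum>s\<leftarrow>L. f (x + s))"

text \<open>Repeated sums are kept: with multiplicities, averaging over this list is averaging over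
  \<open>K\<close> and then over \<open>L\<close>.\<close>

definition prod_list_add :: "'g::ab_group_add list \<Rightarrow> 'g list \<Rightarrow> 'g list" where
  "prod_list_add L K = concat (map (\<lambda>s. map (\<lambda>t. s + t) K) L)"

lemma prod_list_add_eq_Nil_iff [simp]: "prod_list_add L K = [] \<longleftrightarrow> L = [] \<or> K = []"
  by (cases L) (auto simp: prod_list_add_def)

lemma length_prod_list_add: "length (prod_list_add L K) = length L * length K"
  by (induction L) (simp_all add: prod_list_add_def)

lemma sum_list_prod_list_add:
  "(\<Sum>r\<leftarrow>prod_list_add L K. h r) = (\<Sum>s\<leftarrow>L. \<Sum>t\<leftarrow>K. h (s + t))"
  for h :: "_ \<Rightarrow> 'v::ab_group_add"
  by (induction L) (simp_all add: prod_list_add_def o_def)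

lemma sum_list_swap:
  "(\<Sum>s\<leftarrow>L. \<Sum>t\<leftarrow>K. h s t) = (\<Sum>t\<leftarrow>K. \<Sum>s\<leftarrow>L. h s t)"
  for h :: "_ \<Rightarrow> _ \<Rightarrow> 'v::ab_group_add"
  by (induction L) (simp_all add: sum_list_addf)

lemma sum_list_linear: "linear T \<Longrightarrow> T (\<Sum>s\<leftarrow>L. h s) = (\<Sum>s\<leftarrow>L. T (h s))"
  by (induction L) (simp_all add: linear_0 linear_add)

lemma norm_sum_list_le:
  "(\<And>s. s \<in> set L \<Longrightarrow> norm (h s) \<le> g s) \<Longrightarrow> norm (\<Sum>s\<leftarrow>L. h s) \<le> (\<Sum>s\<leftarrow>L. g s)"
proof (induction L)
  case (Cons s L)
  have "norm (h s + (\<Sum>s\<leftarrow>L. h s)) \<le> norm (h s) + norm (\<Sum>s\<leftarrow>L. h s)"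
    by (rule norm_triangle_ineq)
  also have "\<dots> \<le> g s + (\<Sum>s\<leftarrow>L. g s)" by (intro add_mono Cons) (use Cons in auto)
  finally show ?case by simp
qed simp

lemma avg_prod_list_add: "avg (prod_list_add L K) f x = avg L (avg K f) x"
  unfolding avg_def sum_list_prod_list_add length_prod_list_add
    sum_list_linear[OF linear_scale_self, symmetric]
  by (simp add: add.assoc)

text \<open>Commutativity of the group enters here; it lets one list refine two given ones,
  whichever of them is applied last.\<close>

lemma avg_commute: "avg L (avg K f) x = avg K (avg L f) x"
proof -
  have "(\<Sum>s\<leftarrow>L. \<Sum>t\<leftarrow>K. f (x + s + t)) = (\<Sum>s\<leftarrow>K. \<Sum>t\<leftarrow>L. f (x + s + t))"
    by (subst sum_list_swap) (intro arg_cong[where f = sum_list] map_cong refl, simp add: ac_simps)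
  then show ?thesis
    unfolding avg_def sum_list_linear[OF linear_scale_self, symmetric]
    by (simp add: mult.commute)
qed

lemma avg_add: "avg L (\<lambda>x. f x + g x) x = avg L f x + avg L g x"
  by (simp add: avg_def sum_list_addf scaleR_add_right)

lemma avg_linear: "linear T \<Longrightarrow> avg L (\<lambda>x. T (f x)) x = T (avg L f x)"
  by (simp add: avg_def linear_scale sum_list_linear)

lemma avg_const: "L \<noteq> [] \<Longrightarrow> avg L (\<lambda>x. c) x = c"
proof -
  have "(\<Sum>s\<leftarrow>L. c) = real (length L) *\<^sub>R c"
    by (induction L) (simp_all add: scaleR_left_distrib)
  then show "L \<noteq> [] \<Longrightarrow> avg L (\<lambda>x. c) x = c" by (simp add: avg_def)
qed

lemma norm_avg_le:
  assumes "\<And>x. norm (f x) \<le> g x"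
  shows "norm (avg L f x) \<le> avg L g x"
  using norm_sum_list_le[of L "\<lambda>s. f (x + s)" "\<lambda>s. g (x + s)"] assms
  by (simp add: avg_def divide_right_mono)

lemma norm_avg_diff_le:
  assumes "L \<noteq> []" "\<And>x. norm (f x - w) \<le> e"
  shows "norm (avg L f x - w) \<le> e"
proof -
  have "avg L f x - w = avg L (\<lambda>x. f x - w) x"
    using avg_add[of L f "\<lambda>x. - w" x] avg_const[OF assms(1), of "- w" x] by simp
  also have "norm \<dots> \<le> avg L (\<lambda>x. e) x" by (rule norm_avg_le) (rule assms)
  finally show ?thesis by (simp add: avg_const assms)
qed

section \<open>Uniform approximation of constants by averages\<close>

definition avg_near :: "'g::ab_group_add list \<Rightarrow> ('g \<Rightarrow> 'v::real_normed_vector) \<Rightarrow> 'v \<Rightarrow> real \<Rightarrow> bool" where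
  "avg_near L f w e \<longleftrightarrow> L \<noteq> [] \<and> (\<forall>x. norm (avg L f x - w) \<le> e)"

text \<open>The estimate is uniform in x, so it survives any further averaging. Therefore two
  functions always have a common list, which is how uniqueness and additivity of the mean are
  obtained.\<close>

lemma avg_near_prod1: "avg_near L f w e \<Longrightarrow> K \<noteq> [] \<Longrightarrow> avg_near (prod_list_add K L) f w e"
  by (simp add: avg_near_def avg_prod_list_add norm_avg_diff_le)

lemma avg_near_prod2: "avg_near L f w e \<Longrightarrow> K \<noteq> [] \<Longrightarrow> avg_near (prod_list_add L K) f w e"
  by (simp add: avg_near_def avg_prod_list_add norm_avg_diff_le avg_commute[of L K])

text \<open>The Haar integral of f, described without a measure.\<close>

definition has_mean :: "('g::ab_group_add \<Rightarrow> 'v::real_normed_vector) \<Rightarrow> 'v \<Rightarrow> bool" where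
  "has_mean f w \<longleftrightarrow> (\<forall>e>0. \<exists>L. avg_near L f w e)"

lemma has_mean_common:
  assumes "has_mean f w" "has_mean g u" "e > 0"
  obtains L where "avg_near L f w e" "avg_near L g u e"
proof -
  obtain L K where "avg_near L f w e" "avg_near K g u e" using assms unfolding has_mean_def by blast
  moreover from this have "L \<noteq> []" "K \<noteq> []" by (simp_all add: avg_near_def)
  ultimately show ?thesis using that[of "prod_list_add L K"] avg_near_prod1 avg_near_prod2 by blast
qed

lemma has_mean_unique:
  assumes "has_mean f w" "has_mean f u"
  shows "w = u"
proof -
  have "dist w u \<le> 0"
  proof (rule field_le_epsilon)
    fix e :: real assume "e > 0"
    then obtain L where "avg_near L f w (e / 2)" "avg_near L f u (e / 2)"
      using has_mean_common[OF assms, of "e / 2"] half_gt_zero by blast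
    then have "norm (avg L f 0 - w) \<le> e / 2" "norm (avg L f 0 - u) \<le> e / 2"
      by (simp_all add: avg_near_def)
    then show "dist w u \<le> 0 + e"
      using norm_triangle_ineq4[of "avg L f 0 - u" "avg L f 0 - w"] by (simp add: dist_norm)
  qed
  then show ?thesis by simp
qed

lemma has_mean_add:
  assumes "has_mean f w" "has_mean g u"
  shows "has_mean (\<lambda>x. f x + g x) (w + u)"
  unfolding has_mean_def
proof (intro allI impI)
  fix e :: real assume "e > 0"
  then obtain L where L: "avg_near L f w (e / 2)" "avg_near L g u (e / 2)"
    using has_mean_common[OF assms, of "e / 2"] half_gt_zero by blast
  have "norm (avg L (\<lambda>x. f x + g x) x - (w + u)) \<le> e" for x
  proof -
    have "norm (avg L f x - w) \<le> e / 2" "norm (avg L g x - u) \<le> e / 2"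
      using L by (simp_all add: avg_near_def)
    then show ?thesis
      using norm_diff_triangle_ineq[of "avg L f x" "avg L g x" w u] by (simp add: avg_add)
  qed
  with L show "\<exists>L. avg_near L (\<lambda>x. f x + g x) (w + u) e" by (auto simp: avg_near_def)
qed

lemma has_mean_const: "has_mean (\<lambda>x. c) c"
  by (auto simp: has_mean_def avg_near_def avg_const intro!: exI[of _ "[0]"])

lemma has_mean_bounded_linear:
  assumes "bounded_linear T" "has_mean f w"
  shows "has_mean (\<lambda>x. T (f x)) (T w)"
  unfolding has_mean_def
proof (intro allI impI)
  fix e :: real assume "e > 0"
  interpret T: bounded_linear T by fact
  obtain K where K: "K > 0" "\<And>x. norm (T x) \<le> norm x * K" using T.pos_bounded by blast
  obtain L where L: "avg_near L f w (e / K)"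
    using assms(2) \<open>e > 0\<close> K(1) unfolding has_mean_def by (meson divide_pos_pos)
  have "norm (avg L (\<lambda>x. T (f x)) x - T w) \<le> e" for x
  proof -
    have "norm (avg L (\<lambda>x. T (f x)) x - T w) \<le> norm (avg L f x - w) * K"
      using K(2)[of "avg L f x - w"] by (simp add: avg_linear T.linear T.diff)
    also have "\<dots> \<le> e / K * K" using L K(1) by (intro mult_right_mono) (auto simp: avg_near_def)
    finally show ?thesis using K(1) by simp
  qed
  with L show "\<exists>L. avg_near L (\<lambda>x. T (f x)) (T w) e" by (auto simp: avg_near_def)
qed

lemma has_mean_shift: "has_mean f w \<Longrightarrow> has_mean (\<lambda>x. f (x + a)) w"
proof -
  have "avg L (\<lambda>x. f (x + a)) x = avg L f (x + a)" for L x by (simp add: avg_def ac_simps)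
  then have "avg_near L f w e \<Longrightarrow> avg_near L (\<lambda>x. f (x + a)) w e" for L e
    unfolding avg_near_def by simp
  then show "has_mean f w \<Longrightarrow> has_mean (\<lambda>x. f (x + a)) w"
    unfolding has_mean_def by blast
qed

lemma has_mean_uminus: "has_mean f w \<Longrightarrow> has_mean (\<lambda>x. f (- x)) w"
proof -
  have "avg (map uminus L) (\<lambda>x. f (- x)) x = avg L f (- x)" for L x
    by (simp add: avg_def o_def)
  then have "avg_near L f w e \<Longrightarrow> avg_near (map uminus L) (\<lambda>x. f (- x)) w e" for L e
    unfolding avg_near_def by simp
  then show "has_mean f w \<Longrightarrow> has_mean (\<lambda>x. f (- x)) w"
    unfolding has_mean_def by blast
qed

lemma has_mean_norm_le:
  assumes "\<And>x. norm (f x) \<le> g x" "has_mean f w" "has_mean g c"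
  shows "norm w \<le> c"
proof (rule field_le_epsilon)
  fix e :: real assume "e > 0"
  then obtain L where "avg_near L f w (e / 2)" "avg_near L g c (e / 2)"
    using has_mean_common[OF assms(2,3), of "e / 2"] half_gt_zero by blast
  then have "norm (avg L f 0 - w) \<le> e / 2" "norm (avg L g 0 - c) \<le> e / 2"
    unfolding avg_near_def by blast+
  moreover have "norm (avg L f 0) \<le> avg L g 0" by (rule norm_avg_le) (rule assms(1))
  ultimately show "norm w \<le> c + e"
    using norm_triangle_ineq2[of w "avg L f 0"] norm_minus_commute[of w "avg L f 0"]
    unfolding real_norm_def by linarith
qed

lemma has_mean_sum_list:
  "(\<And>s. s \<in> set L \<Longrightarrow> has_mean (f s) (w s)) \<Longrightarrow> has_mean (\<lambda>x. \<Sum>s\<leftarrow>L. f s x) (\<Sum>s\<leftarrow>L. w s)"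
  by (induction L) (simp_all add: has_mean_add has_mean_const)

text \<open>Fubini's theorem in one direction: take the mean over y of the average of f over a list
  of pairs. Shift invariance in y removes the second components and leaves the average of
  \<open>F\<close> over the first components, uniformly close to w.\<close>

lemma has_mean_iterated:
  fixes f :: "'a::ab_group_add \<times> 'b::ab_group_add \<Rightarrow> 'v::real_normed_vector"
  assumes f: "has_mean f w" and F: "\<And>x. has_mean (\<lambda>y. f (x, y)) (F x)"
  shows "has_mean F w"
  unfolding has_mean_def
proof (intro allI impI)
  fix e :: real assume "e > 0"
  then obtain L where L: "avg_near L f w e" using f unfolding has_mean_def by blast
  have "norm (avg (map fst L) F x - w) \<le> e" for x
  proof -
    have "has_mean (\<lambda>y. f (x + s, y + t)) (F (x + s))" for s t
      by (rule has_mean_shift[OF F])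
    then have "has_mean (\<lambda>y. \<Sum>s\<leftarrow>L. f (x + fst s, y + snd s)) (\<Sum>s\<leftarrow>L. F (x + fst s))"
      by (intro has_mean_sum_list)
    then have "has_mean (\<lambda>y. (1 / real (length L)) *\<^sub>R (\<Sum>s\<leftarrow>L. f (x + fst s, y + snd s)))
        ((1 / real (length L)) *\<^sub>R (\<Sum>s\<leftarrow>L. F (x + fst s)))"
      by (rule has_mean_bounded_linear[OF bounded_linear_scaleR_right])
    then have "has_mean (\<lambda>y. avg L f (x, y)) (avg (map fst L) F x)"
      by (simp add: avg_def plus_prod_def o_def)
    from has_mean_add[OF this has_mean_const[of "- w"]]
    have "has_mean (\<lambda>y. avg L f (x, y) - w) (avg (map fst L) F x - w)"
      by (simp only: add_uminus_conv_diff)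
    then show ?thesis
      by (rule has_mean_norm_le[OF _ _ has_mean_const, rotated]) (use L in \<open>auto simp: avg_near_def\<close>)
  qed
  with L show "\<exists>L. avg_near L F w e"
    unfolding avg_near_def by (intro exI[of _ "map fst L"]) auto
qed

lemma has_mean_prod_swap:
  assumes "has_mean f w"
  shows "has_mean (\<lambda>p. f (snd p, fst p)) w"
proof -
  have "avg (map prod.swap L) (\<lambda>p. f (snd p, fst p)) p = avg L f (snd p, fst p)" for L p
    by (simp add: avg_def o_def plus_prod_def)
  then have "avg_near L f w e \<Longrightarrow> avg_near (map prod.swap L) (\<lambda>p. f (snd p, fst p)) w e" for L e
    unfolding avg_near_def by simp
  then show ?thesis using assms unfolding has_mean_def by blast
qed

definition mean :: "('g::ab_group_add \<Rightarrow> 'v::real_normed_vector) \<Rightarrow> 'v" where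
  "mean f = (THE w. has_mean f w)"

lemma mean_eqI: "has_mean f w \<Longrightarrow> mean f = w"
  unfolding mean_def using has_mean_unique by blast

text \<open>Bohr's notion, phrased so that no topology on the group is needed: this way it applies to
  the product of two topological groups, which is not an instance of the class of topological
  groups.\<close>

definition almost_periodic :: "('g::ab_group_add \<Rightarrow> 'v::real_normed_vector) \<Rightarrow> bool" where
  "almost_periodic f \<longleftrightarrow> (\<forall>e>0. \<exists>U T. (\<forall>u\<in>U. \<forall>x. norm (f (x + u) - f x) \<le> e) \<and>
     T \<noteq> [] \<and> (\<forall>x. \<exists>t\<in>set T. x + t \<in> U))"

text \<open>The tube lemma, applied to the difference of f (x + u) and f x on the product, gives one
  neighbourhood \<open>U\<close> of 0 that serves all x; compactness covers the group by finitely
  many translates of \<open>U\<close>.\<close>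

lemma almost_periodicI:
  fixes f :: "'g::{topological_space,ab_group_add} \<Rightarrow> 'v::real_normed_vector"
  assumes add: "continuous_on UNIV (\<lambda>p::'g \<times> 'g. fst p + snd p)"
    and compact: "compact (UNIV :: 'g set)" and f: "continuous_on UNIV f"
  shows "almost_periodic f"
  unfolding almost_periodic_def
proof (intro allI impI)
  fix e :: real assume "e > 0"
  have cont: "continuous_on UNIV (\<lambda>p::'g \<times> 'g. norm (f (fst p + snd p) - f (fst p)))"
    by (intro continuous_intros continuous_on_compose2[OF f] add) auto
  define W where "W = {p::'g \<times> 'g. norm (f (fst p + snd p) - f (fst p)) < e}"
  have "open W"
    unfolding W_def by (intro open_Collect_less cont continuous_intros)
  then have "\<exists>A U. openin euclidean A \<and> openin euclidean U \<and> UNIV \<subseteq> A \<and> 0 \<in> U \<and> A \<times> U \<subseteq> W"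
    using compact \<open>e > 0\<close>
    by (intro tube_lemma_left) (auto simp: W_def euclidean_product_topology)
  then obtain A U where AU: "openin euclidean U" "UNIV \<subseteq> A" "0 \<in> U" "A \<times> U \<subseteq> W"
    by (elim exE conjE)
  then have U: "open U" "0 \<in> U" by simp_all
  have close: "norm (f (x + u) - f x) \<le> e" if "u \<in> U" for x u
  proof -
    have "(x, u) \<in> W" using AU(2,4) that by (simp add: subset_eq)
    then show ?thesis by (simp add: W_def)
  qed
  have "open {x. x + t \<in> U}" for t
    using open_vimage[OF U(1) continuous_on_compose2[OF add, of UNIV "\<lambda>x. (x, t)"]]
    by (simp add: vimage_def continuous_on_Pair)
  moreover have "UNIV \<subseteq> (\<Union>t. {x. x + t \<in> U})"
  proof
    fix x show "x \<in> (\<Union>t. {x. x + t \<in> U})"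
      using U(2) by (auto intro!: exI[of _ "- x"])
  qed
  ultimately obtain C where C: "finite C" "UNIV \<subseteq> (\<Union>t\<in>C. {x. x + t \<in> U})"
    using compactE_image[OF compact, of UNIV "\<lambda>t. {x. x + t \<in> U}"] by auto
  obtain T where T: "set T = C" using finite_list[OF C(1)] by blast
  have "\<forall>x. \<exists>t\<in>set T. x + t \<in> U" using C(2) T by blast
  moreover from this have "T \<noteq> []" by auto
  ultimately show "\<exists>U T. (\<forall>u\<in>U. \<forall>x. norm (f (x + u) - f x) \<le> e) \<and>
      T \<noteq> [] \<and> (\<forall>x. \<exists>t\<in>set T. x + t \<in> U)"
    using close by blast
qed

text \<open>For every x the orbit x + T meets U.  When comparing the averages of f over x + T and y + T
  one can therefore pair up two points at which f nearly takes the value f 0; the other pairs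
  contribute at most the old oscillation d.\<close>

lemma oscillation_avg_le:
  fixes f :: "'g::ab_group_add \<Rightarrow> 'v::real_normed_vector"
  assumes U: "\<And>u. u \<in> U \<Longrightarrow> norm (f u - f 0) \<le> e"
    and T: "T \<noteq> []" "\<And>x. \<exists>t\<in>set T. x + t \<in> U"
    and d: "\<And>x y. norm (f x - f y) \<le> d"
  shows "norm (avg T f x - avg T f y) \<le> ((real (length T) - 1) * d + 2 * e) / real (length T)"
proof -
  let ?n = "length T"
  obtain i where i: "i < ?n" "x + T ! i \<in> U" using T(2) by (metis in_set_conv_nth)
  obtain j where j: "j < ?n" "y + T ! j \<in> U" using T(2) by (metis in_set_conv_nth)
  define p where "p = Transposition.transpose i j"
  have p: "p permutes {..<?n}" unfolding p_def using i(1) j(1) by (intro permutes_swap_id) auto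
  have index: "(\<Sum>s\<leftarrow>T. f (z + s)) = (\<Sum>k<?n. f (z + T ! k))" for z
    by (simp add: sum_list_sum_nth atLeast0LessThan)
  have close: "norm (f (x + T ! i) - f (y + T ! p i)) \<le> 2 * e"
    using U[OF i(2)] U[OF j(2)] norm_triangle_ineq4[of "f (x + T ! i) - f 0" "f (y + T ! j) - f 0"]
    by (simp add: p_def)
  have "(\<Sum>s\<leftarrow>T. f (x + s)) - (\<Sum>s\<leftarrow>T. f (y + s)) = (\<Sum>k<?n. f (x + T ! k) - f (y + T ! p k))"
    using sum.permute[OF p, of "\<lambda>k. f (y + T ! k)"] by (simp add: index sum_subtractf o_def)
  also have "norm \<dots> \<le> (\<Sum>k<?n. if k = i then 2 * e else d)"
    using close d by (intro sum_norm_le) auto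
  also have "\<dots> = (\<Sum>k<?n. d + (if k = i then 2 * e - d else 0))" by (intro sum.cong) auto
  also have "\<dots> = (real ?n - 1) * d + 2 * e"
    using i(1) by (simp add: sum.distrib algebra_simps)
  finally have "norm ((\<Sum>s\<leftarrow>T. f (x + s)) - (\<Sum>s\<leftarrow>T. f (y + s))) / real ?n
      \<le> ((real ?n - 1) * d + 2 * e) / real ?n"
    by (rule divide_right_mono) simp
  moreover have "avg T f x - avg T f y = (1 / real ?n) *\<^sub>R ((\<Sum>s\<leftarrow>T. f (x + s)) - (\<Sum>s\<leftarrow>T. f (y + s)))"
    by (simp only: avg_def scaleR_diff_right)
  ultimately show ?thesis by simp
qed

text \<open>Were the infimum m of the oscillations of averages positive, one more average would push
  an almost optimal oscillation below m.\<close>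

lemma exists_small_oscillation:
  fixes f :: "'g::ab_group_add \<Rightarrow> 'v::real_normed_vector"
  assumes f: "almost_periodic f" and bounded: "\<And>x y. norm (f x - f y) \<le> B" and "e > 0"
  obtains L where "L \<noteq> []" "\<And>x y. norm (avg L f x - avg L f y) \<le> e"
proof -
  define D where "D = {d. \<exists>L. L \<noteq> [] \<and> (\<forall>x y. norm (avg L f x - avg L f y) \<le> d)}"
  have "B \<in> D" unfolding D_def using bounded by (auto intro!: exI[of _ "[0]"] simp: avg_def)
  have nonneg: "0 \<le> d" if "d \<in> D" for d
    using that norm_ge_zero order_trans unfolding D_def by blast
  then have bdd: "bdd_below D" by (auto simp: bdd_below_def)
  have "Inf D \<le> 0"
  proof (rule ccontr)
    assume "\<not> Inf D \<le> 0"
    define m where "m = Inf D"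
    have m: "0 < m" "\<And>d. d \<in> D \<Longrightarrow> m \<le> d"
      using \<open>\<not> Inf D \<le> 0\<close> bdd by (auto simp: m_def intro: cInf_lower)
    obtain U T where UT: "\<And>u x. u \<in> U \<Longrightarrow> norm (f (x + u) - f x) \<le> m / 8"
      "T \<noteq> []" "\<And>x. \<exists>t\<in>set T. x + t \<in> U"
      using f[unfolded almost_periodic_def, rule_format, of "m / 8"] m(1) by auto
    define n where "n = real (length T)"
    have n: "1 \<le> n" using UT(2) by (simp add: n_def Suc_leI)
    \<comment> \<open>\<open>n\<close> is already fixed by m, so d may be chosen within m / (4 * n)
      of m. The n - 1 ordinary pairs then cost at most (n - 1) * m + m / 4 and the close pair 2 * m
      / 8, altogether at most n * m - m / 2.\<close>
    have "Inf D < m + m / (4 * n)" using m(1) n by (simp add: m_def)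
    then obtain d where "d \<in> D" "d < m + m / (4 * n)"
      using cInf_lessD[of D] \<open>B \<in> D\<close> by blast
    then obtain L where L: "L \<noteq> []" "\<And>x y. norm (avg L f x - avg L f y) \<le> d" by (auto simp: D_def)
    \<comment> \<open>Averaging commutes with translation, so \<open>U\<close> and \<open>T\<close>,
      chosen for f, serve \<open>avg L f\<close> as well.\<close>
    have "norm (avg L f u - avg L f 0) \<le> m / 8" if "u \<in> U" for u
    proof -
      have "avg L (\<lambda>x. f (x + u)) 0 - avg L f 0 = avg L (\<lambda>x. f (x + u) - f x) 0"
        by (simp add: avg_def sum_list_subtractf scaleR_diff_right)
      then have "norm (avg L (\<lambda>x. f (x + u)) 0 - avg L f 0) \<le> m / 8"
        using norm_avg_diff_le[OF L(1), of "\<lambda>x. f (x + u) - f x" 0 "m / 8" 0] UT(1)[OF that] by simp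
      then show ?thesis by (simp add: avg_def add.commute)
    qed
    from oscillation_avg_le[of U "avg L f", OF this UT(2,3) L(2)]
    have "norm (avg T (avg L f) x - avg T (avg L f) y) \<le> ((n - 1) * d + m / 4) / n" for x y
      by (simp add: n_def)
    then have "((n - 1) * d + m / 4) / n \<in> D"
      unfolding D_def using L(1) UT(2)
      by (auto simp: avg_prod_list_add intro!: exI[of _ "prod_list_add T L"])
    then have "m * n \<le> (n - 1) * d + m / 4" using m(2) n by (fastforce simp: field_simps)
    also have "\<dots> \<le> (n - 1) * (m + m / (4 * n)) + m / 4"
      using \<open>d < m + m / (4 * n)\<close> n by (intro add_right_mono mult_left_mono) auto
    also have "\<dots> \<le> m * n - m / 2" using n m(1) by (simp add: field_simps)
    finally show False using m(1) by simp
  qed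
  then obtain d where "d \<in> D" "d < e"
    using cInf_lessD[of D e] \<open>B \<in> D\<close> \<open>e > 0\<close> by fastforce
  then obtain L where "L \<noteq> []" "\<And>x y. norm (avg L f x - avg L f y) \<le> d" by (auto simp: D_def)
  with \<open>d < e\<close> show ?thesis by (intro that[of L]) (meson order_trans less_imp_le)+
qed

text \<open>The centres \<open>w m\<close> and \<open>w k\<close> are both close to the average over
  the combined list, hence close to each other; their limit is the mean.\<close>

lemma has_mean_exists:
  fixes f :: "'g::ab_group_add \<Rightarrow> 'v::banach"
  assumes f: "almost_periodic f" and bounded: "\<And>x y. norm (f x - f y) \<le> B"
  shows "\<exists>w. has_mean f w"
proof -
  have "\<forall>m. \<exists>L. L \<noteq> [] \<and> (\<forall>x y. norm (avg L f x - avg L f y) \<le> 1 / real (Suc m))"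
  proof
    fix m
    obtain L where "L \<noteq> []" "\<And>x y. norm (avg L f x - avg L f y) \<le> 1 / real (Suc m)"
      using exists_small_oscillation[OF f bounded, of "1 / real (Suc m)"] by auto
    then show "\<exists>L. L \<noteq> [] \<and> (\<forall>x y. norm (avg L f x - avg L f y) \<le> 1 / real (Suc m))" by blast
  qed
  then obtain L where L: "\<And>m. L m \<noteq> []"
    "\<And>m x y. norm (avg (L m) f x - avg (L m) f y) \<le> 1 / real (Suc m)" by metis
  define w where "w m = avg (L m) f 0" for m
  have near: "avg_near (L m) f (w m) (1 / real (Suc m))" for m
    using L by (simp add: avg_near_def w_def)
  have dist: "norm (w m - w k) \<le> 1 / real (Suc m) + 1 / real (Suc k)" for m k
  proof -
    let ?P = "avg (prod_list_add (L m) (L k)) f 0"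
    have "norm (?P - w m) \<le> 1 / real (Suc m)" "norm (?P - w k) \<le> 1 / real (Suc k)"
      using avg_near_prod2[OF near L(1)] avg_near_prod1[OF near L(1)] by (auto simp: avg_near_def)
    then show ?thesis using norm_triangle_ineq4[of "?P - w k" "?P - w m"] by simp
  qed
  have "Cauchy w"
  proof (rule metric_CauchyI)
    fix e :: real assume "e > 0"
    then obtain N where N: "1 / real (Suc N) < e / 2" using nat_approx_posE[of "e / 2"] by auto
    have "dist (w m) (w k) < e" if "m \<ge> N" "k \<ge> N" for m k
    proof -
      have "1 / real (Suc j) \<le> 1 / real (Suc N)" if "j \<ge> N" for j using that by (simp add: frac_le)
      from this[OF that(1)] this[OF that(2)] N dist[of m k] show ?thesis by (simp add: dist_norm)
    qed
    then show "\<exists>N. \<forall>m\<ge>N. \<forall>k\<ge>N. dist (w m) (w k) < e" by blast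
  qed
  then obtain u where u: "w \<longlonglongrightarrow> u" using Cauchy_convergent convergent_def by blast
  have "has_mean f u"
    unfolding has_mean_def
  proof (intro allI impI)
    fix e :: real assume "e > 0"
    then have "\<forall>\<^sub>F m in sequentially. dist (w m) u < e / 2"
      using u by (intro tendstoD) auto
    moreover have "\<forall>\<^sub>F m in sequentially. 1 / real (Suc m) < e / 2"
      using \<open>e > 0\<close> LIMSEQ_inverse_real_of_nat
      by (intro order_tendstoD(2)[of _ 0]) (auto simp: inverse_eq_divide)
    ultimately obtain m where m: "dist (w m) u < e / 2" "1 / real (Suc m) < e / 2"
      using eventually_happens[OF eventually_conj] by force
    have "norm (avg (L m) f x - u) \<le> e" for x
    proof -
      have "norm (avg (L m) f x - w m) \<le> 1 / real (Suc m)" using near by (auto simp: avg_near_def)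
      with m show ?thesis
        using norm_triangle_ineq[of "avg (L m) f x - w m" "w m - u"] by (simp add: dist_norm)
    qed
    with L(1) show "\<exists>L. avg_near L f u e" by (auto simp: avg_near_def)
  qed
  then show ?thesis ..
qed

section \<open>The mean of continuous functions on a compact abelian group\<close>

locale compact_ab_group =
  fixes G :: "'g::topological_ab_group_add itself"
  assumes compact_UNIV: "compact (UNIV :: 'g set)"
begin

lemma bounded_continuous:
  fixes f :: "'g \<Rightarrow> 'v::real_normed_vector"
  assumes "continuous_on UNIV f"
  obtains B where "\<And>x. norm (f x) \<le> B"
proof -
  have "bounded (range f)"
    using compact_imp_bounded[OF compact_continuous_image[OF assms compact_UNIV]] .
  then obtain B where "\<forall>x. norm (f x) \<le> B" by (auto simp: bounded_iff)
  then show ?thesis using that by blast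
qed

lemma has_mean_mean:
  fixes f :: "'g \<Rightarrow> 'v::banach"
  assumes f: "continuous_on UNIV f"
  shows "has_mean f (mean f)"
proof -
  obtain B where B: "\<And>x. norm (f x) \<le> B" using bounded_continuous[OF f] by blast
  have "norm (f x - f y) \<le> B + B" for x y
    using norm_triangle_ineq4[of "f x" "f y"] B[of x] B[of y] by linarith
  moreover have "almost_periodic f"
    by (intro almost_periodicI compact_UNIV f continuous_intros)
  ultimately have "\<exists>w. has_mean f w" by (rule has_mean_exists[rotated])
  then show ?thesis using mean_eqI by blast
qed

lemma mean_add:
  fixes f g :: "'g \<Rightarrow> 'v::banach"
  shows "continuous_on UNIV f \<Longrightarrow> continuous_on UNIV g \<Longrightarrow> mean (\<lambda>x. f x + g x) = mean f + mean g"
  by (rule mean_eqI[OF has_mean_add[OF has_mean_mean has_mean_mean]])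

lemma mean_const: "mean (\<lambda>x::'g. c) = c"
  by (rule mean_eqI[OF has_mean_const])

lemma mean_bounded_linear:
  fixes f :: "'g \<Rightarrow> 'v::banach"
  shows "bounded_linear T \<Longrightarrow> continuous_on UNIV f \<Longrightarrow> mean (\<lambda>x. T (f x)) = T (mean f)"
  by (rule mean_eqI[OF has_mean_bounded_linear[OF _ has_mean_mean]])

lemma mean_diff:
  fixes f g :: "'g \<Rightarrow> 'v::banach"
  assumes "continuous_on UNIV f" "continuous_on UNIV g"
  shows "mean (\<lambda>x. f x - g x) = mean f - mean g"
  using mean_add[OF assms(1) continuous_on_minus[OF assms(2)]]
    mean_bounded_linear[OF bounded_linear_minus[OF bounded_linear_ident] assms(2)] by simp

lemma mean_shift:
  fixes f :: "'g \<Rightarrow> 'v::banach"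
  shows "continuous_on UNIV f \<Longrightarrow> mean (\<lambda>x. f (x + a)) = mean f"
  by (rule mean_eqI[OF has_mean_shift[OF has_mean_mean]])

lemma mean_reflect:
  fixes f :: "'g \<Rightarrow> 'v::banach"
  assumes "continuous_on UNIV f"
  shows "mean (\<lambda>x. f (a - x)) = mean f"
  using mean_eqI[OF has_mean_uminus[OF has_mean_shift[OF has_mean_mean[OF assms], of a]]]
  by simp

lemma norm_mean_le:
  fixes f :: "'g \<Rightarrow> 'v::banach"
  assumes "continuous_on UNIV f" "continuous_on UNIV g" "\<And>x. norm (f x) \<le> g x"
  shows "norm (mean f) \<le> mean g"
  by (rule has_mean_norm_le[OF _ has_mean_mean[OF assms(1)] has_mean_mean[OF assms(2)]])
    (rule assms(3))

lemma mean_mono: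
  fixes f g :: "'g \<Rightarrow> real"
  assumes "continuous_on UNIV f" "continuous_on UNIV g" "\<And>x. f x \<le> g x"
  shows "mean f \<le> mean g"
proof -
  have "norm (mean (\<lambda>x::'g. 0::real)) \<le> mean (\<lambda>x. g x - f x)"
    by (rule norm_mean_le[OF continuous_on_const continuous_on_diff[OF assms(2,1)]])
      (simp add: assms(3))
  then show ?thesis unfolding mean_diff[OF assms(2,1)] by simp
qed

lemma mean_nonneg:
  fixes f :: "'g \<Rightarrow> real"
  assumes "continuous_on UNIV f" "\<And>x. 0 \<le> f x"
  shows "0 \<le> mean f"
  using mean_mono[OF continuous_on_const assms] unfolding mean_const .

text \<open>Faithfulness: almost periodicity provides finitely many translates of f whose sum is at
  least f a / 2 everywhere, and each of them has the mean of f.\<close>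

lemma mean_positive:
  fixes f :: "'g \<Rightarrow> real"
  assumes f: "continuous_on UNIV f" "\<And>x. 0 \<le> f x" "f a > 0"
  shows "mean f > 0"
proof -
  have "almost_periodic f"
    by (intro almost_periodicI compact_UNIV f continuous_intros)
  then obtain U T where UT: "\<And>u x. u \<in> U \<Longrightarrow> norm (f (x + u) - f x) \<le> f a / 2"
      "T \<noteq> []" "\<And>x. \<exists>t\<in>set T. x + t \<in> U"
    unfolding almost_periodic_def using half_gt_zero[OF f(3)] by meson
  have low: "f a / 2 \<le> (\<Sum>t\<leftarrow>T. f (x + (a + t)))" for x
  proof -
    obtain t where t: "t \<in> set T" "x + t \<in> U" using UT(3) by blast
    have "\<bar>f (a + (x + t)) - f a\<bar> \<le> f a / 2" using UT(1)[OF t(2), of a] by simp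
    then have "f a / 2 \<le> f (a + (x + t))" by linarith
    then have "f a / 2 \<le> f (x + (a + t))" by (simp only: add.left_commute)
    also have "\<dots> \<le> (\<Sum>t\<leftarrow>T. f (x + (a + t)))"
      using t(1) f(2) by (intro member_le_sum_list) auto
    finally show ?thesis .
  qed
  have sum: "has_mean (\<lambda>x. \<Sum>t\<leftarrow>T. f (x + (a + t))) (\<Sum>t\<leftarrow>T. mean f)"
    by (rule has_mean_sum_list, rule has_mean_shift, rule has_mean_mean[OF f(1)])
  have "norm (f a / 2) \<le> (\<Sum>t\<leftarrow>T. mean f)"
    by (rule has_mean_norm_le[where f = "\<lambda>x::'g. f a / 2", OF _ has_mean_const sum])
      (use low f(3) in simp)
  then have "0 < real (length T) * mean f" using f(3) by (simp add: sum_list_triv)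
  then show ?thesis by (simp add: zero_less_mult_iff)
qed

lemma has_mean_product:
  fixes f :: "'g \<Rightarrow> 'g \<Rightarrow> 'v::banach"
  assumes f: "continuous_on UNIV (\<lambda>p. f (fst p) (snd p))"
  shows "has_mean (\<lambda>p. f (fst p) (snd p)) (mean (\<lambda>p. f (fst p) (snd p)))"
proof -
  have compact: "compact (UNIV :: ('g \<times> 'g) set)"
    using compact_Times[OF compact_UNIV compact_UNIV] by simp
  have "bounded (range (\<lambda>p. f (fst p) (snd p)))"
    using compact_imp_bounded[OF compact_continuous_image[OF f compact]] .
  then obtain B where B: "\<forall>p. norm (f (fst p) (snd p)) \<le> B" by (auto simp: bounded_iff)
  have "norm (f (fst p) (snd p) - f (fst q) (snd q)) \<le> B + B" for p q
    using norm_triangle_ineq4[of "f (fst p) (snd p)" "f (fst q) (snd q)"]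
      B[rule_format, of p] B[rule_format, of q] by linarith
  moreover have "almost_periodic (\<lambda>p. f (fst p) (snd p))"
    by (intro almost_periodicI compact f) (unfold plus_prod_def, intro continuous_intros)
  ultimately have "\<exists>w. has_mean (\<lambda>p. f (fst p) (snd p)) w" by (rule has_mean_exists[rotated])
  then show ?thesis using mean_eqI by blast
qed

lemma has_mean_iterated_mean:
  fixes f :: "'g \<Rightarrow> 'g \<Rightarrow> 'v::banach"
  assumes f: "continuous_on UNIV (\<lambda>p. f (fst p) (snd p))"
  shows "has_mean (\<lambda>x. mean (f x)) (mean (\<lambda>p. f (fst p) (snd p)))"
proof (rule has_mean_iterated[OF has_mean_product[OF f]])
  show "has_mean (\<lambda>y. f (fst (x, y)) (snd (x, y))) (mean (f x))" for x
    using has_mean_mean[OF continuous_on_compose2[OF f, of UNIV "\<lambda>y. (x, y)"]]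
    by (simp add: continuous_on_Pair)
qed

text \<open>Both iterated means agree with the mean over the product group, whose existence rests on
  almost periodicity on pairs.\<close>

lemma mean_swap:
  fixes f :: "'g \<Rightarrow> 'g \<Rightarrow> 'v::banach"
  assumes f: "continuous_on UNIV (\<lambda>p. f (fst p) (snd p))"
  shows "mean (\<lambda>x. mean (\<lambda>y. f x y)) = mean (\<lambda>y. mean (\<lambda>x. f x y))"
proof -
  have f': "continuous_on UNIV (\<lambda>p::'g \<times> 'g. f (snd p) (fst p))"
    using continuous_on_compose2[OF f, of UNIV "\<lambda>p. (snd p, fst p)"]
    by (simp add: continuous_on_Pair continuous_on_fst continuous_on_snd)
  have "mean (\<lambda>y. mean (\<lambda>x. f x y)) = mean (\<lambda>p. f (snd p) (fst p))"
    by (rule mean_eqI[OF has_mean_iterated_mean[of "\<lambda>x y. f y x", OF f']])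
  also have "\<dots> = mean (\<lambda>p. f (fst p) (snd p))"
    using has_mean_prod_swap[OF has_mean_product[OF f]] by (intro mean_eqI) simp
  also have "\<dots> = mean (\<lambda>x. mean (f x))"
    by (rule mean_eqI[OF has_mean_iterated_mean[OF f], symmetric])
  finally show ?thesis ..
qed

text \<open>By the tube lemma \<open>f x\<close> is uniformly close to \<open>f a\<close> for x near
  a, and the mean is a contraction for the uniform norm.\<close>

lemma continuous_on_mean:
  fixes f :: "'a::topological_space \<Rightarrow> 'g \<Rightarrow> 'v::banach"
  assumes f: "continuous_on UNIV (\<lambda>p. f (fst p) (snd p))"
  shows "continuous_on UNIV (\<lambda>x. mean (f x))"
  unfolding continuous_on_def
proof (intro ballI tendstoI)
  fix a :: 'a and e :: real assume "e > 0"
  have fx: "continuous_on UNIV (f x)" for x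
    using continuous_on_compose2[OF f, of UNIV "\<lambda>y. (x, y)"] by (simp add: continuous_on_Pair)
  define W where "W = {p. norm (f (fst p) (snd p) - f a (snd p)) < e / 2}"
  have "open W"
    unfolding W_def by (intro open_Collect_less continuous_intros f continuous_on_compose2[OF fx]) auto
  then have "\<exists>A B. openin euclidean A \<and> openin euclidean B \<and> a \<in> A \<and> UNIV \<subseteq> B \<and> A \<times> B \<subseteq> W"
    using compact_UNIV \<open>e > 0\<close>
    by (intro tube_lemma_right) (auto simp: W_def euclidean_product_topology)
  then obtain A B where AB: "openin euclidean A" "a \<in> A" "UNIV \<subseteq> B" "A \<times> B \<subseteq> W"
    by (elim exE conjE)
  then have A: "open A" "a \<in> A" by simp_all
  have close: "norm (f x y - f a y) \<le> e / 2" if "x \<in> A" for x y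
  proof -
    have "(x, y) \<in> W" using AB(3,4) that by (simp add: subset_eq)
    then show ?thesis by (simp add: W_def)
  qed
  have "dist (mean (f x)) (mean (f a)) < e" if "x \<in> A" for x
  proof -
    have "norm (mean (\<lambda>y. f x y - f a y)) \<le> mean (\<lambda>y::'g. e / 2)"
      using close[OF that] by (intro norm_mean_le continuous_intros fx)
    then show ?thesis using \<open>e > 0\<close> by (simp add: mean_diff fx mean_const dist_norm)
  qed
  with A show "\<forall>\<^sub>F x in at a within UNIV. dist (mean (f x)) (mean (f a)) < e"
    using eventually_at_topological by blast
qed

end

section \<open>Convolution on a compact abelian group\<close>

lemma continuous_on_comp_UNIV:
  "continuous_on UNIV f \<Longrightarrow> continuous_on S h \<Longrightarrow> continuous_on S (\<lambda>x. f (h x))"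
  by (rule continuous_on_compose2) auto

definition conv :: "('g::ab_group_add \<Rightarrow> complex) \<Rightarrow> ('g \<Rightarrow> complex) \<Rightarrow> 'g \<Rightarrow> complex" where
  "conv f h x = mean (\<lambda>y. f (x - y) * h y)"

text \<open>The involution of the convolution algebra; it makes the value of
  \<open>conv (adj f) f\<close> at 0 the squared L2 norm of f.\<close>

definition adj :: "('g::ab_group_add \<Rightarrow> complex) \<Rightarrow> 'g \<Rightarrow> complex" where
  "adj f x = cnj (f (- x))"

definition sqnorm :: "('g::ab_group_add \<Rightarrow> complex) \<Rightarrow> real" where
  "sqnorm f = mean (\<lambda>x. (cmod (f x))\<^sup>2)"

lemma continuous_on_adj [continuous_intros]:
  fixes f :: "'g::topological_ab_group_add \<Rightarrow> complex"
  assumes "continuous_on UNIV f"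
  shows "continuous_on UNIV (adj f)"
  unfolding adj_def by (intro continuous_intros continuous_on_comp_UNIV[OF assms])

lemma adj_adj [simp]: "adj (adj f) = f"
  by (simp add: adj_def fun_eq_iff)

context compact_ab_group
begin

lemma mean_mult_left:
  fixes f :: "'g \<Rightarrow> complex"
  shows "continuous_on UNIV f \<Longrightarrow> mean (\<lambda>x. c * f x) = c * mean f"
  by (rule mean_bounded_linear[OF bounded_linear_mult_right])

lemma mean_mult_right:
  fixes f :: "'g \<Rightarrow> complex"
  shows "continuous_on UNIV f \<Longrightarrow> mean (\<lambda>x. f x * c) = mean f * c"
  by (rule mean_bounded_linear[OF bounded_linear_mult_left])

lemma mean_cnj:
  fixes f :: "'g \<Rightarrow> complex"
  shows "continuous_on UNIV f \<Longrightarrow> mean (\<lambda>x. cnj (f x)) = cnj (mean f)"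
  by (rule mean_bounded_linear[OF bounded_linear_cnj])

lemma mean_of_real:
  fixes f :: "'g \<Rightarrow> real"
  shows "continuous_on UNIV f \<Longrightarrow> mean (\<lambda>x. complex_of_real (f x)) = complex_of_real (mean f)"
  by (rule mean_bounded_linear[OF bounded_linear_of_real])

lemma sqnorm_nonneg: "continuous_on UNIV f \<Longrightarrow> 0 \<le> sqnorm (f :: 'g \<Rightarrow> complex)"
  unfolding sqnorm_def by (intro mean_nonneg continuous_intros) simp_all

lemma sqnorm_pos:
  fixes f :: "'g \<Rightarrow> complex"
  assumes "continuous_on UNIV f" "f a \<noteq> 0"
  shows "0 < sqnorm f"
  unfolding sqnorm_def using assms by (intro mean_positive[where a = a] continuous_intros) auto

lemma Cauchy_Schwarz_mean:
  fixes f h :: "'g \<Rightarrow> complex"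
  assumes f: "continuous_on UNIV f" and h: "continuous_on UNIV h"
  shows "(cmod (mean (\<lambda>y. f y * h y)))\<^sup>2 \<le> sqnorm f * sqnorm h"
proof (cases "\<forall>a. h a = 0")
  case True
  then show ?thesis by (simp add: mean_const sqnorm_def)
next
  case False
  then have pos: "0 < sqnorm h" using sqnorm_pos[OF h] by blast
  define m where "m = mean (\<lambda>y. cmod (f y) * cmod (h y))"
  have "cmod (mean (\<lambda>y. f y * h y)) \<le> m"
    unfolding m_def by (intro norm_mean_le continuous_intros f h) (simp add: norm_mult)
  then have le: "(cmod (mean (\<lambda>y. f y * h y)))\<^sup>2 \<le> m\<^sup>2" by (rule power_mono) simp
  have "0 \<le> sqnorm f - 2 * t * m + t\<^sup>2 * sqnorm h" for t
  proof -
    have "0 \<le> mean (\<lambda>y. (cmod (f y) - t * cmod (h y))\<^sup>2)"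
      by (intro mean_nonneg continuous_intros f h) simp
    also have "\<dots> = mean (\<lambda>y. ((cmod (f y))\<^sup>2 - (2 * t) * (cmod (f y) * cmod (h y))) + t\<^sup>2 * (cmod (h y))\<^sup>2)"
      by (simp add: power2_eq_square algebra_simps)
    also have "\<dots> = mean (\<lambda>y. (cmod (f y))\<^sup>2 - (2 * t) * (cmod (f y) * cmod (h y))) + mean (\<lambda>y. t\<^sup>2 * (cmod (h y))\<^sup>2)"
      by (intro mean_add continuous_intros f h)
    also have "mean (\<lambda>y. (cmod (f y))\<^sup>2 - (2 * t) * (cmod (f y) * cmod (h y))) =
        mean (\<lambda>y. (cmod (f y))\<^sup>2) - mean (\<lambda>y. (2 * t) * (cmod (f y) * cmod (h y)))"
      by (intro mean_diff continuous_intros f h)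
    also have "mean (\<lambda>y. (2 * t) * (cmod (f y) * cmod (h y))) = 2 * t * m"
      unfolding m_def by (rule mean_bounded_linear[OF bounded_linear_mult_right]) (intro continuous_intros f h)
    also have "mean (\<lambda>y. t\<^sup>2 * (cmod (h y))\<^sup>2) = t\<^sup>2 * mean (\<lambda>y. (cmod (h y))\<^sup>2)"
      by (rule mean_bounded_linear[OF bounded_linear_mult_right]) (intro continuous_intros h)
    finally show ?thesis by (simp add: sqnorm_def)
  qed
  \<comment> \<open>The minimiser of the quadratic polynomial in t.\<close>
  from this[of "m / sqnorm h"] have "m\<^sup>2 \<le> sqnorm f * sqnorm h"
    using pos by (simp add: field_simps power2_eq_square)
  with le show ?thesis by linarith
qed

lemma continuous_on_conv [continuous_intros]:
  fixes f h :: "'g \<Rightarrow> complex"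
  assumes f: "continuous_on UNIV f" and h: "continuous_on UNIV h"
  shows "continuous_on UNIV (conv f h)"
  unfolding conv_def
  by (rule continuous_on_mean) (intro continuous_intros continuous_on_comp_UNIV[OF f] continuous_on_comp_UNIV[OF h])

lemma conv_commute:
  fixes f h :: "'g \<Rightarrow> complex"
  assumes f: "continuous_on UNIV f" and h: "continuous_on UNIV h"
  shows "conv f h = conv h f"
proof
  fix x
  have "mean (\<lambda>y. f (x - (x - y)) * h (x - y)) = mean (\<lambda>y. f (x - y) * h y)"
    by (rule mean_reflect) (intro continuous_intros continuous_on_comp_UNIV[OF f] h)
  then show "conv f h x = conv h f x" by (simp add: conv_def mult.commute)
qed

lemma conv_assoc:
  fixes f h k :: "'g \<Rightarrow> complex"
  assumes f: "continuous_on UNIV f" and h: "continuous_on UNIV h" and k: "continuous_on UNIV k"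
  shows "conv (conv f h) k = conv f (conv h k)"
proof
  fix x
  have "conv f (conv h k) x = mean (\<lambda>w. mean (\<lambda>z. f (x - w) * (h (w - z) * k z)))"
    unfolding conv_def
    by (subst mean_mult_left) (intro continuous_intros continuous_on_comp_UNIV[OF h] k refl)+
  also have "\<dots> = mean (\<lambda>z. mean (\<lambda>w. f (x - w) * (h (w - z) * k z)))"
    by (rule mean_swap) (intro continuous_intros continuous_on_comp_UNIV[OF f]
        continuous_on_comp_UNIV[OF h] continuous_on_comp_UNIV[OF k])
  also have "\<dots> = mean (\<lambda>z. mean (\<lambda>w. f (x - z - w) * h w) * k z)"
  proof (intro arg_cong[where f = mean] ext)
    fix z
    have "mean (\<lambda>w. f (x - w) * (h (w - z) * k z)) = mean (\<lambda>w. (f (x - w) * h (w - z)) * k z)"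
      by (simp add: mult.assoc)
    also have "\<dots> = mean (\<lambda>w. f (x - w) * h (w - z)) * k z"
      by (rule mean_mult_right) (intro continuous_intros continuous_on_comp_UNIV[OF f]
          continuous_on_comp_UNIV[OF h])
    also have "mean (\<lambda>w. f (x - w) * h (w - z)) = mean (\<lambda>w. f (x - (w + z)) * h (w + z - z))"
      by (rule mean_shift[symmetric]) (intro continuous_intros continuous_on_comp_UNIV[OF f]
          continuous_on_comp_UNIV[OF h])
    finally show "mean (\<lambda>w. f (x - w) * (h (w - z) * k z)) = mean (\<lambda>w. f (x - z - w) * h w) * k z"
      by (simp add: algebra_simps)
  qed
  finally show "conv (conv f h) k x = conv f (conv h k) x" by (simp add: conv_def)
qed

lemma conv_add:
  fixes f h k :: "'g \<Rightarrow> complex"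
  assumes f: "continuous_on UNIV f" and h: "continuous_on UNIV h" and k: "continuous_on UNIV k"
  shows "conv f (\<lambda>x. h x + k x) = (\<lambda>x. conv f h x + conv f k x)"
proof
  fix x
  have "mean (\<lambda>y. f (x - y) * h y + f (x - y) * k y) =
      mean (\<lambda>y. f (x - y) * h y) + mean (\<lambda>y. f (x - y) * k y)"
    by (rule mean_add) (intro continuous_intros continuous_on_comp_UNIV[OF f] h k)+
  then show "conv f (\<lambda>x. h x + k x) x = conv f h x + conv f k x"
    by (simp add: conv_def distrib_left)
qed

lemma conv_scale:
  fixes f h :: "'g \<Rightarrow> complex"
  assumes f: "continuous_on UNIV f" and h: "continuous_on UNIV h"
  shows "conv f (\<lambda>x. c * h x) = (\<lambda>x. c * conv f h x)"
proof
  fix x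
  have "mean (\<lambda>y. c * (f (x - y) * h y)) = c * mean (\<lambda>y. f (x - y) * h y)"
    by (rule mean_mult_left) (intro continuous_intros continuous_on_comp_UNIV[OF f] h)
  then show "conv f (\<lambda>x. c * h x) x = c * conv f h x"
    by (simp add: conv_def mult.left_commute)
qed

lemma conv_diff:
  fixes f h k :: "'g \<Rightarrow> complex"
  assumes f: "continuous_on UNIV f" and h: "continuous_on UNIV h" and k: "continuous_on UNIV k"
  shows "conv f (\<lambda>x. h x - k x) = (\<lambda>x. conv f h x - conv f k x)"
  using conv_add[OF f h, of "\<lambda>x. - 1 * k x"] conv_scale[OF f k, of "- 1"] k
  by (simp add: continuous_on_minus)

lemma adj_conv:
  fixes f h :: "'g \<Rightarrow> complex"
  assumes f: "continuous_on UNIV f" and h: "continuous_on UNIV h"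
  shows "adj (conv f h) = conv (adj f) (adj h)"
proof
  fix x
  have "mean (\<lambda>y. cnj (f (- x - (0 - y)) * h (0 - y))) = mean (\<lambda>y. cnj (f (- x - y) * h y))"
    by (rule mean_reflect) (intro continuous_intros continuous_on_comp_UNIV[OF f] h)
  also have "\<dots> = cnj (mean (\<lambda>y. f (- x - y) * h y))"
    by (rule mean_cnj) (intro continuous_intros continuous_on_comp_UNIV[OF f] h)
  finally show "adj (conv f h) x = conv (adj f) (adj h) x"
    by (simp add: conv_def adj_def algebra_simps)
qed

lemma conv_adj_self:
  fixes f :: "'g \<Rightarrow> complex"
  assumes f: "continuous_on UNIV f"
  shows "conv (adj f) f 0 = complex_of_real (sqnorm f)"
proof -
  have "conv (adj f) f 0 = mean (\<lambda>y. complex_of_real ((cmod (f y))\<^sup>2))"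
    by (simp only: conv_def adj_def complex_norm_square diff_0 minus_minus mult.commute)
  also have "\<dots> = complex_of_real (sqnorm f)"
    unfolding sqnorm_def by (rule mean_of_real) (intro continuous_intros f)
  finally show ?thesis .
qed

lemma sqnorm_reflect:
  fixes f :: "'g \<Rightarrow> complex"
  assumes f: "continuous_on UNIV f"
  shows "sqnorm (\<lambda>y. f (x - y)) = sqnorm f"
  unfolding sqnorm_def by (rule mean_reflect) (intro continuous_intros f)

text \<open>A uniform bound by L2 norms: convolving with a fixed function turns L2 convergence into
  uniform convergence, which keeps limits continuous.\<close>

lemma conv_norm_le:
  fixes f h :: "'g \<Rightarrow> complex"
  assumes f: "continuous_on UNIV f" and h: "continuous_on UNIV h"
  shows "(cmod (conv f h x))\<^sup>2 \<le> sqnorm f * sqnorm h"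
  using Cauchy_Schwarz_mean[OF _ h, of "\<lambda>y. f (x - y)"] sqnorm_reflect[OF f, of x]
  by (simp add: conv_def continuous_on_comp_UNIV[OF f] continuous_on_diff)

lemma sqnorm_conv_le:
  fixes f h :: "'g \<Rightarrow> complex"
  assumes f: "continuous_on UNIV f" and h: "continuous_on UNIV h"
  shows "sqnorm (conv f h) \<le> sqnorm f * sqnorm h"
proof -
  have "mean (\<lambda>x. (cmod (conv f h x))\<^sup>2) \<le> mean (\<lambda>x::'g. sqnorm f * sqnorm h)"
    by (intro mean_mono continuous_intros f h conv_norm_le)
  then show ?thesis by (simp add: sqnorm_def mean_const)
qed

lemma conv_norm_le_sup:
  fixes f h :: "'g \<Rightarrow> complex"
  assumes f: "continuous_on UNIV f" and h: "continuous_on UNIV h"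
    and B: "\<And>x. cmod (f x) \<le> B" and e: "\<And>x. cmod (h x) \<le> e"
  shows "cmod (conv f h x) \<le> B * e"
proof -
  have "0 \<le> B" using B[of 0] norm_ge_zero order_trans by blast
  then have "norm (mean (\<lambda>y. f (x - y) * h y)) \<le> mean (\<lambda>y::'g. B * e)"
    by (intro norm_mean_le continuous_intros continuous_on_comp_UNIV[OF f] h)
      (auto simp: norm_mult intro!: mult_mono B e)
  then show ?thesis by (simp add: conv_def mean_const)
qed

lemma conv_tendsto:
  fixes f h :: "'g \<Rightarrow> complex"
  assumes f: "continuous_on UNIV f" and hn: "\<And>n::nat. continuous_on UNIV (H n)"
    and h: "continuous_on UNIV h" and lim: "uniform_limit UNIV H h sequentially"
  shows "(\<lambda>n. conv f (H n) x) \<longlonglongrightarrow> conv f h x"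
proof (rule tendstoI)
  fix e :: real assume "e > 0"
  obtain B where B: "\<And>x. norm (f x) \<le> B" using bounded_continuous[OF f] by blast
  have "0 \<le> B" using B[of 0] norm_ge_zero order_trans by blast
  then have pos: "0 < e / (B + 1)" using \<open>e > 0\<close> by simp
  have "\<forall>\<^sub>F n in sequentially. \<forall>x\<in>UNIV. dist (H n x) (h x) < e / (B + 1)"
    using lim pos by (rule uniform_limitD)
  then show "\<forall>\<^sub>F n in sequentially. dist (conv f (H n) x) (conv f h x) < e"
  proof (eventually_elim)
    case (elim n)
    have "cmod (conv f (\<lambda>x. H n x - h x) x) \<le> B * (e / (B + 1))"
      using elim by (intro conv_norm_le_sup continuous_intros f hn h B) (auto simp: dist_norm less_imp_le)
    also have "\<dots> < e" using \<open>0 \<le> B\<close> \<open>e > 0\<close> by (simp add: field_simps)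
    finally show ?case by (simp add: conv_diff[OF f hn h] dist_norm)
  qed
qed

end

section \<open>Characters separate points\<close>

text \<open>The index is one below the exponent, since the continuous functions under convolution
  have no unit in general.\<close>

primrec conv_power :: "('g::ab_group_add \<Rightarrow> complex) \<Rightarrow> nat \<Rightarrow> 'g \<Rightarrow> complex" where
  "conv_power g 0 = g"
| "conv_power g (Suc n) = conv g (conv_power g n)"

text \<open>The nonzero self-adjoint idempotents of the convolution algebra: by
  \<open>conv_adj_self\<close> the value at 0 is the squared norm, so asking it to be nonzero
  excludes exactly the zero function.\<close>

definition conv_idempotent :: "('g::topological_ab_group_add \<Rightarrow> complex) \<Rightarrow> bool" where
  "conv_idempotent q \<longleftrightarrow> continuous_on UNIV q \<and> adj q = q \<and> conv q q = q \<and> q 0 \<noteq> 0"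

context compact_ab_group
begin

lemma conv_scale_left:
  fixes f h :: "'g \<Rightarrow> complex"
  assumes f: "continuous_on UNIV f" and h: "continuous_on UNIV h"
  shows "conv (\<lambda>x. c * f x) h = (\<lambda>x. c * conv f h x)"
  unfolding conv_commute[OF continuous_on_mult_left[OF f] h] conv_commute[OF f h]
  by (rule conv_scale[OF h f])

lemma conv_diff_left:
  fixes f h k :: "'g \<Rightarrow> complex"
  assumes f: "continuous_on UNIV f" and h: "continuous_on UNIV h" and k: "continuous_on UNIV k"
  shows "conv (\<lambda>x. h x - k x) f = (\<lambda>x. conv h f x - conv k f x)"
  unfolding conv_commute[OF continuous_on_diff[OF h k] f] conv_commute[OF h f] conv_commute[OF k f]
  by (rule conv_diff[OF f h k])

lemma continuous_on_conv_power [continuous_intros]: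
  fixes g :: "'g \<Rightarrow> complex"
  assumes "continuous_on UNIV g"
  shows "continuous_on UNIV (conv_power g n)"
  by (induction n) (simp_all add: assms continuous_on_conv)

lemma conv_conv_power:
  fixes g :: "'g \<Rightarrow> complex"
  assumes g: "continuous_on UNIV g"
  shows "conv (conv_power g m) (conv_power g n) = conv_power g (Suc (m + n))"
  by (induction m) (simp_all add: conv_assoc continuous_on_conv_power g)

lemma adj_conv_power:
  fixes g :: "'g \<Rightarrow> complex"
  assumes "continuous_on UNIV g" "adj g = g"
  shows "adj (conv_power g n) = conv_power g n"
  by (induction n) (simp_all add: assms adj_conv continuous_on_conv_power)

lemma sqnorm_conv_power:
  fixes g :: "'g \<Rightarrow> complex"
  assumes "continuous_on UNIV g" "adj g = g"
  shows "conv_power g (2 * n + 1) 0 = complex_of_real (sqnorm (conv_power g n))"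
  using conv_adj_self[OF continuous_on_conv_power[OF assms(1)], of n]
  by (simp add: adj_conv_power assms conv_conv_power mult_2)

text \<open>The squared norms s of the convolution powers of g are log-convex and submultiplicative.
  Hence s (n + 1) / s n increases to a limit l, and s n / l ^ (n + 1) decreases but stays
  above 1.\<close>

lemma conv_power_growth:
  fixes g :: "'g \<Rightarrow> complex"
  assumes g: "continuous_on UNIV g" "adj g = g" "g a \<noteq> 0"
  defines "s n \<equiv> sqnorm (conv_power g n)"
  obtains l where "l > 0" "\<And>n. 1 \<le> s n / l ^ Suc n" "decseq (\<lambda>n. s n / l ^ Suc n)"
proof -
  note cont = continuous_on_conv_power[OF g(1)]
  have nonneg: "0 \<le> s n" for n unfolding s_def by (rule sqnorm_nonneg[OF cont])
  have submult: "s (Suc (m + n)) \<le> s m * s n" for m n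
    unfolding s_def conv_conv_power[OF g(1), symmetric] by (rule sqnorm_conv_le[OF cont cont])
  \<comment> \<open>Cauchy-Schwarz for the powers with index n and n + 2: their convolution has
    index 2 * n + 3, and its value at 0 is \<open>s (Suc n)\<close>.\<close>
  have logconvex: "(s (Suc n))\<^sup>2 \<le> s n * s (Suc (Suc n))" for n
    using conv_norm_le[OF cont cont, of n "Suc (Suc n)" 0] sqnorm_conv_power[OF g(1,2), of "Suc n"] nonneg[of "Suc n"]
    by (simp add: s_def conv_conv_power[OF g(1)] mult_2 del: conv_power.simps)
  have pos: "0 < s n" for n
  proof (induction n)
    case 0
    show ?case unfolding s_def by (rule sqnorm_pos[where a = a]) (use g in simp_all)
  next
    case (Suc n)
    \<comment> \<open>Log-convexity yields positivity from two predecessors, so index 1 is settled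
      separately: the value of \<open>conv g g\<close> at 0 is \<open>s 0\<close>.\<close>
    show ?case
    proof (cases n)
      case 0
      have "conv_power g 1 0 \<noteq> 0"
        using sqnorm_conv_power[OF g(1,2), of 0] Suc 0 by (simp add: s_def del: conv_power.simps)
      then show ?thesis unfolding s_def 0 by (intro sqnorm_pos[where a = 0] cont) simp
    next
      case (Suc m)
      have "0 < (s n)\<^sup>2" using \<open>0 < s n\<close> by (rule zero_less_power)
      also have "\<dots> \<le> s m * s (Suc n)" unfolding Suc by (rule logconvex)
      finally have "0 < s m * s (Suc n)" .
      with nonneg[of m] nonneg[of "Suc n"] show ?thesis
        by (metis less_eq_real_def mult_zero_right)
    qed
  qed
  define r where "r n = s (Suc n) / s n" for n
  have "r n \<le> r (Suc n)" for n
    using logconvex[of n] pos[of n] pos[of "Suc n"] by (simp add: r_def field_simps power2_eq_square)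
  then have inc: "incseq r" by (rule incseq_SucI)
  have "r n \<le> s 0" for n
    using submult[of 0 n] pos[of n] by (simp add: r_def field_simps)
  then obtain l where l: "r \<longlonglongrightarrow> l" "\<And>n. r n \<le> l" using incseq_convergent[OF inc] by blast
  have "0 < r 0" using pos by (simp add: r_def)
  then have "0 < l" using l(2)[of 0] by linarith
  have lower: "s j * r j ^ n \<le> s (j + n)" for j n
  proof (induction n)
    case (Suc n)
    have "s j * r j ^ Suc n = r j * (s j * r j ^ n)" by simp
    also have "\<dots> \<le> r (j + n) * s (j + n)"
      using inc pos nonneg by (intro mult_mono Suc) (auto simp: incseq_def r_def less_imp_le)
    also have "\<dots> = s (j + Suc n)" using pos[of "j + n"] by (simp add: r_def)
    finally show ?case .
  qed simp
  \<comment> \<open>Growth at the rate \<open>r j\<close> from index j on is compared with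
    submultiplicativity, whose index shift accounts for the exponent n + 1. Afterwards j tends to
    infinity.\<close>
  have "r j ^ Suc n \<le> s n" for j n
  proof -
    have "s j * r j ^ Suc n \<le> s j * s n"
      using lower[of j "Suc n"] submult[of j n] by simp
    then show ?thesis using pos[of j] by (simp only: mult_le_cancel_left_pos)
  qed
  then have "l ^ Suc n \<le> s n" for n
    by (intro LIMSEQ_le_const2[OF tendsto_power[OF l(1)]]) auto
  then have "1 \<le> s n / l ^ Suc n" for n using \<open>0 < l\<close> by (simp add: le_divide_eq del: power_Suc)
  moreover have "decseq (\<lambda>n. s n / l ^ Suc n)"
  proof (rule decseq_SucI)
    fix n
    have "s (Suc n) / l ^ Suc (Suc n) = (r n / l) * (s n / l ^ Suc n)"
      using pos[of n] by (simp add: r_def)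
    also have "\<dots> \<le> 1 * (s n / l ^ Suc n)"
      using l(2)[of n] \<open>0 < l\<close> nonneg by (intro mult_right_mono) auto
    finally show "s (Suc n) / l ^ Suc (Suc n) \<le> s n / l ^ Suc n" by simp
  qed
  ultimately show ?thesis using \<open>0 < l\<close> that by blast
qed

text \<open>Power iteration: the normalised even convolution powers of a self-adjoint function converge
  uniformly to the projection onto the top eigenspace of its square.\<close>

lemma conv_idempotent_exists:
  fixes g :: "'g \<Rightarrow> complex"
  assumes g: "continuous_on UNIV g" "adj g = g" "g a \<noteq> 0"
  obtains l q where "l \<noteq> 0" "conv_idempotent q" "conv (conv g g) q = (\<lambda>x. l * q x)"
proof -
  define s where "s n = sqnorm (conv_power g n)" for n
  obtain l where l: "l > 0" "\<And>n. 1 \<le> s n / l ^ Suc n" "decseq (\<lambda>n. s n / l ^ Suc n)"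
    using conv_power_growth[OF g] unfolding s_def by blast
  define b where "b n = s n / l ^ Suc n" for n
  have b: "1 \<le> b n" "decseq b" for n using l unfolding b_def by auto
  obtain \<beta> where \<beta>: "b \<longlonglongrightarrow> \<beta>" "\<And>n. \<beta> \<le> b n" using decseq_convergent[OF b(2), of 1] b(1) by blast
  have "1 \<le> \<beta>" using LIMSEQ_le_const[OF \<beta>(1)] b(1) by blast
  \<comment> \<open>\<open>Q n\<close> is the convolution power of exponent n + 1 of
    \<open>conv g g\<close> divided by l. So \<open>Q m\<close> and \<open>Q n\<close> multiply to
    \<open>Q (Suc (m + n))\<close>, and the values at 0 form the convergent sequence
    \<open>b\<close>.\<close>
  define Q where "Q n x = complex_of_real (1 / l ^ Suc n) * conv_power g (2 * n + 1) x" for n x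
  have Qdef: "Q n = (\<lambda>x. complex_of_real (1 / l ^ Suc n) * conv_power g (2 * n + 1) x)" for n
    by (simp add: Q_def fun_eq_iff)
  note contP = continuous_on_conv_power[OF g(1)]
  have cont: "continuous_on UNIV (Q n)" for n
    unfolding Qdef by (intro continuous_intros contP)
  have Q0: "Q n 0 = complex_of_real (b n)" for n
    unfolding Q_def sqnorm_conv_power[OF g(1,2)] by (simp add: b_def s_def)
  have convQ: "conv (Q m) (Q n) = Q (Suc (m + n))" for m n
  proof -
    have "conv (conv_power g (2 * m + 1)) (conv_power g (2 * n + 1)) = conv_power g (2 * Suc (m + n) + 1)"
      by (simp add: conv_conv_power[OF g(1)] del: conv_power.simps)
    then have "conv (Q m) (Q n) = (\<lambda>x. complex_of_real (1 / l ^ Suc m) * (complex_of_real (1 / l ^ Suc n) *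
        conv_power g (2 * Suc (m + n) + 1) x))"
      unfolding Qdef by (simp only: conv_scale_left conv_scale contP continuous_on_mult_left)
    also have "\<dots> = Q (Suc (m + n))" by (simp add: Qdef power_add fun_eq_iff del: conv_power.simps)
    finally show ?thesis .
  qed
  have adjQ: "adj (Q n) = Q n" for n
    using adj_conv_power[OF g(1,2), of "2 * n + 1"] by (simp add: Q_def adj_def fun_eq_iff del: conv_power.simps)
  \<comment> \<open>For self-adjoint functions the squared norm is the value of the square at 0, so
    convergence of \<open>b\<close> makes \<open>Q\<close> an L2 Cauchy sequence.\<close>
  have sqnormQ: "sqnorm (\<lambda>x. Q m x - Q n x) = b (Suc (m + m)) - 2 * b (Suc (m + n)) + b (Suc (n + n))" for m n
  proof -
    let ?D = "\<lambda>x. Q m x - Q n x"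
    have D: "continuous_on UNIV ?D" by (intro continuous_intros cont)
    have "adj ?D = ?D" using adjQ[of m] adjQ[of n] by (simp add: adj_def fun_eq_iff)
    then have "complex_of_real (sqnorm ?D) = conv ?D ?D 0" using conv_adj_self[OF D] by simp
    also have "\<dots> = conv (Q m) ?D 0 - conv (Q n) ?D 0"
      by (simp only: conv_diff_left[OF D cont[of m] cont[of n]])
    also have "\<dots> = complex_of_real (b (Suc (m + m)) - 2 * b (Suc (m + n)) + b (Suc (n + n)))"
      by (simp add: conv_diff[OF cont cont cont] convQ Q0 add.commute)
    finally show ?thesis by (simp only: of_real_eq_iff)
  qed
  \<comment> \<open>The shift matters: \<open>R n\<close> is \<open>Q 0\<close> convolved with
    \<open>Q n\<close>, so \<open>conv_norm_le\<close> upgrades the L2 estimate to a uniform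
    one.\<close>
  define R where "R n = Q (Suc n)" for n
  have "uniformly_Cauchy_on UNIV R"
  proof (rule uniformly_Cauchy_onI)
    fix e :: real assume "e > 0"
    \<comment> \<open>\<open>M\<close> exceeds twice the squared norm of \<open>Q 0\<close>, so that
      the final bound is strictly below e^2.\<close>
    define M where "M = 2 * sqnorm (Q 0) + 1"
    have "0 < M" unfolding M_def using sqnorm_nonneg[OF cont, of 0] by linarith
    then have "\<beta> < \<beta> + e\<^sup>2 / M" using \<open>e > 0\<close> by simp
    then have "\<forall>\<^sub>F n in sequentially. b n < \<beta> + e\<^sup>2 / M" by (rule order_tendstoD(2)[OF \<beta>(1)])
    then obtain K where K: "b K < \<beta> + e\<^sup>2 / M" by (meson eventually_sequentially order_refl)
    have "dist (R m x) (R n x) < e" if "m \<ge> K" "n \<ge> K" for x m n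
    proof -
      have "b (Suc (m + m)) \<le> b K" "b (Suc (n + n)) \<le> b K"
        using b(2) that by (auto simp: decseq_def)
      with \<beta>(2)[of "Suc (m + n)"] K have small: "sqnorm (\<lambda>x. Q m x - Q n x) \<le> 2 * (e\<^sup>2 / M)"
        unfolding sqnormQ by linarith
      have "R m x - R n x = conv (Q 0) (\<lambda>x. Q m x - Q n x) x"
        by (simp add: R_def conv_diff[OF cont cont cont] convQ)
      then have "(dist (R m x) (R n x))\<^sup>2 \<le> sqnorm (Q 0) * sqnorm (\<lambda>x. Q m x - Q n x)"
        unfolding dist_norm using conv_norm_le[OF cont[of 0], of "\<lambda>x. Q m x - Q n x" x]
        by (simp add: cont continuous_on_diff)
      also have "\<dots> \<le> sqnorm (Q 0) * (2 * (e\<^sup>2 / M))"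
        using small sqnorm_nonneg[OF cont, of 0] by (rule mult_left_mono)
      also have "\<dots> < e\<^sup>2" using \<open>0 < M\<close> \<open>e > 0\<close> by (simp add: M_def field_simps)
      finally show ?thesis using \<open>e > 0\<close> by (simp add: power_less_imp_less_base)
    qed
    then show "\<exists>K. \<forall>x\<in>UNIV. \<forall>m\<ge>K. \<forall>n\<ge>K. dist (R m x) (R n x) < e" by blast
  qed
  then obtain q where q: "uniform_limit UNIV R q sequentially"
    using Cauchy_uniformly_convergent uniformly_convergent_on_def by blast
  have contR: "continuous_on UNIV (R n)" for n unfolding R_def by (rule cont)
  have contq: "continuous_on UNIV q"
    by (rule uniform_limit_theorem[OF _ q]) (auto intro: always_eventually contR)
  have lim: "(\<lambda>n. R n x) \<longlonglongrightarrow> q x" for x using tendsto_uniform_limitI[OF q] by simp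
  \<comment> \<open>Convolution with \<open>Q m\<close> only shifts the sequence \<open>R\<close>,
    so it fixes the limit q; passing to the limit once more shows that q is idempotent.\<close>
  have Qq: "conv (Q m) q = q" for m
  proof
    fix x
    have "(\<lambda>n. conv (Q m) (R n) x) \<longlonglongrightarrow> conv (Q m) q x" by (rule conv_tendsto[OF cont contR contq q])
    moreover have "conv (Q m) (R n) x = R (n + Suc m) x" for n
      by (simp add: R_def convQ add.commute)
    ultimately have "(\<lambda>n. R (n + Suc m) x) \<longlonglongrightarrow> conv (Q m) q x" by simp
    moreover have "(\<lambda>n. R (n + Suc m) x) \<longlonglongrightarrow> q x" by (rule LIMSEQ_ignore_initial_segment[OF lim])
    ultimately show "conv (Q m) q x = q x" by (rule LIMSEQ_unique)
  qed
  have "conv q q = q"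
  proof
    fix x
    have "(\<lambda>n. conv q (R n) x) \<longlonglongrightarrow> conv q q x" by (rule conv_tendsto[OF contq contR contq q])
    moreover have "conv q (R n) x = q x" for n
      unfolding conv_commute[OF contq contR] by (simp add: R_def Qq)
    ultimately show "conv q q x = q x" by (simp add: LIMSEQ_const_iff)
  qed
  moreover have "adj q = q"
  proof
    fix x
    have "(\<lambda>n. cnj (R n (- x))) \<longlonglongrightarrow> cnj (q (- x))" by (intro tendsto_intros lim)
    moreover have "cnj (R n (- x)) = R n x" for n
      using fun_cong[OF adjQ[of "Suc n"], of x] by (simp add: R_def adj_def)
    ultimately show "adj q x = q x" using LIMSEQ_unique[OF lim[of x]] by (simp add: adj_def)
  qed
  moreover have "q 0 \<noteq> 0"
  proof -
    have "R n 0 = complex_of_real (b (Suc n))" for n by (simp add: R_def Q0)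
    then have "(\<lambda>n. complex_of_real (b (Suc n))) \<longlonglongrightarrow> q 0" using lim[of 0] by simp
    moreover have "(\<lambda>n. complex_of_real (b (Suc n))) \<longlonglongrightarrow> complex_of_real \<beta>"
      by (intro tendsto_of_real LIMSEQ_Suc \<beta>(1))
    ultimately have "q 0 = complex_of_real \<beta>" by (rule LIMSEQ_unique)
    with \<open>1 \<le> \<beta>\<close> show ?thesis by simp
  qed
  moreover have "conv (conv g g) q = (\<lambda>x. complex_of_real l * q x)"
  proof -
    have gg: "conv g g = (\<lambda>x. complex_of_real l * Q 0 x)" using l(1) by (simp add: Q_def fun_eq_iff)
    show ?thesis unfolding gg conv_scale_left[OF cont contq] Qq ..
  qed
  ultimately show ?thesis using that[of "complex_of_real l" q] l(1) contq by (auto simp: conv_idempotent_def)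
qed

text \<open>The estimates come from the idempotent law: submultiplicativity gives s <= s^2 for the
  squared norm s, whence s >= 1, and Cauchy-Schwarz bounds the values of q by s, which is q
  0.\<close>

lemma conv_idempotentD:
  assumes "conv_idempotent (q :: 'g \<Rightarrow> complex)"
  shows "continuous_on UNIV q" "adj q = q" "conv q q = q" "q 0 \<noteq> 0"
    "q 0 = complex_of_real (sqnorm q)" "1 \<le> sqnorm q" "cmod (q x) \<le> sqnorm q"
proof -
  show q: "continuous_on UNIV q" "adj q = q" "conv q q = q" "q 0 \<noteq> 0"
    using assms by (auto simp: conv_idempotent_def)
  show "q 0 = complex_of_real (sqnorm q)" using conv_adj_self[OF q(1)] q by simp
  have "sqnorm q \<le> sqnorm q * sqnorm q" using sqnorm_conv_le[OF q(1,1)] q(3) by simp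
  then show "1 \<le> sqnorm q" using sqnorm_pos[OF q(1,4)] by simp
  have "(cmod (q x))\<^sup>2 \<le> (sqnorm q)\<^sup>2"
    using conv_norm_le[OF q(1,1), of x] q(3) by (simp add: power2_eq_square)
  then show "cmod (q x) \<le> sqnorm q" using sqnorm_nonneg[OF q(1)] by (rule power2_le_imp_le)
qed

lemma conv_idempotent_diff:
  fixes q q' :: "'g \<Rightarrow> complex"
  assumes q: "conv_idempotent q" and q': "conv_idempotent q'" "conv q q' = q'" "q' \<noteq> q"
  shows "conv_idempotent (\<lambda>x. q x - q' x)"
proof -
  note c = conv_idempotentD(1)[OF q] conv_idempotentD(1)[OF q'(1)]
  let ?d = "\<lambda>x. q x - q' x"
  have d: "continuous_on UNIV ?d" by (intro continuous_intros c)
  have adj: "adj ?d = ?d"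
    using conv_idempotentD(2)[OF q] conv_idempotentD(2)[OF q'(1)] by (simp add: adj_def fun_eq_iff)
  have "conv q' q = q'" using conv_commute[OF c] q'(2) by simp
  then have dd: "conv ?d ?d = ?d"
    using conv_idempotentD(3)[OF q] conv_idempotentD(3)[OF q'(1)] q'(2)
    unfolding conv_diff_left[OF d c] conv_diff[OF c(1) c] conv_diff[OF c(2) c] by (simp add: fun_eq_iff)
  obtain a where "q' a \<noteq> q a" using q'(3) by (metis ext)
  then have "?d a \<noteq> 0" by simp
  then have "0 < sqnorm ?d" by (rule sqnorm_pos[OF d])
  then have "complex_of_real (sqnorm ?d) \<noteq> 0" by simp
  then have "?d 0 \<noteq> 0" using conv_adj_self[OF d] unfolding adj dd by simp
  with d adj dd show ?thesis by (simp add: conv_idempotent_def)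
qed

text \<open>The difference of an idempotent and a proper subidempotent is an idempotent, whose
  squared norm is at least 1. Each descent thus lowers the squared norm by 1 or more, so nothing
  lies below an idempotent with the least integer part.\<close>

lemma minimal_conv_idempotent_exists:
  fixes p :: "'g \<Rightarrow> complex"
  assumes p: "conv_idempotent p"
  obtains q where "conv_idempotent q" "conv p q = q"
    "\<And>q'. conv_idempotent q' \<Longrightarrow> conv q q' = q' \<Longrightarrow> q' = q"
proof -
  let ?P = "\<lambda>q. conv_idempotent q \<and> conv p q = q"
  have "?P p" using p conv_idempotentD by blast
  then obtain q where q: "?P q" and least: "\<And>q'. ?P q' \<Longrightarrow> nat \<lfloor>sqnorm q\<rfloor> \<le> nat \<lfloor>sqnorm q'\<rfloor>"
    using ex_has_least_nat[of ?P p "\<lambda>q. nat \<lfloor>sqnorm q\<rfloor>"] by blast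
  have "q' = q" if q': "conv_idempotent q'" "conv q q' = q'" for q'
  proof (rule ccontr)
    assume ne: "q' \<noteq> q"
    note c = conv_idempotentD(1)[OF p] conv_idempotentD(1)[OF conjunct1[OF q]] conv_idempotentD(1)[OF q'(1)]
    have "conv p q' = conv (conv p q) q'" using conv_assoc[OF c] q'(2) by simp
    then have "?P q'" using q q' by simp
    note d = conv_idempotent_diff[OF conjunct1[OF q] q' ne]
    have "complex_of_real (sqnorm q - sqnorm q') = complex_of_real (sqnorm (\<lambda>x. q x - q' x))"
      using conv_idempotentD(5)[OF d] conv_idempotentD(5)[OF q'(1)] conv_idempotentD(5)[OF conjunct1[OF q]]
      by simp
    then have "sqnorm q - sqnorm q' = sqnorm (\<lambda>x. q x - q' x)" by (simp only: of_real_eq_iff)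
    then have "sqnorm q' \<le> sqnorm q - 1" using conv_idempotentD(6)[OF d] by linarith
    moreover have "1 \<le> sqnorm q'" by (rule conv_idempotentD(6)[OF q'(1)])
    ultimately have "nat \<lfloor>sqnorm q'\<rfloor> < nat \<lfloor>sqnorm q\<rfloor>" by linarith
    with least[OF \<open>?P q'\<close>] show False by simp
  qed
  with q that show ?thesis by blast
qed

text \<open>A minimal idempotent has a one-dimensional corner: by minimality the idempotent extracted
  from g - t q is again q, so (g - t q)^2 is a multiple of q for every t; compare t = 0 and
  t = 1.\<close>

lemma minimal_conv_idempotent_scalar:
  fixes q g :: "'g \<Rightarrow> complex"
  assumes q: "conv_idempotent q"
    and minimal: "\<And>q'. conv_idempotent q' \<Longrightarrow> conv q q' = q' \<Longrightarrow> q' = q"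
    and g: "continuous_on UNIV g" "adj g = g" "conv q g = g"
  obtains c where "g = (\<lambda>x. c * q x)"
proof -
  note cq = conv_idempotentD(1)[OF q]
  have square: "\<exists>l. conv f f = (\<lambda>x. l * q x)"
    if f: "continuous_on UNIV f" "adj f = f" "conv q f = f" for f :: "'g \<Rightarrow> complex"
  proof (cases "\<forall>a. f a = 0")
    case True
    then have "conv f f = (\<lambda>x. 0 * q x)" by (simp add: conv_def fun_eq_iff mean_const)
    then show ?thesis by blast
  next
    case False
    then obtain a where "f a \<noteq> 0" by blast
    obtain l q' where lq: "l \<noteq> 0" "conv_idempotent q'" "conv (conv f f) q' = (\<lambda>x. l * q' x)"
      using conv_idempotent_exists[OF f(1,2) \<open>f a \<noteq> 0\<close>] .
    note cq' = conv_idempotentD(1)[OF lq(2)]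
    have ff: "conv q (conv f f) = conv f f" using conv_assoc[OF cq f(1,1)] f(3) by simp
    \<comment> \<open>q absorbs \<open>conv f f\<close>, of which q' is an eigenvector with nonzero
      eigenvalue; hence q absorbs q', and minimality applies.\<close>
    have "(\<lambda>x. l * conv q q' x) = conv q (conv (conv f f) q')"
      unfolding lq(3) conv_scale[OF cq cq'] ..
    also have "\<dots> = conv (conv q (conv f f)) q'"
      by (rule conv_assoc[symmetric]) (intro continuous_intros cq cq' f)+
    also have "\<dots> = (\<lambda>x. l * q' x)" unfolding ff lq(3) ..
    finally have "conv q q' = q'" using lq(1) by (simp add: fun_eq_iff)
    then have "q' = q" by (rule minimal[OF lq(2)])
    have "conv f f = conv (conv f f) q"
      using ff conv_commute[OF cq, of "conv f f"] by (simp add: continuous_on_conv f)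
    then show ?thesis using lq(3) unfolding \<open>q' = q\<close> by auto
  qed
  let ?h = "\<lambda>x. g x - q x"
  have h: "continuous_on UNIV ?h" by (intro continuous_intros g cq)
  have "adj ?h = ?h" using g(2) conv_idempotentD(2)[OF q] by (simp add: adj_def fun_eq_iff)
  moreover have "conv q ?h = ?h"
    unfolding conv_diff[OF cq g(1) cq] using g(3) conv_idempotentD(3)[OF q] by simp
  ultimately obtain l0 l1 where l: "conv g g = (\<lambda>x. l0 * q x)" "conv ?h ?h = (\<lambda>x. l1 * q x)"
    using square[OF g] square[OF h] by blast
  have "conv g q = g" using conv_commute[OF cq g(1)] g(3) by simp
  then have "conv ?h ?h = (\<lambda>x. conv g g x - g x - (g x - q x))"
    unfolding conv_diff_left[OF h g(1) cq] conv_diff[OF g(1) g(1) cq] conv_diff[OF cq g(1) cq]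
    using g(3) conv_idempotentD(3)[OF q] by simp
  then have "l1 * q x = l0 * q x - g x - (g x - q x)" for x unfolding l by metis
  \<comment> \<open>Expanding the square of g - q gave l1 * q = l0 * q - 2 * g + q, which is linear
    in g.\<close>
  then have "g x = ((l0 + 1 - l1) / 2) * q x" for x by (simp add: field_simps)
  then show ?thesis using that by blast
qed

text \<open>Every translate of q lies in the corner of q and is therefore a multiple of q, so q / q
  0 is multiplicative. Its modulus is at most 1 because q is bounded by q 0, and multiplicativity
  turns this into equality.\<close>

lemma minimal_conv_idempotent_character:
  fixes q :: "'g \<Rightarrow> complex"
  assumes q: "conv_idempotent q"
    and minimal: "\<And>q'. conv_idempotent q' \<Longrightarrow> conv q q' = q' \<Longrightarrow> q' = q"
  shows "(\<lambda>x. q x / q 0) \<in> dual_group"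
proof -
  note cq = conv_idempotentD(1)[OF q] and q0 = conv_idempotentD(4)[OF q]
  define T where "T t x = q (x - t)" for t x
  have T: "continuous_on UNIV (T t)" for t
    unfolding T_def by (intro continuous_intros continuous_on_comp_UNIV[OF cq])
  have qT: "conv q (T t) = T t" for t
  proof
    fix x
    have "conv q (T t) x = mean (\<lambda>y. q (x - y) * q (y - t))" by (simp add: conv_def T_def)
    also have "\<dots> = mean (\<lambda>y. q (x - (y + t)) * q (y + t - t))"
      by (rule mean_shift[symmetric]) (intro continuous_intros continuous_on_comp_UNIV[OF cq])
    also have "\<dots> = conv q q (x - t)" by (simp add: conv_def algebra_simps)
    finally show "conv q (T t) x = T t x" by (simp add: conv_idempotentD(3)[OF q] T_def)
  qed
  have adjT: "cnj (T t (- x)) = T (- t) x" for t x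
    using fun_cong[OF conv_idempotentD(2)[OF q], of "x + t"] by (simp add: adj_def T_def)
  have "\<exists>c. \<forall>x. T t x = c * q x" for t
  proof -
    \<comment> \<open>\<open>T t\<close> has adjoint \<open>T (- t)\<close>, so the result on
      self-adjoint elements is applied to two combinations from which \<open>T t\<close> is
      recovered.\<close>
    let ?g = "\<lambda>x. T t x + T (- t) x" and ?h = "\<lambda>x. \<i> * (T t x - T (- t) x)"
    have "continuous_on UNIV ?g" "adj ?g = ?g" "conv q ?g = ?g"
      using adjT[of t] adjT[of "- t"]
      by (simp_all add: continuous_on_add T conv_add[OF cq T T] qT)
        (simp add: adj_def fun_eq_iff add.commute)
    then obtain c where c: "?g = (\<lambda>x. c * q x)"
      using minimal_conv_idempotent_scalar[OF q minimal] by blast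
    have D: "continuous_on UNIV (\<lambda>x. T t x - T (- t) x)" by (intro continuous_intros T)
    then have "continuous_on UNIV ?h" "adj ?h = ?h" "conv q ?h = ?h"
      using adjT[of t] adjT[of "- t"]
      by (simp_all add: continuous_on_mult_left conv_scale[OF cq D] conv_diff[OF cq T T] qT)
        (simp add: adj_def fun_eq_iff algebra_simps)
    then obtain d where d: "?h = (\<lambda>x. d * q x)"
      using minimal_conv_idempotent_scalar[OF q minimal] by blast
    have "T t x = ((c - \<i> * d) / 2) * q x" for x
    proof -
      have "T t x + T (- t) x = c * q x" "\<i> * (\<i> * (T t x - T (- t) x)) = \<i> * (d * q x)"
        using fun_cong[OF c, of x] fun_cong[OF d, of x] by simp_all
      then have sum: "T t x + T (- t) x = c * q x" and diff: "T t x - T (- t) x = - (\<i> * d * q x)"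
        by (simp_all add: algebra_simps)
      have "T t x * 2 = (T t x + T (- t) x) + (T t x - T (- t) x)" by simp
      then have "T t x * 2 = (c - \<i> * d) * q x" unfolding sum diff by (simp add: algebra_simps)
      then show ?thesis by simp
    qed
    then show ?thesis by blast
  qed
  then obtain c where c: "\<And>t x. T t x = c t * q x" by metis
  define \<rho> where "\<rho> x = q x / q 0" for x
  have \<rho>0: "\<rho> 0 = 1" using q0 by (simp add: \<rho>_def)
  have "\<rho> (x - t) = c t * \<rho> x" for x t using c[of t x] by (simp add: \<rho>_def T_def)
  from this[of 0] this have diff: "\<rho> (x - t) = \<rho> (- t) * \<rho> x" for x t by (simp add: \<rho>0)
  have add: "\<rho> (x + t) = \<rho> x * \<rho> t" for x t using diff[of x "- t"] by (simp add: mult.commute)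
  have le: "cmod (\<rho> x) \<le> 1" for x
    using conv_idempotentD(7)[OF q, of x] conv_idempotentD(6)[OF q] conv_idempotentD(5)[OF q]
    by (simp add: \<rho>_def norm_divide divide_le_eq)
  have "cmod (\<rho> x) = 1" for x
  proof -
    have "cmod (\<rho> x) * cmod (\<rho> (- x)) = 1"
      using add[of x "- x"] \<rho>0 by (simp flip: norm_mult)
    moreover have "cmod (\<rho> x) * cmod (\<rho> (- x)) \<le> cmod (\<rho> x) * 1"
      using le by (intro mult_left_mono) auto
    ultimately show ?thesis using le[of x] by linarith
  qed
  moreover have "continuous_on UNIV \<rho>" unfolding \<rho>_def using q0 by (intro continuous_intros cq) auto
  ultimately show ?thesis using add unfolding dual_group_def \<rho>_def by blast
qed

section \<open>Characters and completeness\<close>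

lemma dual_groupD:
  assumes "\<rho> \<in> dual_group"
  shows "continuous_on UNIV \<rho>" "cmod (\<rho> x) = 1" "\<rho> (x + y) = \<rho> x * \<rho> y" "\<rho> 0 = 1"
    "\<rho> (- x) = cnj (\<rho> x)" "\<rho> x * cnj (\<rho> x) = 1"
proof -
  show *: "continuous_on UNIV \<rho>" "cmod (\<rho> x) = 1" "\<rho> (x + y) = \<rho> x * \<rho> y" for x y
    using assms by (auto simp: dual_group_def)
  show inv: "\<rho> x * cnj (\<rho> x) = 1" for x using *(2)[of x] by (simp add: complex_norm_square[symmetric])
  have "\<rho> 0 \<noteq> 0" using *(2)[of 0] by auto
  then show zero: "\<rho> 0 = 1" using *(3)[of 0 0] by simp
  have "\<rho> x * \<rho> (- x) = \<rho> x * cnj (\<rho> x)" using *(3)[of x "- x"] inv[of x] zero by simp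
  moreover have "\<rho> x \<noteq> 0" using *(2)[of x] by auto
  ultimately show "\<rho> (- x) = cnj (\<rho> x)" by simp
qed

text \<open>Write * for convolution. For nonzero f let g = adj f * f; there is an idempotent p in an
  eigenspace of g * g with eigenvalue l nonzero, and below p a minimal q, a multiple of a character.
  Orthogonality forces f * q = 0, hence g * g * q = 0, although p makes it l times q.\<close>

theorem orthogonal_to_characters_imp_zero:
  fixes f :: "'g \<Rightarrow> complex"
  assumes f: "continuous_on UNIV f"
    and orth: "\<And>\<rho>. \<rho> \<in> dual_group \<Longrightarrow> mean (\<lambda>x. f x * cnj (\<rho> x)) = 0"
  shows "f x = 0"
proof (rule ccontr)
  assume "f x \<noteq> 0"
  define g where "g = conv (adj f) f"
  have cf: "continuous_on UNIV (adj f)" by (intro continuous_intros f)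
  have g: "continuous_on UNIV g" unfolding g_def by (intro continuous_intros f)
  have "adj g = g" unfolding g_def adj_conv[OF cf f] adj_adj by (rule conv_commute[OF f cf])
  moreover have "g 0 \<noteq> 0"
    using conv_adj_self[OF f] sqnorm_pos[OF f \<open>f x \<noteq> 0\<close>] by (simp add: g_def)
  ultimately obtain l p where p: "l \<noteq> 0" "conv_idempotent p" "conv (conv g g) p = (\<lambda>x. l * p x)"
    using conv_idempotent_exists[OF g] by blast
  obtain q where q: "conv_idempotent q" "conv p q = q"
    "\<And>q'. conv_idempotent q' \<Longrightarrow> conv q q' = q' \<Longrightarrow> q' = q"
    using minimal_conv_idempotent_exists[OF p(2)] by blast
  note cp = conv_idempotentD(1)[OF p(2)] and cq = conv_idempotentD(1)[OF q(1)] and q0 = conv_idempotentD(4)[OF q(1)]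
  define \<rho> where "\<rho> = (\<lambda>x. q x / q 0)"
  have \<rho>: "\<rho> \<in> dual_group"
    unfolding \<rho>_def by (rule minimal_conv_idempotent_character[OF q(1)]) (rule q(3))
  have "conv f \<rho> = (\<lambda>x. 0)"
  proof
    fix x
    have "conv f \<rho> x = conv \<rho> f x" by (simp add: conv_commute[OF f dual_groupD(1)[OF \<rho>]])
    also have "\<dots> = mean (\<lambda>y. \<rho> x * (f y * cnj (\<rho> y)))"
      using dual_groupD(3)[OF \<rho>, of x "- y" for y] by (simp add: conv_def dual_groupD(5)[OF \<rho>] ac_simps)
    also have "\<dots> = \<rho> x * mean (\<lambda>y. f y * cnj (\<rho> y))"
      by (rule mean_mult_left) (intro continuous_intros f dual_groupD(1)[OF \<rho>])
    finally show "conv f \<rho> x = 0" by (simp add: orth[OF \<rho>])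
  qed
  moreover have "q = (\<lambda>x. q 0 * \<rho> x)" using q0 by (simp add: \<rho>_def fun_eq_iff)
  ultimately have fq: "conv f q = (\<lambda>x. 0)"
    using conv_scale[OF f dual_groupD(1)[OF \<rho>], of "q 0"] by simp
  have zero: "conv h (\<lambda>x. 0) = (\<lambda>x. 0)" for h :: "'g \<Rightarrow> complex"
    by (simp add: conv_def fun_eq_iff mean_const)
  have "conv g q = (\<lambda>x. 0)" unfolding g_def conv_assoc[OF cf f cq] fq by (rule zero)
  then have "conv (conv g g) q = (\<lambda>x. 0)" unfolding conv_assoc[OF g g cq] by (simp add: zero)
  moreover have "conv (conv g g) q = conv (conv (conv g g) p) q"
    using conv_assoc[OF continuous_on_conv[OF g g] cp cq] q(2) by simp
  then have "conv (conv g g) q = (\<lambda>x. l * q x)"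
    unfolding p(3) conv_scale_left[OF cp cq] q(2) .
  ultimately have "l * q 0 = 0" by metis
  with p(1) q0 show False by simp
qed

end

section \<open>Density of trigonometric polynomials\<close>

lemma dual_group_mult:
  "\<rho> \<in> dual_group \<Longrightarrow> \<eta> \<in> dual_group \<Longrightarrow> (\<lambda>x. \<rho> x * \<eta> x) \<in> dual_group"
  by (auto simp: dual_group_def norm_mult intro: continuous_on_mult)

lemma dual_group_cnj: "\<rho> \<in> dual_group \<Longrightarrow> (\<lambda>x. cnj (\<rho> x)) \<in> dual_group"
  by (auto simp: dual_group_def intro: continuous_on_cnj)

lemma dual_group_one: "(\<lambda>x. 1) \<in> dual_group"
  by (auto simp: dual_group_def)

inductive_set trig_polynomials :: "('g::topological_ab_group_add \<Rightarrow> complex) set" where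
  char: "\<rho> \<in> dual_group \<Longrightarrow> \<rho> \<in> trig_polynomials"
| add: "p \<in> trig_polynomials \<Longrightarrow> r \<in> trig_polynomials \<Longrightarrow> (\<lambda>x. p x + r x) \<in> trig_polynomials"
| scale: "p \<in> trig_polynomials \<Longrightarrow> (\<lambda>x. c * p x) \<in> trig_polynomials"

lemma continuous_on_trig_polynomial:
  "p \<in> trig_polynomials \<Longrightarrow> continuous_on UNIV p"
  by (induction rule: trig_polynomials.induct) (auto simp: dual_group_def intro: continuous_on_add continuous_on_mult_left)

lemma trig_polynomials_mult:
  assumes "p \<in> trig_polynomials" "r \<in> trig_polynomials"
  shows "(\<lambda>x. p x * r x) \<in> trig_polynomials"
  using assms(1)
proof (induction rule: trig_polynomials.induct)
  case (char \<rho>)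
  show ?case using assms(2)
  proof (induction rule: trig_polynomials.induct)
    case (char \<eta>)
    then show ?case using \<open>\<rho> \<in> dual_group\<close> by (intro trig_polynomials.char dual_group_mult)
  next
    case (add p r)
    show ?case using trig_polynomials.add[OF add.IH] by (simp add: distrib_left)
  next
    case (scale p c)
    show ?case using trig_polynomials.scale[OF scale.IH, of c] by (simp add: mult.left_commute)
  qed
next
  case (add p p')
  show ?case using trig_polynomials.add[OF add.IH] by (simp add: distrib_right)
next
  case (scale p c)
  show ?case using trig_polynomials.scale[OF scale.IH, of c] by (simp add: mult.assoc)
qed

lemma trig_polynomials_const: "(\<lambda>x. c) \<in> trig_polynomials"
  using trig_polynomials.scale[OF trig_polynomials.char[OF dual_group_one], of c] by simp

text \<open>Were x and y not separated, the translates by x and by y of a Urysohn function would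
  have the same Fourier coefficients; their difference would vanish, yet at 0 it compares the values
  at x and y.\<close>

lemma characters_separate_points:
  fixes x y :: "'g::{topological_ab_group_add,t2_space}"
  assumes compact: "compact (UNIV :: 'g set)" and "x \<noteq> y"
  shows "\<exists>\<rho>\<in>dual_group. \<rho> x \<noteq> \<rho> y"
proof (rule ccontr)
  assume "\<not> ?thesis"
  then have eq: "\<rho> x = \<rho> y" if "\<rho> \<in> dual_group" for \<rho> using that by blast
  interpret compact_ab_group "TYPE('g)" by unfold_locales (rule compact)
  have "Hausdorff_space (euclidean :: 'g topology)"
    unfolding Hausdorff_space_def disjnt_def using hausdorff by (metis open_openin)
  then have normal: "normal_space (euclidean :: 'g topology)"
    using compact by (intro compact_Hausdorff_or_regular_imp_normal_space) (auto simp: compact_space_def)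
  have "closedin euclidean {x}" "closedin euclidean {y}" "disjnt {x} {y}"
    using \<open>x \<noteq> y\<close> by (auto simp: disjnt_def)
  then obtain f where f: "continuous_map euclidean euclideanreal f" "f ` {x} \<subseteq> {0}" "f ` {y} \<subseteq> {1::real}"
    using Urysohn_lemma_alt[OF normal, of "{x}" "{y}" 0 1] by metis
  define F where "F z = complex_of_real (f z)" for z
  have F: "continuous_on UNIV F" unfolding F_def using f(1) by (intro continuous_intros) simp
  have mean: "mean (\<lambda>z. F (z + a) * cnj (\<rho> z)) = \<rho> a * mean (\<lambda>z. F z * cnj (\<rho> z))"
    if "\<rho> \<in> dual_group" for \<rho> a
  proof -
    note \<rho> = dual_groupD[OF that]
    have "cnj (\<rho> z) = \<rho> a * cnj (\<rho> (z + a))" for z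
    proof -
      have "\<rho> a * cnj (\<rho> (z + a)) = cnj (\<rho> z) * (\<rho> a * cnj (\<rho> a))"
        by (simp only: \<rho>(3) complex_cnj_mult ac_simps)
      then show ?thesis by (simp add: \<rho>(6))
    qed
    then have "mean (\<lambda>z. F (z + a) * cnj (\<rho> z)) = mean (\<lambda>z. \<rho> a * (F (z + a) * cnj (\<rho> (z + a))))"
      by (metis mult.left_commute)
    also have "\<dots> = \<rho> a * mean (\<lambda>z. F (z + a) * cnj (\<rho> (z + a)))"
      by (rule mean_mult_left) (intro continuous_intros continuous_on_comp_UNIV[OF F] continuous_on_comp_UNIV[OF \<rho>(1)])
    also have "mean (\<lambda>z. F (z + a) * cnj (\<rho> (z + a))) = mean (\<lambda>z. F z * cnj (\<rho> z))"
      by (rule mean_shift) (intro continuous_intros F \<rho>(1))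
    finally show ?thesis .
  qed
  have cont: "continuous_on UNIV (\<lambda>z. F (z + a))" for a
    by (intro continuous_intros continuous_on_comp_UNIV[OF F])
  have "F (0 + x) - F (0 + y) = 0"
  proof (rule orthogonal_to_characters_imp_zero[where f = "\<lambda>z. F (z + x) - F (z + y)" and x = 0])
    show "continuous_on UNIV (\<lambda>z. F (z + x) - F (z + y))" by (intro continuous_intros cont)
    fix \<rho> :: "'g \<Rightarrow> complex" assume "\<rho> \<in> dual_group"
    have "mean (\<lambda>z. F (z + x) * cnj (\<rho> z) - F (z + y) * cnj (\<rho> z)) =
        mean (\<lambda>z. F (z + x) * cnj (\<rho> z)) - mean (\<lambda>z. F (z + y) * cnj (\<rho> z))"
      by (rule mean_diff) (intro continuous_intros cont dual_groupD(1)[OF \<open>\<rho> \<in> dual_group\<close>])+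
    also have "\<dots> = 0"
      unfolding mean[OF \<open>\<rho> \<in> dual_group\<close>] eq[OF \<open>\<rho> \<in> dual_group\<close>] by simp
    finally show "mean (\<lambda>z. (F (z + x) - F (z + y)) * cnj (\<rho> z)) = 0" by (simp add: left_diff_distrib)
  qed
  with f(2,3) show False by (simp add: F_def)
qed

text \<open>Stone-Weierstrass for the real functions among the trigonometric polynomials: conjugates
  of characters are characters, so their real and imaginary parts belong to this ring and separate
  points.\<close>

lemma trig_polynomials_dense:
  fixes f :: "'g::{topological_ab_group_add,t2_space} \<Rightarrow> real"
  assumes compact: "compact (UNIV :: 'g set)" and f: "continuous_on UNIV f" and "e > 0"
  shows "\<exists>p\<in>trig_polynomials. \<forall>x. cmod (complex_of_real (f x) - p x) < e"
proof -
  define R where "R = {h :: 'g \<Rightarrow> real. (\<lambda>x. complex_of_real (h x)) \<in> trig_polynomials}"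
  interpret function_ring_on R "UNIV :: 'g set"
  proof
    show "compact (UNIV :: 'g set)" by fact
    show "continuous_on UNIV h" if "h \<in> R" for h
      using continuous_on_Re[OF continuous_on_trig_polynomial, of "\<lambda>x. complex_of_real (h x)"] that
      by (simp add: R_def)
    show "(\<lambda>x. h x + k x) \<in> R" if "h \<in> R" "k \<in> R" for h k
      using that trig_polynomials.add unfolding R_def by fastforce
    show "(\<lambda>x. h x * k x) \<in> R" if "h \<in> R" "k \<in> R" for h k
      using that trig_polynomials_mult unfolding R_def by fastforce
    show "(\<lambda>x. c) \<in> R" for c unfolding R_def using trig_polynomials_const by simp
    fix x y :: 'g assume "x \<noteq> y"
    then obtain \<rho> where \<rho>: "\<rho> \<in> dual_group" "\<rho> x \<noteq> \<rho> y"
      using characters_separate_points[OF compact] by blast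
    have cnj: "(\<lambda>z. cnj (\<rho> z)) \<in> trig_polynomials"
      by (intro trig_polynomials.char dual_group_cnj \<rho>)
    have "(\<lambda>z. complex_of_real (Re (\<rho> z))) = (\<lambda>z. (1/2) * (\<rho> z + cnj (\<rho> z)))"
      by (simp add: complex_eq_iff fun_eq_iff)
    then have re: "(\<lambda>z. Re (\<rho> z)) \<in> R"
      unfolding R_def using trig_polynomials.scale[OF trig_polynomials.add[OF trig_polynomials.char[OF \<rho>(1)] cnj], of "1/2"] by simp
    have "(\<lambda>z. complex_of_real (Im (\<rho> z))) = (\<lambda>z. (-\<i>/2) * (\<rho> z + (-1) * cnj (\<rho> z)))"
      by (simp add: complex_eq_iff fun_eq_iff)
    then have im: "(\<lambda>z. Im (\<rho> z)) \<in> R"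
      unfolding R_def using trig_polynomials.scale[OF trig_polynomials.add[OF trig_polynomials.char[OF \<rho>(1)] trig_polynomials.scale[OF cnj, of "-1"]], of "-\<i>/2"]
      by simp
    show "\<exists>h\<in>R. h x \<noteq> h y" using re im \<rho>(2) by (metis complex_eqI)
  qed
  obtain h where "h \<in> R" "\<forall>x\<in>UNIV. \<bar>f x - h x\<bar> < e" using Stone_Weierstrass_basic[OF f \<open>e > 0\<close>] by blast
  then show ?thesis
    by (intro bexI[of _ "\<lambda>x. complex_of_real (h x)"]) (auto simp: R_def simp flip: of_real_diff)
qed


section \<open>Homogeneous elements\<close>

lemma homogeneous_scaleC:
  assumes "\<And>g. unital_star_hom (\<gamma> g)" "homogeneous \<gamma> \<rho> a"
  shows "homogeneous \<gamma> \<rho> (c *\<^sub>C a)"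
  using assms by (simp add: homogeneous_def unital_star_homD scaleC_scaleC mult.commute)

text \<open>A Fourier coefficient of the orbit of a is homogeneous. Weighting the orbit with a bump
  concentrated where it stays near a reproduces a up to a scalar; a trigonometric polynomial in
  place of the bump makes the weighted mean a finite sum of Fourier coefficients.\<close>

theorem homogeneous_elements_total:
  fixes \<gamma> :: "'g::{topological_ab_group_add,t2_space} \<Rightarrow> 'a::cstar_algebra \<Rightarrow> 'a"
  assumes graded: "graded_cstar_algebra \<gamma>"
  shows "closure (span {a. \<exists>\<rho>\<in>dual_group. homogeneous \<gamma> \<rho> a}) = UNIV"
proof -
  let ?H = "{a. \<exists>\<rho>\<in>dual_group. homogeneous \<gamma> \<rho> a}"
  have compact: "compact (UNIV :: 'g set)" and hom: "unital_star_hom (\<gamma> g)" "bij (\<gamma> g)"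
    and add: "\<gamma> (g + h) = \<gamma> g \<circ> \<gamma> h" and cont: "continuous_on UNIV (\<lambda>g. \<gamma> g a)" for g h a
    using graded by (auto simp: graded_cstar_algebra_def star_automorphism_def)
  interpret compact_ab_group "TYPE('g)" by unfold_locales (rule compact)
  have "\<gamma> 0 (\<gamma> 0 a) = \<gamma> 0 a" for a using fun_cong[OF add[of 0 0], of a] by simp
  then have zero: "\<gamma> 0 a = a" for a using bij_is_inj[OF hom(2)] by (simp add: inj_eq)
  \<comment> \<open>\<open>span\<close> is the real span, but the homogeneous elements are closed
    under complex multiples, hence so is their span.\<close>
  have span_scaleC: "c *\<^sub>C a \<in> span ?H" if "a \<in> span ?H" for c a
  proof -
    have "c *\<^sub>C b \<in> ?H" if "b \<in> ?H" for b
      using that homogeneous_scaleC[of \<gamma>, OF hom(1)] by blast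
    then have "(\<lambda>x. c *\<^sub>C x) ` ?H \<subseteq> ?H" by blast
    then have "span ((\<lambda>x. c *\<^sub>C x) ` ?H) \<subseteq> span ?H" by (rule span_mono)
    moreover have "(\<lambda>x. c *\<^sub>C x) ` span ?H = span ((\<lambda>x. c *\<^sub>C x) ` ?H)"
      by (rule span_linear_image[symmetric]) (rule bounded_linear.linear[OF bounded_linear_scaleC_right])
    ultimately show ?thesis using that by blast
  qed
  have fourier: "homogeneous \<gamma> (\<lambda>x. cnj (\<rho> x)) (mean (\<lambda>x. \<rho> x *\<^sub>C \<gamma> x a))" if "\<rho> \<in> dual_group" for \<rho> a
    unfolding homogeneous_def
  proof
    fix g
    note \<rho> = dual_groupD[OF that]
    have c: "continuous_on UNIV (\<lambda>x. \<rho> x *\<^sub>C \<gamma> x a)" by (intro continuous_intros \<rho> cont)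
    have c': "continuous_on UNIV (\<lambda>x. \<rho> (x + g) *\<^sub>C \<gamma> (x + g) a)"
      by (intro continuous_on_comp_UNIV[OF c] continuous_intros)
    have "\<gamma> g (mean (\<lambda>x. \<rho> x *\<^sub>C \<gamma> x a)) = mean (\<lambda>x. \<gamma> g (\<rho> x *\<^sub>C \<gamma> x a))"
      by (rule mean_bounded_linear[OF unital_star_hom_bounded_linear[OF hom(1)] c, symmetric])
    also have "\<dots> = mean (\<lambda>x. cnj (\<rho> g) *\<^sub>C \<rho> (x + g) *\<^sub>C \<gamma> (x + g) a)"
    proof (intro arg_cong[where f = mean] ext)
      fix x
      have "\<gamma> g (\<rho> x *\<^sub>C \<gamma> x a) = \<rho> x *\<^sub>C \<gamma> (x + g) a"
        by (simp add: unital_star_homD[OF hom(1)] add.commute[of x g] add)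
      moreover have "\<rho> x = cnj (\<rho> g) * \<rho> (x + g)"
        using \<rho>(6)[of g] by (simp add: \<rho>(3) mult.left_commute mult.commute[of "cnj (\<rho> g)"])
      ultimately show "\<gamma> g (\<rho> x *\<^sub>C \<gamma> x a) = cnj (\<rho> g) *\<^sub>C \<rho> (x + g) *\<^sub>C \<gamma> (x + g) a"
        by (simp only: scaleC_scaleC)
    qed
    also have "\<dots> = cnj (\<rho> g) *\<^sub>C mean (\<lambda>x. \<rho> (x + g) *\<^sub>C \<gamma> (x + g) a)"
      by (rule mean_bounded_linear[OF bounded_linear_scaleC_right c'])
    also have "mean (\<lambda>x. \<rho> (x + g) *\<^sub>C \<gamma> (x + g) a) = mean (\<lambda>x. \<rho> x *\<^sub>C \<gamma> x a)"
      by (rule mean_shift[OF c])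
    finally show "\<gamma> g (mean (\<lambda>x. \<rho> x *\<^sub>C \<gamma> x a)) = cnj (\<rho> g) *\<^sub>C mean (\<lambda>x. \<rho> x *\<^sub>C \<gamma> x a)" .
  qed
  have trig: "mean (\<lambda>x. p x *\<^sub>C \<gamma> x a) \<in> span ?H" if "p \<in> trig_polynomials" for p a
    using that
  proof (induction rule: trig_polynomials.induct)
    case (char \<rho>)
    then have "mean (\<lambda>x. \<rho> x *\<^sub>C \<gamma> x a) \<in> ?H" using fourier dual_group_cnj by blast
    then show ?case by (rule span_base)
  next
    case (add p r)
    have "mean (\<lambda>x. p x *\<^sub>C \<gamma> x a + r x *\<^sub>C \<gamma> x a) = mean (\<lambda>x. p x *\<^sub>C \<gamma> x a) + mean (\<lambda>x. r x *\<^sub>C \<gamma> x a)"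
      by (rule mean_add) (intro continuous_intros cont continuous_on_trig_polynomial add)+
    then show ?case using span_add[OF add.IH] by (simp add: scaleC_add_left)
  next
    case (scale p c)
    have "mean (\<lambda>x. c *\<^sub>C p x *\<^sub>C \<gamma> x a) = c *\<^sub>C mean (\<lambda>x. p x *\<^sub>C \<gamma> x a)"
      by (rule mean_bounded_linear[OF bounded_linear_scaleC_right])
        (intro continuous_intros cont continuous_on_trig_polynomial scale)
    then show ?case using span_scaleC[OF scale.IH, of c] by (simp add: scaleC_scaleC)
  qed
  have "a \<in> closure (span ?H)" for a
    unfolding closure_approachable
  proof (intro allI impI)
    fix e :: real assume "e > 0"
    \<comment> \<open>A bump that is positive only where the orbit is within e / 2 of a; its value
      at 0 is e / 2, so its mean m is positive.\<close>
    define F where "F x = max 0 (e / 2 - norm (\<gamma> x a - a))" for x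
    have F: "continuous_on UNIV F" "\<And>x. 0 \<le> F x"
      unfolding F_def by (intro continuous_intros cont) auto
    define m where "m = mean F"
    have "F 0 > 0" using \<open>e > 0\<close> by (simp add: F_def zero)
    then have m: "m > 0" unfolding m_def by (intro mean_positive[OF F])
    \<comment> \<open>Chosen so that replacing \<open>F\<close> by p costs less than e * m / 2
      before division by m; the summand 1 covers a = 0.\<close>
    define d where "d = e * m / (4 * (norm a + 1))"
    have "d > 0" unfolding d_def using \<open>e > 0\<close> m by (intro divide_pos_pos mult_pos_pos) (auto simp: add_nonneg_pos)
    then obtain p where p: "p \<in> trig_polynomials" "\<And>x. cmod (complex_of_real (F x) - p x) < d"
      using trig_polynomials_dense[OF compact F(1)] by blast
    have cp: "continuous_on UNIV p" by (rule continuous_on_trig_polynomial[OF p(1)])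
    let ?b = "mean (\<lambda>x. F x *\<^sub>R \<gamma> x a)" and ?y = "mean (\<lambda>x. p x *\<^sub>C \<gamma> x a)"
    have "norm (?b - m *\<^sub>R a) \<le> e / 2 * m"
    proof -
      have "?b - m *\<^sub>R a = mean (\<lambda>x. F x *\<^sub>R \<gamma> x a) - mean (\<lambda>x. F x *\<^sub>R a)"
        unfolding m_def mean_bounded_linear[OF bounded_linear_scaleR_left F(1)] ..
      also have "\<dots> = mean (\<lambda>x. F x *\<^sub>R \<gamma> x a - F x *\<^sub>R a)"
        by (rule mean_diff[symmetric]) (intro continuous_intros F cont)+
      also have "norm \<dots> \<le> mean (\<lambda>x. e / 2 * F x)"
      proof (intro norm_mean_le continuous_intros F cont)
        fix x
        have "norm (F x *\<^sub>R \<gamma> x a - F x *\<^sub>R a) = F x * norm (\<gamma> x a - a)"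
          using F(2)[of x] by (simp flip: scaleR_diff_right)
        also have "\<dots> \<le> F x * (e / 2)"
        proof (cases "F x = 0")
          case False
          then have "norm (\<gamma> x a - a) \<le> e / 2" by (simp add: F_def max_def split: if_splits)
          then show ?thesis using F(2)[of x] by (rule mult_left_mono)
        qed simp
        finally show "norm (F x *\<^sub>R \<gamma> x a - F x *\<^sub>R a) \<le> e / 2 * F x" by (simp add: mult.commute)
      qed
      also have "\<dots> = e / 2 * m"
        unfolding m_def by (rule mean_bounded_linear[OF bounded_linear_mult_right F(1)])
      finally show ?thesis .
    qed
    moreover have "norm (?y - ?b) \<le> d * norm a"
    proof -
      have "?y - ?b = mean (\<lambda>x. p x *\<^sub>C \<gamma> x a - F x *\<^sub>R \<gamma> x a)"
        by (rule mean_diff[symmetric]) (intro continuous_intros F cont cp)+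
      also have "norm \<dots> \<le> mean (\<lambda>x::'g. d * norm a)"
      proof (intro norm_mean_le continuous_intros F cont cp)
        fix x
        have "norm (p x *\<^sub>C \<gamma> x a - F x *\<^sub>R \<gamma> x a) = cmod (complex_of_real (F x) - p x) * norm (\<gamma> x a)"
          by (simp add: norm_minus_commute[of _ "p x"] flip: scaleC_of_real scaleC_diff_left norm_scaleC)
        also have "\<dots> \<le> d * norm a"
          using p(2)[of x] \<open>d > 0\<close> unital_star_hom_norm_le[OF hom(1)] by (intro mult_mono) (auto simp: less_imp_le)
        finally show "norm (p x *\<^sub>C \<gamma> x a - F x *\<^sub>R \<gamma> x a) \<le> d * norm a" .
      qed
      finally show ?thesis by (simp add: mean_const)
    qed
    ultimately have "norm (?y - m *\<^sub>R a) \<le> d * norm a + e / 2 * m"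
      using norm_triangle_ineq[of "?y - ?b" "?b - m *\<^sub>R a"] by simp
    also have "d * norm a < e / 2 * m"
    proof -
      have "norm a / (4 * (norm a + 1)) < 1 / 2" by (simp add: divide_less_eq add_nonneg_pos)
      then have "(e * m) * (norm a / (4 * (norm a + 1))) < (e * m) * (1 / 2)"
        using \<open>e > 0\<close> m by (intro mult_strict_left_mono) auto
      then show ?thesis by (simp add: d_def)
    qed
    finally have "norm (?y - m *\<^sub>R a) < e * m" by simp
    moreover have "dist ((1 / m) *\<^sub>R ?y) a = norm (?y - m *\<^sub>R a) / m"
    proof -
      have "(1 / m) *\<^sub>R ?y - a = (1 / m) *\<^sub>R (?y - m *\<^sub>R a)" using m by (simp add: scaleR_diff_right)
      then show ?thesis using m by (simp add: dist_norm)
    qed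
    ultimately have "dist ((1 / m) *\<^sub>R ?y) a < e" using m by (simp add: divide_less_eq)
    then show "\<exists>y\<in>span ?H. dist y a < e" using span_scale[OF trig[OF p(1)]] by blast
  qed
  then show ?thesis by blast
qed

section \<open>Hilbert spaces and representations\<close>

lemma cinner_add_left: "cinner (x + y) z = cinner x z + cinner y z"
  by (metis cinner_add_right cinner_commute complex_cnj_add)

lemma cinner_scaleC_left: "cinner (c *\<^sub>C x) y = cnj c * cinner x y"
  by (metis cinner_commute cinner_scaleC_right complex_cnj_mult)

lemma cinner_scaleR_right: "cinner x (r *\<^sub>R y) = complex_of_real r * cinner x y"
  by (simp add: cinner_scaleC_right flip: scaleC_of_real)

lemma cinner_scaleR_left: "cinner (r *\<^sub>R x) y = complex_of_real r * cinner x y"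
  by (simp add: cinner_scaleC_left flip: scaleC_of_real)

lemma cinner_diff_right: "cinner x (y - z) = cinner x y - cinner x z"
  using cinner_add_right[of x y "-1 *\<^sub>R z"] cinner_scaleR_right[of x "-1" z] by simp

lemma cinner_diff_left: "cinner (x - y) z = cinner x z - cinner y z"
  using cinner_add_left[of x "-1 *\<^sub>R y" z] cinner_scaleR_left[of "-1" y z] by simp

lemma cinner_zero_right [simp]: "cinner x 0 = 0"
  using cinner_scaleR_right[of x 0 0] by simp

lemma cinner_self: "cinner x x = complex_of_real ((norm x)\<^sup>2)"
proof -
  have "Im (cinner x x) = 0" using arg_cong[OF cinner_commute[of x x], of Im] by simp
  then show ?thesis by (simp add: complex_eq_iff power2_norm_eq_inner inner_eq_Re_cinner)
qed

lemma norm_scaleC_hilbert: "norm (c *\<^sub>C x) = cmod c * norm (x :: 'v::chilbert_space)"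
proof -
  have cnj: "c * cnj c = (complex_of_real (cmod c))\<^sup>2" using complex_norm_square[of c] by simp
  have "complex_of_real ((norm (c *\<^sub>C x))\<^sup>2) = complex_of_real ((cmod c * norm x)\<^sup>2)"
    unfolding cinner_self[symmetric] cinner_scaleC_left cinner_scaleC_right
    by (simp add: cinner_self power_mult_distrib cnj flip: mult.assoc)
  then show ?thesis by (simp only: of_real_eq_iff power2_eq_iff_nonneg norm_ge_zero mult_nonneg_nonneg)
qed

text \<open>The constant 2 is crude: real and imaginary parts are estimated separately by the real
  Cauchy-Schwarz inequality.\<close>

lemma bounded_bilinear_cinner: "bounded_bilinear (cinner :: 'v::chilbert_space \<Rightarrow> 'v \<Rightarrow> complex)"
proof (rule bounded_bilinear.intro)
  have "cmod (cinner x y) \<le> norm x * norm y * 2" for x y :: 'v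
  proof -
    have "Im (cinner x y) = - Re (cinner x (\<i> *\<^sub>C y))" by (simp add: cinner_scaleC_right)
    then have "\<bar>Im (cinner x y)\<bar> \<le> norm x * norm y"
      using Cauchy_Schwarz_ineq2[of x "\<i> *\<^sub>C y"] by (simp add: inner_eq_Re_cinner norm_scaleC_hilbert)
    moreover have "\<bar>Re (cinner x y)\<bar> \<le> norm x * norm y"
      using Cauchy_Schwarz_ineq2[of x y] by (simp add: inner_eq_Re_cinner)
    ultimately show ?thesis using cmod_le[of "cinner x y"] by linarith
  qed
  then show "\<exists>K. \<forall>x y::'v. norm (cinner x y) \<le> norm x * norm y * K" by blast
qed (simp_all add: cinner_add_left cinner_add_right cinner_scaleR_left cinner_scaleR_right scaleR_conv_of_real)

lemmas continuous_on_cinner [continuous_intros] = bounded_bilinear.continuous_on[OF bounded_bilinear_cinner]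
lemmas tendsto_cinner = bounded_bilinear.tendsto[OF bounded_bilinear_cinner]

lemma eq_on_dense:
  fixes f g :: "'x::topological_space \<Rightarrow> 'y::t2_space"
  assumes "closure D = UNIV" "continuous_on UNIV f" "continuous_on UNIV g" "\<And>x. x \<in> D \<Longrightarrow> f x = g x"
  shows "f x = g x"
proof -
  have "closed {x. f x = g x}" using assms(2,3) by (rule closed_Collect_eq)
  then have "closure D \<subseteq> {x. f x = g x}" using assms(4) by (intro closure_minimal) auto
  with assms(1) show ?thesis by blast
qed

text \<open>The squared norm of the linearity defect expands into inner products, which U preserves,
  and so equals the same expression without U. A map obtained by continuous extension is thus linear
  at once.\<close>

lemma isometry_clinear:
  fixes U :: "'v::chilbert_space \<Rightarrow> 'v"
  assumes U: "\<And>x y. cinner (U x) (U y) = cinner x y"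
  shows "clinear U"
  unfolding clinear_def
proof (intro conjI allI)
  fix x y and c :: complex
  have "cinner (U (x + y) - (U x + U y)) (U (x + y) - (U x + U y)) =
      cinner ((x + y) - (x + y)) ((x + y) - (x + y))"
    by (simp only: cinner_diff_left cinner_diff_right cinner_add_left cinner_add_right U)
      (simp add: algebra_simps)
  then show "U (x + y) = U x + U y" by (simp add: cinner_self)
  have "cinner (U (c *\<^sub>C x) - c *\<^sub>C U x) (U (c *\<^sub>C x) - c *\<^sub>C U x) =
      cinner (c *\<^sub>C x - c *\<^sub>C x) (c *\<^sub>C x - c *\<^sub>C x)"
    by (simp only: cinner_diff_left cinner_diff_right cinner_scaleC_left cinner_scaleC_right U)
      (simp add: algebra_simps)
  then show "U (c *\<^sub>C x) = c *\<^sub>C U x" by (simp add: cinner_self)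
qed

lemma clinear_linear: "clinear f \<Longrightarrow> linear f"
  by (rule linearI) (auto simp: clinear_def simp flip: scaleC_of_real)

lemma unitary_norm: "unitary U \<Longrightarrow> norm (U x) = norm x"
  using cinner_self[of "U x"] cinner_self[of x]
  by (simp add: unitary_def del: of_real_power)

lemma unitary_bounded_linear:
  assumes U: "unitary U"
  shows "bounded_linear U"
proof -
  from U have "linear U" by (simp add: unitary_def clinear_linear)
  then show ?thesis
    by (intro bounded_linear_intro[where K = 1]) (simp_all add: linear_add linear_scale unitary_norm[OF U])
qed

lemma star_representationD:
  assumes "star_representation \<pi>"
  shows "clinear (\<pi> x)" "bounded_linear (\<pi> x)" "\<pi> (x + y) \<zeta> = \<pi> x \<zeta> + \<pi> y \<zeta>" "\<pi> (c *\<^sub>C x) \<zeta> = c *\<^sub>C \<pi> x \<zeta>"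
    "\<pi> (x * y) \<zeta> = \<pi> x (\<pi> y \<zeta>)" "cinner (\<pi> (star x) \<zeta>) \<eta> = cinner \<zeta> (\<pi> x \<eta>)"
    "cinner (\<pi> x \<zeta>) \<eta> = cinner \<zeta> (\<pi> (star x) \<eta>)"
proof -
  show "clinear (\<pi> x)" "bounded_linear (\<pi> x)" "\<pi> (x + y) \<zeta> = \<pi> x \<zeta> + \<pi> y \<zeta>" "\<pi> (c *\<^sub>C x) \<zeta> = c *\<^sub>C \<pi> x \<zeta>"
    "\<pi> (x * y) \<zeta> = \<pi> x (\<pi> y \<zeta>)" and *: "cinner (\<pi> (star x) \<zeta>) \<eta> = cinner \<zeta> (\<pi> x \<eta>)" for x
    using assms unfolding star_representation_def by blast+
  show "cinner (\<pi> x \<zeta>) \<eta> = cinner \<zeta> (\<pi> (star x) \<eta>)" using *[of "star x"] by (simp add: star_star)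
qed

lemma star_representation_linear: "star_representation \<pi> \<Longrightarrow> linear (\<lambda>x. \<pi> x \<zeta>)"
  by (rule linearI) (auto simp: star_representationD simp flip: scaleC_of_real)

text \<open>For norm x < 1 write 1 - \<open>star x * x\<close> as b * b with b self-adjoint: the
  squared norm of \<open>\<pi> x \<zeta>\<close> is then at most the inner product of \<zeta> with
  \<open>\<pi> 1 \<zeta>\<close>.\<close>

lemma star_representation_norm_le:
  assumes \<pi>: "star_representation \<pi>"
  shows "norm (\<pi> x \<zeta>) \<le> norm \<zeta> * norm x"
proof (rule norm_le_by_scaling[where P = "\<lambda>x. True"])
  fix x :: 'a assume "norm x < 1"
  note rep = star_representationD[OF \<pi>]
  \<comment> \<open>\<open>star_representation\<close> does not demand that 1 acts as the identity;
    \<open>\<pi> 1\<close> is a self-adjoint idempotent and hence contractive.\<close>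
  have one: "norm (\<pi> 1 \<zeta>) \<le> norm \<zeta>"
  proof -
    have "cinner (\<pi> 1 \<zeta>) (\<pi> 1 \<zeta>) = cinner \<zeta> (\<pi> 1 \<zeta>)"
      using rep(5)[of 1 1 \<zeta>] by (simp add: rep(7))
    then have "(norm (\<pi> 1 \<zeta>))\<^sup>2 = inner \<zeta> (\<pi> 1 \<zeta>)"
      by (simp add: inner_eq_Re_cinner power2_norm_eq_inner)
    also have "\<dots> \<le> norm \<zeta> * norm (\<pi> 1 \<zeta>)" by (rule norm_cauchy_schwarz)
    finally show ?thesis by (cases "\<pi> 1 \<zeta> = 0") (auto simp: power2_eq_square)
  qed
  have "(norm x)\<^sup>2 < 1" using \<open>norm x < 1\<close> by (simp add: power_less_one_iff abs_square_less_1)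
  then have "norm (star x * x) < 1" by (simp add: norm_star_mult)
  moreover have "star (star x * x) = star x * x" by (simp add: star_mult star_star)
  ultimately obtain b where b: "b * b = 1 - star x * x" "star b = b"
    using square_root_one_minus by metis
  have "cinner \<zeta> (\<pi> (b * b) \<zeta>) = cinner \<zeta> (\<pi> 1 \<zeta>) - cinner \<zeta> (\<pi> (star x * x) \<zeta>)"
    unfolding b(1) linear_diff[OF star_representation_linear[OF \<pi>]] by (rule cinner_diff_right)
  moreover have "cinner \<zeta> (\<pi> (b * b) \<zeta>) = cinner (\<pi> b \<zeta>) (\<pi> b \<zeta>)"
    by (simp add: rep(7)[of b] b(2) rep(5))
  moreover have "cinner \<zeta> (\<pi> (star x * x) \<zeta>) = cinner (\<pi> x \<zeta>) (\<pi> x \<zeta>)" by (simp add: rep(7) rep(5))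
  ultimately have "(norm (\<pi> x \<zeta>))\<^sup>2 = inner \<zeta> (\<pi> 1 \<zeta>) - (norm (\<pi> b \<zeta>))\<^sup>2"
    by (simp add: inner_eq_Re_cinner power2_norm_eq_inner)
  also have "\<dots> \<le> norm \<zeta> * norm (\<pi> 1 \<zeta>)"
    using norm_cauchy_schwarz[of \<zeta> "\<pi> 1 \<zeta>"] zero_le_power2[of "norm (\<pi> b \<zeta>)"] by linarith
  also have "\<dots> \<le> (norm \<zeta>)\<^sup>2" unfolding power2_eq_square by (intro mult_left_mono one) simp
  finally show "norm (\<pi> x \<zeta>) \<le> norm \<zeta>" by (rule power2_le_imp_le) simp
qed (simp_all add: star_representation_linear[OF \<pi>])

lemma star_representation_bounded_linear:
  assumes "star_representation \<pi>"
  shows "bounded_linear (\<lambda>x. \<pi> x \<zeta>)"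
  using star_representation_linear[OF assms, of \<zeta>] star_representation_norm_le[OF assms, of _ \<zeta>]
  by (intro bounded_linear.intro bounded_linear_axioms.intro exI[of _ "norm \<zeta>"]) (auto simp: mult.commute)


section \<open>Averages over a group of unitaries\<close>

locale unitary_representation = group H for H (structure) +
  fixes u :: "'h \<Rightarrow> 'v::chilbert_space \<Rightarrow> 'v"
  assumes unitary_u: "h \<in> carrier H \<Longrightarrow> unitary (u h)"
    and u_mult: "h \<in> carrier H \<Longrightarrow> k \<in> carrier H \<Longrightarrow> u (h \<otimes> k) \<zeta> = u h (u k \<zeta>)"
    and u_one: "u \<one> \<zeta> = \<zeta>"
begin

definition fixed_vectors :: "'v set" where
  "fixed_vectors = {\<zeta>. \<forall>h\<in>carrier H. u h \<zeta> = \<zeta>}"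

text \<open>Repeated midpoints generate enough convex combinations for the parallelogram argument,
  and properties of averages become inductions with two cases.\<close>

inductive averaging :: "('v \<Rightarrow> 'v) \<Rightarrow> bool" where
  base: "h \<in> carrier H \<Longrightarrow> averaging (u h)"
| mid: "averaging S \<Longrightarrow> averaging T \<Longrightarrow> averaging (\<lambda>\<zeta>. (1 / 2) *\<^sub>R (S \<zeta> + T \<zeta>))"

lemma averaging_bounded_linear: "averaging T \<Longrightarrow> bounded_linear T"
proof (induction rule: averaging.induct)
  case (mid S T)
  then show ?case
    by (intro bounded_linear_const_scaleR bounded_linear_add)
qed (intro unitary_bounded_linear unitary_u)

lemma averaging_norm_le: "averaging T \<Longrightarrow> norm (T \<zeta>) \<le> norm \<zeta>"
proof (induction rule: averaging.induct)
  case (base h)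
  then show ?case by (simp add: unitary_norm unitary_u)
next
  case (mid S T)
  then show ?case using norm_triangle_ineq[of "S \<zeta>" "T \<zeta>"] by simp
qed

lemma averaging_u_comp: "averaging T \<Longrightarrow> h \<in> carrier H \<Longrightarrow> averaging (\<lambda>\<zeta>. u h (T \<zeta>))"
proof (induction rule: averaging.induct)
  case (base k)
  then have "(\<lambda>\<zeta>. u h (u k \<zeta>)) = u (h \<otimes> k)" by (simp add: u_mult fun_eq_iff)
  then show ?case using averaging.base base by simp
next
  case (mid S T)
  have "linear (u h)" using unitary_u[OF \<open>h \<in> carrier H\<close>] unitary_bounded_linear bounded_linear.linear by blast
  then show ?case
    using averaging.mid[OF mid.IH[OF mid.prems]] by (simp add: linear_scale linear_add)
qed

lemma averaging_comp: "averaging S \<Longrightarrow> averaging T \<Longrightarrow> averaging (\<lambda>\<zeta>. S (T \<zeta>))"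
proof (induction rule: averaging.induct)
  case (base h)
  then show ?case by (intro averaging_u_comp)
next
  case (mid S S')
  then show ?case by (intro averaging.mid)
qed

lemma averaging_fixed: "averaging T \<Longrightarrow> \<mu> \<in> fixed_vectors \<Longrightarrow> T \<mu> = \<mu>"
proof (induction rule: averaging.induct)
  case (mid S T)
  then show ?case by (simp add: scaleR_add_left[symmetric] flip: scaleR_2)
qed (simp add: fixed_vectors_def)

lemma cinner_averaging: "averaging T \<Longrightarrow> \<mu> \<in> fixed_vectors \<Longrightarrow> cinner \<mu> (T \<zeta>) = cinner \<mu> \<zeta>"
proof (induction rule: averaging.induct)
  case (base h)
  then have "cinner \<mu> (u h \<zeta>) = cinner (u h \<mu>) (u h \<zeta>)" by (simp add: fixed_vectors_def)
  also have "\<dots> = cinner \<mu> \<zeta>" using unitary_u[OF base(1)] by (simp add: unitary_def)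
  finally show ?case .
next
  case (mid S T)
  then show ?case by (simp add: cinner_scaleR_right cinner_add_right)
qed

text \<open>The averages of w of almost minimal norm converge, by the parallelogram law, to the
  projection of w onto the fixed vectors (Alaoglu-Birkhoff).\<close>

lemma averages_converge:
  obtains z where "z \<in> fixed_vectors" "\<And>\<mu>. \<mu> \<in> fixed_vectors \<Longrightarrow> cinner \<mu> (w - z) = 0"
    "\<And>e. e > 0 \<Longrightarrow> \<exists>T. averaging T \<and> norm (T w - z) < e"
proof -
  define S where "S = (\<lambda>T. (norm (T w))\<^sup>2) ` {T. averaging T}"
  define q where "q = Inf S"
  have one: "averaging (u \<one>)" by (rule averaging.base) simp
  have "S \<noteq> {}" unfolding S_def using one by blast
  have "bdd_below S" unfolding S_def by (intro bdd_belowI[of _ 0]) auto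
  then have q: "q \<le> (norm (T w))\<^sup>2" if "averaging T" for T
    unfolding q_def S_def using that by (intro cInf_lower) (auto simp: S_def)
  have "\<exists>T. averaging T \<and> (norm (T w))\<^sup>2 < q + 1 / real (Suc n)" for n
    using cInf_lessD[OF \<open>S \<noteq> {}\<close>, of "q + 1 / real (Suc n)"] by (auto simp: q_def S_def)
  then obtain T where T: "\<And>n. averaging (T n)" "\<And>n. (norm (T n w))\<^sup>2 < q + 1 / real (Suc n)" by metis
  \<comment> \<open>The midpoint of two averages is an average, so its squared norm is at least
    q.\<close>
  have close: "(norm (A w - B w))\<^sup>2 \<le> 2 * (norm (A w))\<^sup>2 + 2 * (norm (B w))\<^sup>2 - 4 * q"
    if "averaging A" "averaging B" for A B
  proof -
    have "(norm (A w + B w))\<^sup>2 + (norm (A w - B w))\<^sup>2 = 2 * (norm (A w))\<^sup>2 + 2 * (norm (B w))\<^sup>2"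
      by (simp add: power2_norm_eq_inner algebra_simps inner_commute)
    moreover have "(norm ((1 / 2) *\<^sub>R (A w + B w)))\<^sup>2 = (norm (A w + B w))\<^sup>2 / 4"
      by (simp add: power_divide)
    ultimately show ?thesis using q[OF averaging.mid[OF that]] by simp
  qed
  define z where "z n = T n w" for n
  have dist_z: "(dist (z i) (z j))\<^sup>2 \<le> 2 / real (Suc i) + 2 / real (Suc j)" for i j
    using close[OF T(1)[of i] T(1)[of j]] T(2)[of i] T(2)[of j] by (simp add: z_def dist_norm)
  have "Cauchy z"
  proof (rule metric_CauchyI)
    fix e :: real assume "e > 0"
    then obtain N where N: "1 / real (Suc N) < e\<^sup>2 / 4" using nat_approx_posE[of "e\<^sup>2 / 4"] by auto
    have "dist (z i) (z j) < e" if "i \<ge> N" "j \<ge> N" for i j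
    proof -
      have "1 / real (Suc k) \<le> 1 / real (Suc N)" if "k \<ge> N" for k using that by (simp add: frac_le)
      from this[OF that(1)] this[OF that(2)] N dist_z[of i j] have "(dist (z i) (z j))\<^sup>2 < e\<^sup>2" by simp
      then show ?thesis using \<open>e > 0\<close> by (simp add: power_less_imp_less_base)
    qed
    then show "\<exists>N. \<forall>i\<ge>N. \<forall>j\<ge>N. dist (z i) (z j) < e" by blast
  qed
  then obtain l where l: "z \<longlonglongrightarrow> l" using Cauchy_convergent convergent_def by blast
  have inverse_tendsto: "(\<lambda>n. 4 / real (Suc n)) \<longlonglongrightarrow> 0"
    using tendsto_mult_right_zero[OF LIMSEQ_inverse_real_of_nat, of 4] by (simp add: divide_inverse)
  have "u h l = l" if h: "h \<in> carrier H" for h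
  proof -
    interpret uh: bounded_linear "u h" by (intro unitary_bounded_linear unitary_u h)
    \<comment> \<open>Following \<open>T n\<close> by \<open>u h\<close> gives another average that
      is almost minimal, so the two vectors are close.\<close>
    have "(norm (u h (z n) - z n))\<^sup>2 \<le> 4 / real (Suc n)" for n
      using close[OF averaging_u_comp[OF T(1)[of n] h] T(1)[of n]] T(2)[of n] unitary_norm[OF unitary_u[OF h], of "T n w"]
      by (simp add: z_def)
    then have "(\<lambda>n. (norm (u h (z n) - z n))\<^sup>2) \<longlonglongrightarrow> 0"
      by (intro tendsto_sandwich[OF _ _ tendsto_const inverse_tendsto]) auto
    moreover have "(\<lambda>n. (norm (u h (z n) - z n))\<^sup>2) \<longlonglongrightarrow> (norm (u h l - l))\<^sup>2"
      by (intro tendsto_intros uh.tendsto l)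
    ultimately have "(norm (u h l - l))\<^sup>2 = 0" by (rule LIMSEQ_unique[symmetric])
    then show ?thesis by simp
  qed
  then have "l \<in> fixed_vectors" by (simp add: fixed_vectors_def)
  moreover have "cinner \<mu> (w - l) = 0" if "\<mu> \<in> fixed_vectors" for \<mu>
  proof -
    have "(\<lambda>n. cinner \<mu> (z n)) \<longlonglongrightarrow> cinner \<mu> l" by (intro tendsto_cinner tendsto_const l)
    then have "cinner \<mu> w = cinner \<mu> l"
      by (simp add: z_def cinner_averaging[OF T(1) that] LIMSEQ_const_iff)
    then show ?thesis by (simp add: cinner_diff_right)
  qed
  moreover have "\<exists>T. averaging T \<and> norm (T w - l) < e" if "e > 0" for e
  proof -
    obtain n where "dist (z n) l < e" using l \<open>e > 0\<close> by (meson LIMSEQ_iff_nz metric_LIMSEQ_D order_refl)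
    then show ?thesis using T(1) by (auto simp: z_def dist_norm)
  qed
  ultimately show ?thesis using that by blast
qed

lemma fixed_vectors_diff: "x \<in> fixed_vectors \<Longrightarrow> y \<in> fixed_vectors \<Longrightarrow> x - y \<in> fixed_vectors"
  using unitary_u unitary_bounded_linear bounded_linear.linear linear_diff
  unfolding fixed_vectors_def by fastforce

lemma orthogonal_projection_eqI:
  assumes "z \<in> fixed_vectors" "\<And>\<mu>. \<mu> \<in> fixed_vectors \<Longrightarrow> cinner \<mu> (w - z) = 0"
  shows "orthogonal_projection fixed_vectors w = z"
  unfolding orthogonal_projection_def
proof (rule the_equality)
  fix y assume y: "y \<in> fixed_vectors \<and> (\<forall>\<mu>\<in>fixed_vectors. cinner \<mu> (w - y) = 0)"
  then have m: "y - z \<in> fixed_vectors" using fixed_vectors_diff assms(1) by blast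
  have "cinner (y - z) (y - z) = cinner (y - z) (w - z) - cinner (y - z) (w - y)"
    by (simp flip: cinner_diff_right)
  also have "\<dots> = 0" using y m assms(2) by simp
  finally show "y = z" by (simp add: cinner_self)
qed (use assms in blast)

abbreviation E :: "'v \<Rightarrow> 'v" where "E \<equiv> orthogonal_projection fixed_vectors"

lemma E_fixed: "E w \<in> fixed_vectors"
  and cinner_E: "\<mu> \<in> fixed_vectors \<Longrightarrow> cinner \<mu> (E w) = cinner \<mu> w"
  and E_approximation: "e > 0 \<Longrightarrow> \<exists>T. averaging T \<and> norm (T w - E w) < e"
proof -
  obtain z where z: "z \<in> fixed_vectors" "\<And>\<mu>. \<mu> \<in> fixed_vectors \<Longrightarrow> cinner \<mu> (w - z) = 0"
    "\<And>e. e > 0 \<Longrightarrow> \<exists>T. averaging T \<and> norm (T w - z) < e"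
    using averages_converge[of w] by blast
  have "E w = z" by (rule orthogonal_projection_eqI[OF z(1,2)])
  then show "E w \<in> fixed_vectors" "\<mu> \<in> fixed_vectors \<Longrightarrow> cinner \<mu> (E w) = cinner \<mu> w"
    "e > 0 \<Longrightarrow> \<exists>T. averaging T \<and> norm (T w - E w) < e"
    using z by (auto simp: cinner_diff_right)
qed

lemma E_averaging: "averaging T \<Longrightarrow> E (T w) = E w"
  by (rule orthogonal_projection_eqI[OF E_fixed]) (simp add: cinner_diff_right cinner_E cinner_averaging)

text \<open>Choose S for v and T for S w: T is a contraction fixing E v, so the first approximation
  survives. A common average is required because the same one occurs on both sides of the exchange
  equation.\<close>

lemma E_approximation2:
  assumes "e > 0"
  obtains T where "averaging T" "norm (T v - E v) < e" "norm (T w - E w) < e"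
proof -
  obtain S where S: "averaging S" "norm (S v - E v) < e" using E_approximation[OF assms] by blast
  obtain T where T: "averaging T" "norm (T (S w) - E (S w)) < e" using E_approximation[OF assms] by blast
  interpret T: bounded_linear T by (rule averaging_bounded_linear[OF T(1)])
  have "T (S v) - E v = T (S v - E v)" by (simp add: T.diff averaging_fixed[OF T(1) E_fixed])
  then have "norm (T (S v) - E v) < e" using averaging_norm_le[OF T(1), of "S v - E v"] S(2) by simp
  then show ?thesis using that[OF averaging_comp[OF T(1) S(1)]] T(2) E_averaging[OF S(1)] by simp
qed

end


section \<open>The unitaries of an invariant state\<close>

text \<open>Invariance of the state makes the map from \<open>\<pi> x \<xi>\<close> to
  \<open>\<pi> (\<theta> x) \<xi>\<close> isometric, hence independent of the representative x and
  uniformly continuous, so it extends to the closure.\<close>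

lemma gns_isometry_exists:
  assumes gns: "gns_triple \<phi> \<pi> \<xi>" and \<theta>: "unital_star_hom \<theta>" and inv: "\<And>x. \<phi> (\<theta> x) = \<phi> x"
  obtains U where "\<And>\<zeta> \<eta>. cinner (U \<zeta>) (U \<eta>) = cinner \<zeta> \<eta>" "\<And>x. U (\<pi> x \<xi>) = \<pi> (\<theta> x) \<xi>"
proof -
  have \<pi>: "star_representation \<pi>" and dense: "closure (range (\<lambda>x. \<pi> x \<xi>)) = UNIV"
    and \<phi>: "\<And>x. \<phi> x = cinner \<xi> (\<pi> x \<xi>)"
    using gns by (auto simp: gns_triple_def)
  note rep = star_representationD[OF \<pi>]
  have vec: "cinner (\<pi> x \<xi>) (\<pi> y \<xi>) = \<phi> (star x * y)" for x y by (simp add: \<phi> rep(5,7))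
  have key: "cinner (\<pi> (\<theta> x) \<xi>) (\<pi> (\<theta> y) \<xi>) = cinner (\<pi> x \<xi>) (\<pi> y \<xi>)" for x y
    by (simp add: vec inv flip: unital_star_homD(4,5)[OF \<theta>])
  have dist: "dist (\<pi> (\<theta> x) \<xi>) (\<pi> (\<theta> y) \<xi>) = dist (\<pi> x \<xi>) (\<pi> y \<xi>)" for x y
  proof -
    have "complex_of_real ((norm (\<pi> (\<theta> x) \<xi> - \<pi> (\<theta> y) \<xi>))\<^sup>2) = complex_of_real ((norm (\<pi> x \<xi> - \<pi> y \<xi>))\<^sup>2)"
      unfolding cinner_self[symmetric] by (simp only: cinner_diff_left cinner_diff_right key)
    then show ?thesis
      by (simp only: dist_norm of_real_eq_iff power2_eq_iff_nonneg norm_ge_zero)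
  qed
  define f where "f \<zeta> = \<pi> (\<theta> (SOME x. \<pi> x \<xi> = \<zeta>)) \<xi>" for \<zeta>
  have f: "f (\<pi> x \<xi>) = \<pi> (\<theta> x) \<xi>" for x
  proof -
    have "\<pi> (SOME y. \<pi> y \<xi> = \<pi> x \<xi>) \<xi> = \<pi> x \<xi>" by (rule someI) (rule refl)
    then show ?thesis using dist[of "SOME y. \<pi> y \<xi> = \<pi> x \<xi>" x] by (simp add: f_def)
  qed
  have "uniformly_continuous_on (range (\<lambda>x. \<pi> x \<xi>)) f"
    unfolding uniformly_continuous_on_def by (auto simp: f dist)
  then obtain U where U: "uniformly_continuous_on (closure (range (\<lambda>x. \<pi> x \<xi>))) U"
    "\<And>\<zeta>. \<zeta> \<in> range (\<lambda>x. \<pi> x \<xi>) \<Longrightarrow> f \<zeta> = U \<zeta>"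
    by (rule uniformly_continuous_on_extension_on_closure) blast
  have cont: "continuous_on UNIV U" using U(1) dense uniformly_continuous_imp_continuous by metis
  have U_vec: "U (\<pi> x \<xi>) = \<pi> (\<theta> x) \<xi>" for x using U(2)[of "\<pi> x \<xi>"] f by simp
  have half: "cinner (U (\<pi> x \<xi>)) (U \<eta>) = cinner (\<pi> x \<xi>) \<eta>" for x \<eta>
  proof (rule eq_on_dense[OF dense, of "\<lambda>\<eta>. cinner (U (\<pi> x \<xi>)) (U \<eta>)" "\<lambda>\<eta>. cinner (\<pi> x \<xi>) \<eta>" \<eta>])
    show "continuous_on UNIV (\<lambda>\<eta>. cinner (U (\<pi> x \<xi>)) (U \<eta>))"
      by (rule continuous_on_cinner[OF continuous_on_const cont])
    show "continuous_on UNIV (\<lambda>\<eta>. cinner (\<pi> x \<xi>) \<eta>)"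
      by (rule continuous_on_cinner[OF continuous_on_const continuous_on_id])
  qed (auto simp: U_vec key)
  have "cinner (U \<zeta>) (U \<eta>) = cinner \<zeta> \<eta>" for \<zeta> \<eta>
  proof (rule eq_on_dense[OF dense, of "\<lambda>\<zeta>. cinner (U \<zeta>) (U \<eta>)" "\<lambda>\<zeta>. cinner \<zeta> \<eta>" \<zeta>])
    show "continuous_on UNIV (\<lambda>\<zeta>. cinner (U \<zeta>) (U \<eta>))"
      by (rule continuous_on_cinner[OF cont continuous_on_const])
    show "continuous_on UNIV (\<lambda>\<zeta>. cinner \<zeta> \<eta>)"
      by (rule continuous_on_cinner[OF continuous_on_id continuous_on_const])
  qed (auto simp: half)
  with U_vec show ?thesis using that by blast
qed

text \<open>The inverse automorphism also preserves the state; the isometry it induces is a right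
  inverse, which gives surjectivity. Density of the orbit gives the uniqueness that
  \<open>THE\<close> demands.\<close>

lemma gns_unitary:
  assumes gns: "gns_triple \<phi> \<pi> \<xi>" and \<theta>: "star_automorphism \<theta>" and inv: "\<And>x. \<phi> (\<theta> x) = \<phi> x"
  shows "unitary (gns_unitary \<pi> \<xi> \<theta>)" "gns_unitary \<pi> \<xi> \<theta> (\<pi> x \<xi>) = \<pi> (\<theta> x) \<xi>"
proof -
  have dense: "closure (range (\<lambda>x. \<pi> x \<xi>)) = UNIV" using gns by (auto simp: gns_triple_def)
  have hom: "unital_star_hom \<theta>" and bij: "bij \<theta>" using \<theta> by (auto simp: star_automorphism_def)
  have right: "\<theta> (inv_into UNIV \<theta> x) = x" for x using bij by (simp add: bij_is_surj surj_f_inv_f)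
  have injD: "\<theta> x = \<theta> y \<Longrightarrow> x = y" for x y using bij by (simp add: bij_is_inj inj_eq)
  have hom': "unital_star_hom (inv_into UNIV \<theta>)"
    unfolding unital_star_hom_def clinear_def
    by (intro conjI allI; rule injD) (simp_all add: right unital_star_homD[OF hom])
  have inv': "\<phi> (inv_into UNIV \<theta> x) = \<phi> x" for x using inv[of "inv_into UNIV \<theta> x"] by (simp add: right)
  obtain U where U: "\<And>\<zeta> \<eta>. cinner (U \<zeta>) (U \<eta>) = cinner \<zeta> \<eta>" "\<And>x. U (\<pi> x \<xi>) = \<pi> (\<theta> x) \<xi>"
    using gns_isometry_exists[OF gns hom inv] by blast
  obtain V where V: "\<And>\<zeta> \<eta>. cinner (V \<zeta>) (V \<eta>) = cinner \<zeta> \<eta>" "\<And>x. V (\<pi> x \<xi>) = \<pi> (inv_into UNIV \<theta> x) \<xi>"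
    using gns_isometry_exists[OF gns hom' inv'] by blast
  have isometry_cont: "continuous_on UNIV W" if "\<And>\<zeta> \<eta>. cinner (W \<zeta>) (W \<eta>) = cinner \<zeta> \<eta>" for W :: "'b \<Rightarrow> 'b"
  proof -
    have "norm (W \<zeta>) = norm \<zeta>" for \<zeta>
      using that[of \<zeta> \<zeta>] by (simp add: cinner_self del: of_real_power)
    then have "bounded_linear W"
      using clinear_linear[OF isometry_clinear[OF that]]
      by (intro bounded_linear.intro bounded_linear_axioms.intro exI[of _ 1]) auto
    then show ?thesis by (rule linear_continuous_on)
  qed
  have UV: "U (V \<zeta>) = \<zeta>" for \<zeta>
    by (rule eq_on_dense[OF dense, of "\<lambda>\<zeta>. U (V \<zeta>)" "\<lambda>\<zeta>. \<zeta>" \<zeta>])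
      (auto simp: U V right intro: continuous_on_id isometry_cont)
  have "surj U" by (rule surjI[where f = V]) (rule UV)
  then have "unitary U" by (simp add: unitary_def isometry_clinear U(1))
  moreover have "W = U" if "unitary W \<and> (\<forall>x. W (\<pi> x \<xi>) = \<pi> (\<theta> x) \<xi>)" for W
  proof
    fix \<zeta> show "W \<zeta> = U \<zeta>"
      using that by (intro eq_on_dense[OF dense, of W U \<zeta>] isometry_cont U(1)) (auto simp: unitary_def U(2))
  qed
  ultimately have "gns_unitary \<pi> \<xi> \<theta> = U"
    unfolding gns_unitary_def using U(2) by (intro the_equality) blast+
  with \<open>unitary U\<close> U(2) show "unitary (gns_unitary \<pi> \<xi> \<theta>)" "gns_unitary \<pi> \<xi> \<theta> (\<pi> x \<xi>) = \<pi> (\<theta> x) \<xi>"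
    by simp_all
qed

lemma gns_unitary_conjugates:
  assumes gns: "gns_triple \<phi> \<pi> \<xi>" and \<theta>: "star_automorphism \<theta>" and inv: "\<And>x. \<phi> (\<theta> x) = \<phi> x"
  shows "gns_unitary \<pi> \<xi> \<theta> (\<pi> x \<zeta>) = \<pi> (\<theta> x) (gns_unitary \<pi> \<xi> \<theta> \<zeta>)"
proof (rule eq_on_dense[of "range (\<lambda>x. \<pi> x \<xi>)" "\<lambda>\<zeta>. gns_unitary \<pi> \<xi> \<theta> (\<pi> x \<zeta>)"
      "\<lambda>\<zeta>. \<pi> (\<theta> x) (gns_unitary \<pi> \<xi> \<theta> \<zeta>)" \<zeta>])
  have \<pi>: "star_representation \<pi>" using gns by (simp add: gns_triple_def)
  show "closure (range (\<lambda>x. \<pi> x \<xi>)) = UNIV" using gns by (simp add: gns_triple_def)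
  have U: "continuous_on UNIV (gns_unitary \<pi> \<xi> \<theta>)"
    by (rule linear_continuous_on[OF unitary_bounded_linear[OF gns_unitary(1)[OF gns \<theta> inv]]])
  have cont: "continuous_on UNIV (\<pi> y)" for y by (rule linear_continuous_on[OF star_representationD(2)[OF \<pi>]])
  show "continuous_on UNIV (\<lambda>\<zeta>. gns_unitary \<pi> \<xi> \<theta> (\<pi> x \<zeta>))" by (rule continuous_on_comp_UNIV[OF U cont])
  show "continuous_on UNIV (\<lambda>\<zeta>. \<pi> (\<theta> x) (gns_unitary \<pi> \<xi> \<theta> \<zeta>))" by (rule continuous_on_comp_UNIV[OF cont U])
  fix \<zeta> assume "\<zeta> \<in> range (\<lambda>x. \<pi> x \<xi>)"
  then obtain y where \<zeta>: "\<zeta> = \<pi> y \<xi>" by blast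
  have "unital_star_hom \<theta>" using \<theta> by (simp add: star_automorphism_def)
  then show "gns_unitary \<pi> \<xi> \<theta> (\<pi> x \<zeta>) = \<pi> (\<theta> x) (gns_unitary \<pi> \<xi> \<theta> \<zeta>)"
    unfolding \<zeta> star_representationD(5)[OF \<pi>, symmetric] gns_unitary(2)[OF gns \<theta> inv]
    by (simp add: unital_star_homD(4))
qed

lemma unitary_representation_gns:
  fixes H (structure)
  assumes system: "cstar_dynamical_system H \<alpha>" and \<phi>: "invariant_state H \<alpha> \<phi>"
    and gns: "gns_triple \<phi> \<pi> \<xi>"
  shows "unitary_representation H (\<lambda>h. gns_unitary \<pi> \<xi> (\<alpha> h))"
proof -
  interpret group H using system by (simp add: cstar_dynamical_system_def)
  have auto: "star_automorphism (\<alpha> h)" if "h \<in> carrier H" for h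
    using system that by (simp add: cstar_dynamical_system_def)
  have mult: "\<alpha> (h \<otimes> k) x = \<alpha> h (\<alpha> k x)" if "h \<in> carrier H" "k \<in> carrier H" for h k x
    using system that by (simp add: cstar_dynamical_system_def)
  have inv: "\<phi> (\<alpha> h x) = \<phi> x" if "h \<in> carrier H" for h x
    using \<phi> that by (simp add: invariant_state_def)
  have dense: "closure (range (\<lambda>x. \<pi> x \<xi>)) = UNIV" using gns by (simp add: gns_triple_def)
  have U1: "unitary (gns_unitary \<pi> \<xi> (\<alpha> h))" if "h \<in> carrier H" for h
    by (rule gns_unitary(1)[OF gns auto[OF that]]) (rule inv[OF that])
  have U2: "gns_unitary \<pi> \<xi> (\<alpha> h) (\<pi> x \<xi>) = \<pi> (\<alpha> h x) \<xi>" if "h \<in> carrier H" for h x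
    by (rule gns_unitary(2)[OF gns auto[OF that]]) (rule inv[OF that])
  have cont: "continuous_on UNIV (gns_unitary \<pi> \<xi> (\<alpha> h))" if "h \<in> carrier H" for h
    by (rule linear_continuous_on[OF unitary_bounded_linear[OF U1[OF that]]])
  show ?thesis
  proof (intro unitary_representation.intro unitary_representation_axioms.intro)
    show "group H" by (rule is_group)
  next
    fix h assume "h \<in> carrier H"
    then show "unitary (gns_unitary \<pi> \<xi> (\<alpha> h))" by (rule U1)
  next
    fix h k \<zeta> assume hk: "h \<in> carrier H" "k \<in> carrier H"
    show "gns_unitary \<pi> \<xi> (\<alpha> (h \<otimes> k)) \<zeta> = gns_unitary \<pi> \<xi> (\<alpha> h) (gns_unitary \<pi> \<xi> (\<alpha> k) \<zeta>)"
    proof (rule eq_on_dense[OF dense, of "gns_unitary \<pi> \<xi> (\<alpha> (h \<otimes> k))"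
            "\<lambda>\<zeta>. gns_unitary \<pi> \<xi> (\<alpha> h) (gns_unitary \<pi> \<xi> (\<alpha> k) \<zeta>)" \<zeta>])
      show "continuous_on UNIV (gns_unitary \<pi> \<xi> (\<alpha> (h \<otimes> k)))" using hk by (intro cont m_closed)
      show "continuous_on UNIV (\<lambda>\<zeta>. gns_unitary \<pi> \<xi> (\<alpha> h) (gns_unitary \<pi> \<xi> (\<alpha> k) \<zeta>))"
        by (rule continuous_on_comp_UNIV[OF cont[OF hk(1)] cont[OF hk(2)]])
    qed (auto simp: U2 hk mult)
  next
    fix \<zeta>
    \<comment> \<open>\<open>cstar_dynamical_system\<close> does not state that the unit acts
      trivially; but an injective idempotent map is the identity.\<close>
    have "\<alpha> \<one> (\<alpha> \<one> x) = \<alpha> \<one> x" for x using mult[of \<one> \<one> x] by simp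
    moreover have "inj (\<alpha> \<one>)" using auto[of \<one>] by (simp add: star_automorphism_def bij_is_inj)
    ultimately have "\<alpha> \<one> x = x" for x by (simp add: inj_eq)
    then show "gns_unitary \<pi> \<xi> (\<alpha> \<one>) \<zeta> = \<zeta>"
      by (intro eq_on_dense[OF dense, of "gns_unitary \<pi> \<xi> (\<alpha> \<one>)" "\<lambda>\<zeta>. \<zeta>" \<zeta>] cont continuous_on_id)
        (auto simp: U2)
  qed
qed

section \<open>Words in homogeneous elements\<close>

text \<open>Positions form a set without order or multiplicity, enough for separating two words; the
  degree is part of the relation, since an element alone does not determine it.\<close>

inductive graded_word ::
  "('g::topological_ab_group_add \<Rightarrow> 'a::cstar_algebra \<Rightarrow> 'a) \<Rightarrow> 'k set \<Rightarrow> ('k \<Rightarrow> 'a \<Rightarrow> 'b::cstar_algebra) \<Rightarrow>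
   'k set \<Rightarrow> ('g \<Rightarrow> complex) \<Rightarrow> 'b \<Rightarrow> bool"
  for \<gamma> L i where
  empty: "graded_word \<gamma> L i {} (\<lambda>g. 1) 1"
| letter: "\<lbrakk>d \<in> L; \<rho> \<in> dual_group; homogeneous \<gamma> \<rho> a; graded_word \<gamma> L i S \<eta> x\<rbrakk> \<Longrightarrow>
    graded_word \<gamma> L i (insert d S) (\<lambda>g. \<rho> g * \<eta> g) (i d a * x)"

lemma graded_word_finite: "graded_word \<gamma> L i S \<rho> x \<Longrightarrow> finite S"
  by (induction rule: graded_word.induct) auto

lemma graded_word_subset: "graded_word \<gamma> L i S \<rho> x \<Longrightarrow> S \<subseteq> L"
  by (induction rule: graded_word.induct) auto

lemma graded_word_dual_group: "graded_word \<gamma> L i S \<rho> x \<Longrightarrow> \<rho> \<in> dual_group"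
  by (induction rule: graded_word.induct) (auto intro: dual_group_one dual_group_mult)

lemma graded_word_single:
  assumes "d \<in> L" "\<rho> \<in> dual_group" "homogeneous \<gamma> \<rho> a"
  shows "graded_word \<gamma> L i {d} \<rho> (i d a)"
  using graded_word.letter[OF assms graded_word.empty, of i] by simp

lemma graded_word_mult:
  assumes "graded_word \<gamma> L i S \<rho> x" and y: "graded_word \<gamma> L i T \<eta> y"
  shows "graded_word \<gamma> L i (S \<union> T) (\<lambda>g. \<rho> g * \<eta> g) (x * y)"
  using assms(1)
proof (induction rule: graded_word.induct)
  case empty
  then show ?case using y by simp
next
  case (letter d \<rho> a S \<rho>' x)
  then show ?case
    using graded_word.letter[OF letter(1-3) letter.IH] by (simp add: mult.assoc)
qed

lemma homogeneous_star:
  assumes "\<And>g. unital_star_hom (\<gamma> g)" "homogeneous \<gamma> \<rho> a"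
  shows "homogeneous \<gamma> (\<lambda>g. cnj (\<rho> g)) (star a)"
  using assms by (simp add: homogeneous_def unital_star_homD star_scaleC)

lemma graded_word_star:
  assumes \<gamma>: "\<And>g. unital_star_hom (\<gamma> g)" and i: "\<And>d. d \<in> L \<Longrightarrow> unital_star_hom (i d)"
    and "graded_word \<gamma> L i S \<rho> x"
  shows "graded_word \<gamma> L i S (\<lambda>g. cnj (\<rho> g)) (star x)"
  using assms(3)
proof (induction rule: graded_word.induct)
  case empty
  show ?case using graded_word.empty by simp
next
  case (letter d \<rho> a S \<eta> x)
  have "graded_word \<gamma> L i {d} (\<lambda>g. cnj (\<rho> g)) (i d (star a))"
    using letter by (intro graded_word_single dual_group_cnj homogeneous_star[where \<gamma> = \<gamma>, OF \<gamma>])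
  from graded_word_mult[OF letter.IH this] show ?case
    by (simp add: star_mult mult.commute unital_star_homD(5)[OF i[OF letter(1)]])
qed

lemma graded_word_image:
  assumes f: "unital_star_hom f" and h: "\<And>d. d \<in> L \<Longrightarrow> h d \<in> L" "\<And>d a. d \<in> L \<Longrightarrow> f (i d a) = i (h d) a"
    and "graded_word \<gamma> L i S \<rho> x"
  shows "graded_word \<gamma> L i (h ` S) \<rho> (f x)"
  using assms(4)
proof (induction rule: graded_word.induct)
  case empty
  show ?case using graded_word.empty by (simp add: unital_star_homD[OF f])
next
  case (letter d \<rho> a S \<eta> x)
  then show ?case
    using graded_word.letter[OF h(1)[OF letter(1)] letter(2,3) letter.IH]
    by (simp add: unital_star_homD[OF f] h(2))
qed

section \<open>Bicharacters and words with separated positions\<close>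

lemma bicharacterD:
  assumes "bicharacter v" "\<rho> \<in> dual_group" "\<eta> \<in> dual_group"
  shows "cmod (v \<rho> \<eta>) = 1"
    and "\<rho>' \<in> dual_group \<Longrightarrow> v (\<lambda>g. \<rho> g * \<rho>' g) \<eta> = v \<rho> \<eta> * v \<rho>' \<eta>"
    and "\<eta>' \<in> dual_group \<Longrightarrow> v \<rho> (\<lambda>g. \<eta> g * \<eta>' g) = v \<rho> \<eta> * v \<rho> \<eta>'"
  using assms unfolding bicharacter_def by blast+

lemma bicharacter_one:
  assumes v: "bicharacter v" and \<rho>: "\<rho> \<in> dual_group"
  shows "v \<rho> (\<lambda>g. 1) = 1" "v (\<lambda>g. 1) \<rho> = 1"
proof -
  have "v \<rho> (\<lambda>g. 1) * v \<rho> (\<lambda>g. 1) = v \<rho> (\<lambda>g. 1)" "v (\<lambda>g. 1) \<rho> * v (\<lambda>g. 1) \<rho> = v (\<lambda>g. 1) \<rho>"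
    using bicharacterD(3)[OF v \<rho> dual_group_one dual_group_one]
      bicharacterD(2)[OF v dual_group_one \<rho> dual_group_one] by simp_all
  moreover have "v \<rho> (\<lambda>g. 1) \<noteq> 0" "v (\<lambda>g. 1) \<rho> \<noteq> 0"
    using bicharacterD(1)[OF v \<rho> dual_group_one] bicharacterD(1)[OF v dual_group_one \<rho>] by auto
  ultimately show "v \<rho> (\<lambda>g. 1) = 1" "v (\<lambda>g. 1) \<rho> = 1" by simp_all
qed

lemma bicharacter_cnj:
  assumes v: "bicharacter v" and \<rho>: "\<rho> \<in> dual_group" and \<eta>: "\<eta> \<in> dual_group"
  shows "v (\<lambda>g. cnj (\<rho> g)) \<eta> = cnj (v \<rho> \<eta>)"
proof -
  have unit: "z * cnj z = 1" if "cmod z = 1" for z using that by (simp add: complex_norm_square[symmetric])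
  have mod: "cmod (v \<rho> \<eta>) = 1" by (rule bicharacterD(1)[OF v \<rho> \<eta>])
  have "(\<lambda>g. \<rho> g * cnj (\<rho> g)) = (\<lambda>g. 1)" using \<rho> by (simp add: dual_group_def unit)
  then have "v \<rho> \<eta> * v (\<lambda>g. cnj (\<rho> g)) \<eta> = v \<rho> \<eta> * cnj (v \<rho> \<eta>)"
    using bicharacterD(2)[OF v \<rho> \<eta> dual_group_cnj[OF \<rho>]] bicharacter_one(2)[OF v \<eta>] unit[OF mod] by simp
  moreover have "v \<rho> \<eta> \<noteq> 0" using mod by auto
  ultimately show ?thesis by simp
qed

text \<open>Each letter of x passes each letter of y at the cost of one value of v; the bicharacter
  laws collect these values into the one at the total degrees.\<close>

lemma graded_word_commute:
  assumes bichar: "bicharacter v"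
    and comm: "\<And>k l \<rho> \<eta> a b. \<lbrakk>k \<in> L; l \<in> L; k < l; \<rho> \<in> dual_group; \<eta> \<in> dual_group; homogeneous \<gamma> \<rho> a;
      homogeneous \<gamma> \<eta> b\<rbrakk> \<Longrightarrow> i k a * i l b = v \<rho> \<eta> *\<^sub>C (i l b * i k a)"
    and x: "graded_word \<gamma> L i S \<rho> x" and y: "graded_word \<gamma> L i T \<eta> y"
    and less: "\<And>s t. s \<in> S \<Longrightarrow> t \<in> T \<Longrightarrow> s < (t :: 'k::linorder)"
  shows "x * y = v \<rho> \<eta> *\<^sub>C (y * x)"
  using x less
proof (induction rule: graded_word.induct)
  case empty
  show ?case using bicharacter_one(2)[OF bichar graded_word_dual_group[OF y]] by simp
next
  case (letter d \<rho> a S \<rho>' x)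
  have single: "i d a * y = v \<rho> \<eta> *\<^sub>C (y * i d a)"
    if "graded_word \<gamma> L i T \<eta> y" "\<And>t. t \<in> T \<Longrightarrow> d < t" for T \<eta> y
    using that
  proof (induction rule: graded_word.induct)
    case empty
    show ?case using bicharacter_one(1)[OF bichar] letter(2) by simp
  next
    case (letter e \<eta> b T \<eta>' y)
    have "i d a * (i e b * y) = v \<rho> \<eta> *\<^sub>C (i e b * (i d a * y))"
      using comm[OF \<open>d \<in> L\<close> letter(1) _ \<open>\<rho> \<in> dual_group\<close> letter(2) \<open>homogeneous \<gamma> \<rho> a\<close> letter(3)] letter.prems
      by (simp add: mult_scaleC_left flip: mult.assoc)
    also have "i d a * y = v \<rho> \<eta>' *\<^sub>C (y * i d a)" using letter.prems by (intro letter.IH) auto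
    finally show ?case
      using bicharacterD(3)[OF bichar \<open>\<rho> \<in> dual_group\<close> letter(2) graded_word_dual_group[OF letter(4)]]
      by (simp add: mult_scaleC_right scaleC_scaleC mult.assoc)
  qed
  have "i d a * x * y = v \<rho>' \<eta> *\<^sub>C (i d a * y * x)"
    using letter.IH letter.prems by (simp add: mult.assoc mult_scaleC_right)
  moreover have "i d a * y = v \<rho> \<eta> *\<^sub>C (y * i d a)" by (rule single[OF y]) (use letter.prems in auto)
  ultimately show ?case
    using bicharacterD(2)[OF bichar letter(2) graded_word_dual_group[OF y] graded_word_dual_group[OF letter(4)]]
    by (simp add: mult_scaleC_left scaleC_scaleC mult.assoc mult.commute[of "v \<rho> \<eta>"])
qed

section \<open>Totality of the homogeneous words\<close>

lemma closure_subspace: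
  fixes S :: "'x::real_normed_vector set"
  assumes S: "subspace S"
  shows "subspace (closure S)"
  unfolding subspace_def
proof (intro conjI ballI allI)
  show "0 \<in> closure S" using subspace_0[OF S] closure_subset by blast
next
  fix x y assume "x \<in> closure S" "y \<in> closure S"
  then obtain f g where "\<forall>n. f n \<in> S" "f \<longlonglongrightarrow> x" "\<forall>n. g n \<in> S" "g \<longlonglongrightarrow> y"
    unfolding closure_sequential by blast
  then have "\<forall>n. f n + g n \<in> S" "(\<lambda>n. f n + g n) \<longlonglongrightarrow> x + y"
    using subspace_add[OF S] by (auto intro: tendsto_add)
  then show "x + y \<in> closure S" unfolding closure_sequential by (intro exI conjI)
next
  fix c :: real and x assume "x \<in> closure S"
  then obtain f where "\<forall>n. f n \<in> S" "f \<longlonglongrightarrow> x" unfolding closure_sequential by blast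
  then have "\<forall>n. c *\<^sub>R f n \<in> S" "(\<lambda>n. c *\<^sub>R f n) \<longlonglongrightarrow> c *\<^sub>R x"
    using subspace_scale[OF S] by (auto intro: tendsto_scaleR)
  then show "c *\<^sub>R x \<in> closure S" unfolding closure_sequential by (intro exI conjI)
qed

lemma closure_span_image:
  fixes f :: "'x::real_normed_vector \<Rightarrow> 'y::real_normed_vector"
  assumes "bounded_linear f" "f ` A \<subseteq> closure (span B)" "x \<in> closure (span A)"
  shows "f x \<in> closure (span B)"
proof -
  have closed: "subspace (closure (span B))" by (rule closure_subspace[OF subspace_span])
  have "f ` span A \<subseteq> closure (span B)"
    unfolding span_linear_image[OF bounded_linear.linear[OF assms(1)], symmetric]
    by (rule span_minimal[OF assms(2) closed])
  then have "f ` closure (span A) \<subseteq> closure (span B)"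
    by (intro image_closure_subset linear_continuous_on assms(1) closed_closure)
  with assms(3) show ?thesis by blast
qed

text \<open>The closed span of the words is a subalgebra, as multiplication is continuous in each
  factor, and contains every \<open>i k a\<close> by totality of the homogeneous elements; so it
  contains the dense image of the free algebra.\<close>

theorem graded_words_total:
  fixes \<gamma> :: "'g::{topological_ab_group_add,t2_space} \<Rightarrow> 'a::cstar_algebra \<Rightarrow> 'a"
    and i :: "'k::linorder \<Rightarrow> 'a \<Rightarrow> 'b::cstar_algebra"
  assumes graded: "graded_cstar_algebra \<gamma>" and tensor: "braided_tensor_product \<gamma> v L i"
    and "L \<noteq> {}"
  shows "closure (span {x. \<exists>S \<rho>. graded_word \<gamma> L i S \<rho> x}) = UNIV"
proof -
  let ?G = "{x. \<exists>S \<rho>. graded_word \<gamma> L i S \<rho> x}"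
  let ?W = "closure (span ?G)"
  have \<gamma>: "unital_star_hom (\<gamma> g)" for g
    using graded by (simp add: graded_cstar_algebra_def star_automorphism_def)
  have i: "unital_star_hom (i k)" if "k \<in> L" for k using tensor that by (simp add: braided_tensor_product_def)
  have "?G \<subseteq> ?W" by (rule order_trans[OF span_superset closure_subset])
  then have GW: "x \<in> ?W" if "graded_word \<gamma> L i S \<rho> x" for S \<rho> x
    by (rule subsetD) (rule CollectI, rule exI, rule exI, rule that)
  have subspace: "subspace ?W" by (rule closure_subspace[OF subspace_span])
  have one: "1 \<in> ?W" by (rule GW[OF graded_word.empty])
  have mult1: "x * y \<in> ?W" if "x \<in> ?W" "y \<in> ?G" for x y
  proof (rule closure_span_image[OF bounded_linear_mult_left _ that(1)])
    from that(2) obtain T \<eta> where y: "graded_word \<gamma> L i T \<eta> y" by (elim CollectE exE)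
    show "(\<lambda>x. x * y) ` ?G \<subseteq> ?W"
      by (rule image_subsetI) (elim CollectE exE, rule GW[OF graded_word_mult[OF _ y]])
  qed
  have mult: "x * y \<in> ?W" if "x \<in> ?W" "y \<in> ?W" for x y
    by (rule closure_span_image[OF bounded_linear_mult_right _ that(2)])
      (rule image_subsetI, rule mult1[OF that(1)])
  have letter: "i k a \<in> ?W" if "k \<in> L" for k a
  proof (rule closure_span_image[OF unital_star_hom_bounded_linear[OF i[OF that]]])
    show "a \<in> closure (span {a. \<exists>\<rho>\<in>dual_group. homogeneous \<gamma> \<rho> a})"
      by (simp add: homogeneous_elements_total[OF graded])
    show "i k ` {a. \<exists>\<rho>\<in>dual_group. homogeneous \<gamma> \<rho> a} \<subseteq> ?W"
      by (rule image_subsetI) (elim CollectE bexE, rule GW[OF graded_word_single[OF that]])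
  qed
  \<comment> \<open>The span is real; a complex scalar acts as multiplication by the letter
    \<open>c *\<^sub>C 1\<close>, which has to be placed at some position.\<close>
  have scaleC: "c *\<^sub>C x \<in> ?W" if "x \<in> ?W" for c x
  proof -
    obtain k where k: "k \<in> L" using \<open>L \<noteq> {}\<close> by blast
    have "c *\<^sub>C x = i k (c *\<^sub>C 1) * x" by (simp add: unital_star_homD[OF i[OF k]] mult_scaleC_left)
    then show ?thesis using mult[OF letter[OF k] that] by simp
  qed
  have word: "prod_list (map (\<lambda>(k, a). i k a) w) \<in> ?W" if "fst ` set w \<subseteq> L" for w
    using that by (induction w) (auto intro!: one mult letter)
  have "free_eval i f \<in> ?W" if "f \<in> free_carrier L" for f
    unfolding free_eval_def using that word
    by (intro subspace_sum[OF subspace] scaleC) (auto simp: free_carrier_def)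
  then have "free_eval i ` free_carrier L \<subseteq> ?W" by blast
  then have "closure (free_eval i ` free_carrier L) \<subseteq> ?W" by (rule closure_minimal) simp
  moreover have "closure (free_eval i ` free_carrier L) = UNIV" using tensor by (simp add: braided_tensor_product_def)
  ultimately show ?thesis by blast
qed


section \<open>The dyadic group\<close>

lemma dyadic_group_carrier:
  assumes "h \<in> carrier dyadic_group" "d \<in> dyadic_rationals"
  shows "h d \<in> dyadic_rationals"
proof -
  interpret B: group "BijGroup dyadic_rationals" by (rule group_BijGroup)
  have "h \<in> Bij dyadic_rationals"
    using assms(1) B.generate_incl[OF dyadic_generators_subset] by (auto simp: dyadic_group_def BijGroup_def)
  then show ?thesis using assms(2) by (auto simp: Bij_def bij_betw_def)
qed

lemma dyadic_translation_carrier: "dyadic_translation k n \<in> carrier dyadic_group"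
  by (auto simp: dyadic_group_def dyadic_generators_def intro!: generate.incl)

text \<open>Stated for all large N because the conditions coming from the several group elements in
  an average have to hold at a common N.\<close>

lemma dyadic_translation_separates:
  fixes S T :: "rat set"
  assumes "finite S" "finite T" "T \<subseteq> dyadic_rationals"
  shows "\<forall>\<^sub>F N in sequentially. \<forall>s\<in>S. \<forall>t\<in>T. s < dyadic_translation (int N) 0 t"
proof -
  \<comment> \<open>For empty S or T the maximum has an unspecified value, but there is nothing to
    separate.\<close>
  obtain M where M: "Max ((\<lambda>(s, t). s - t) ` (S \<times> T)) < of_nat M" using reals_Archimedean2 by blast
  have "s < dyadic_translation (int N) 0 t" if "N \<ge> M" "s \<in> S" "t \<in> T" for N s t
  proof -
    have "s - t \<le> Max ((\<lambda>(s, t). s - t) ` (S \<times> T))"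
      using assms that by (intro Max_ge) auto
    also have "\<dots> < of_nat M" by (rule M)
    also have "\<dots> \<le> of_nat N" using \<open>N \<ge> M\<close> by simp
    finally show ?thesis using that assms(3) by (auto simp: dyadic_translation_def)
  qed
  then show ?thesis unfolding eventually_sequentially by blast
qed

theorem theorem4p8:
  fixes \<gamma> :: "'g::{topological_ab_group_add,t2_space} \<Rightarrow> 'a::cstar_algebra \<Rightarrow> 'a"
    and v :: "('g \<Rightarrow> complex) \<Rightarrow> ('g \<Rightarrow> complex) \<Rightarrow> complex"
    and i :: "rat \<Rightarrow> 'a \<Rightarrow> 'b::cstar_algebra"
    and \<alpha> :: "(rat \<Rightarrow> rat) \<Rightarrow> 'b \<Rightarrow> 'b"
  assumes graded: "graded_cstar_algebra \<gamma>"
    and nuclear: "nuclear (fixed_point_algebra \<gamma>)"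
    and bichar: "bicharacter v"
    and tensor: "braided_tensor_product \<gamma> v dyadic_rationals i"
    and action: "cstar_dynamical_system dyadic_group \<alpha>"
    and action_gen: "\<And>h d a. h \<in> carrier dyadic_group \<Longrightarrow> d \<in> dyadic_rationals \<Longrightarrow> \<alpha> h (i d a) = i (h d) a"
    and cond: "\<And>\<rho> \<eta>. \<rho> \<in> Delta v \<Longrightarrow> \<eta> \<in> Delta v \<Longrightarrow> v \<rho> \<eta> = 1 \<or> symmetrized v \<rho> \<eta> \<noteq> 1"
  shows "H_abelian TYPE('v::chilbert_space) dyadic_group \<alpha>"
  unfolding H_abelian_def Let_def
proof (intro allI impI)
  fix \<phi> :: "'b \<Rightarrow> complex" and \<pi> :: "'b \<Rightarrow> 'v \<Rightarrow> 'v" and \<xi> :: 'v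
  assume "invariant_state dyadic_group \<alpha> \<phi> \<and> gns_triple \<phi> \<pi> \<xi>"
  then have inv: "invariant_state dyadic_group \<alpha> \<phi>" and gns: "gns_triple \<phi> \<pi> \<xi>" by blast+
  define u where "u h = gns_unitary \<pi> \<xi> (\<alpha> h)" for h
  interpret unitary_representation dyadic_group u
    unfolding u_def by (rule unitary_representation_gns[OF action inv gns])
  have E: "gns_invariant_projection dyadic_group \<alpha> \<pi> \<xi> = E"
    unfolding gns_invariant_projection_def fixed_vectors_def u_def ..
  have \<pi>: "star_representation \<pi>" using gns by (simp add: gns_triple_def)
  note rep = star_representationD[OF \<pi>]
  have \<gamma>: "unital_star_hom (\<gamma> g)" for g
    using graded by (simp add: graded_cstar_algebra_def star_automorphism_def)
  have i: "unital_star_hom (i k)" if "k \<in> dyadic_rationals" for k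
    using tensor that by (simp add: braided_tensor_product_def)
  have \<alpha>: "star_automorphism (\<alpha> h)" if "h \<in> carrier dyadic_group" for h
    using action that by (simp add: cstar_dynamical_system_def)
  let ?word = "graded_word \<gamma> dyadic_rationals i"

  have shift: "u h (\<pi> x \<zeta>) = \<pi> (\<alpha> h x) \<zeta>" if "h \<in> carrier dyadic_group" "\<zeta> \<in> fixed_vectors" for h x \<zeta>
  proof -
    have "u h (\<pi> x \<zeta>) = \<pi> (\<alpha> h x) (u h \<zeta>)"
      unfolding u_def by (rule gns_unitary_conjugates[OF gns \<alpha>[OF that(1)]])
        (use inv that(1) in \<open>simp add: invariant_state_def\<close>)
    also have "u h \<zeta> = \<zeta>" using that by (simp add: fixed_vectors_def)
    finally show ?thesis .
  qed
  have moved: "?word (h ` S) \<rho> (\<alpha> h x)" if "h \<in> carrier dyadic_group" "?word S \<rho> x" for h S \<rho> x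
    by (rule graded_word_image[OF _ _ _ that(2)])
      (use \<alpha> that(1) dyadic_group_carrier action_gen in \<open>auto simp: star_automorphism_def\<close>)

  have comm: "i k a * i l b = v \<rho> \<eta> *\<^sub>C (i l b * i k a)"
    if "k \<in> dyadic_rationals" "l \<in> dyadic_rationals" "k < l" "\<rho> \<in> dual_group" "\<eta> \<in> dual_group"
      "homogeneous \<gamma> \<rho> a" "homogeneous \<gamma> \<eta> b" for k l \<rho> \<eta> a b
    using tensor that by (simp add: braided_tensor_product_def)

  define \<tau> where "\<tau> N = dyadic_translation (int N) 0" for N
  have \<tau>: "\<tau> N \<in> carrier dyadic_group" for N unfolding \<tau>_def by (rule dyadic_translation_carrier)

  \<comment> \<open>For single group elements, both sides are coefficients at \<zeta>' and \<zeta>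
    of the translated words, in opposite order, and the positions are separated for large N. Both
    sides are real bilinear in \<open>A\<close> and \<open>B\<close>, so midpoints follow. The
    adjoints appear because the left factor of a product is moved into the first argument.\<close>
  have asymptotic: "\<forall>\<^sub>F N in sequentially.
      cinner (A (\<pi> (star x) \<zeta>')) (u (\<tau> N) (B (\<pi> y \<zeta>))) =
      v \<rho> \<eta> * cinner (u (\<tau> N) (B (\<pi> (star y) \<zeta>'))) (A (\<pi> x \<zeta>))"
    if A: "averaging A" and B: "averaging B" and x: "?word S \<rho> x" and y: "?word T \<eta> y"
      and \<zeta>: "\<zeta> \<in> fixed_vectors" "\<zeta>' \<in> fixed_vectors" for A B x y S T \<rho> \<eta> \<zeta> \<zeta>'
    using A
  proof (induction rule: averaging.induct)
    case (base g)
    note g = base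
    show ?case using B
    proof (induction rule: averaging.induct)
      case (base h)
      have "\<forall>\<^sub>F N in sequentially. \<forall>s\<in>g ` S. \<forall>t\<in>h ` T. s < \<tau> N t"
        unfolding \<tau>_def using graded_word_finite[OF x] graded_word_finite[OF y] graded_word_subset[OF y]
        by (intro dyadic_translation_separates) (auto intro: dyadic_group_carrier[OF base])
      then show ?case
      proof (eventually_elim)
        case (elim N)
        let ?x = "\<alpha> g x" and ?y = "\<alpha> (\<tau> N) (\<alpha> h y)"
        have star: "\<alpha> k (star z) = star (\<alpha> k z)" if "k \<in> carrier dyadic_group" for k z
          using \<alpha>[OF that] by (simp add: star_automorphism_def unital_star_homD)
        have wx: "?word (g ` S) \<rho> ?x" by (rule moved[OF g x])
        have wy: "?word (\<tau> N ` h ` T) \<eta> ?y" by (intro moved \<tau> base y)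
        have eq: "?x * ?y = v \<rho> \<eta> *\<^sub>C (?y * ?x)"
          by (rule graded_word_commute[OF bichar comm wx wy]) (use elim in auto)
        have "cinner \<zeta>' (\<pi> ?x (\<pi> ?y \<zeta>)) = v \<rho> \<eta> * cinner \<zeta>' (\<pi> ?y (\<pi> ?x \<zeta>))"
          by (simp only: rep(5)[symmetric] eq rep(4) cinner_scaleC_right)
        then show ?case
          using g base \<zeta> by (simp add: shift \<tau> star rep(6))
      qed
    next
      case (mid B B')
      have lin: "linear (u (\<tau> N))" for N by (intro bounded_linear.linear unitary_bounded_linear unitary_u \<tau>)
      from mid.IH show ?case
      proof (eventually_elim)
        case (elim N)
        then show ?case
          by (simp add: linear_scale[OF lin] linear_add[OF lin] cinner_scaleR_left cinner_scaleR_right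
              cinner_add_left cinner_add_right algebra_simps)
      qed
    qed
  next
    case (mid A A')
    from mid.IH show ?case
    proof (eventually_elim)
      case (elim N)
      then show ?case
        by (simp add: cinner_scaleR_left cinner_scaleR_right cinner_add_left cinner_add_right algebra_simps)
    qed
  qed

  have exchange: "cinner \<zeta>' (\<pi> x (E (\<pi> y \<zeta>))) = v \<rho> \<eta> * cinner \<zeta>' (\<pi> y (E (\<pi> x \<zeta>)))"
    if x: "?word S \<rho> x" and y: "?word T \<eta> y" and \<zeta>: "\<zeta> \<in> fixed_vectors" "\<zeta>' \<in> fixed_vectors"
    for x y S T \<rho> \<eta> \<zeta> \<zeta>'
  proof -
    obtain A where A: "\<And>n. averaging (A n)"
      "\<And>n. norm (A n (\<pi> (star x) \<zeta>') - E (\<pi> (star x) \<zeta>')) < 1 / real (Suc n)"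
      "\<And>n. norm (A n (\<pi> x \<zeta>) - E (\<pi> x \<zeta>)) < 1 / real (Suc n)"
    proof -
      have "\<exists>T. averaging T \<and> norm (T (\<pi> (star x) \<zeta>') - E (\<pi> (star x) \<zeta>')) < 1 / real (Suc n) \<and>
          norm (T (\<pi> x \<zeta>) - E (\<pi> x \<zeta>)) < 1 / real (Suc n)" for n
        by (rule E_approximation2[of "1 / real (Suc n)"]) auto
      then show ?thesis using that by metis
    qed
    obtain B where B: "\<And>n. averaging (B n)"
      "\<And>n. norm (B n (\<pi> (star y) \<zeta>') - E (\<pi> (star y) \<zeta>')) < 1 / real (Suc n)"
      "\<And>n. norm (B n (\<pi> y \<zeta>) - E (\<pi> y \<zeta>)) < 1 / real (Suc n)"
    proof -
      have "\<exists>T. averaging T \<and> norm (T (\<pi> (star y) \<zeta>') - E (\<pi> (star y) \<zeta>')) < 1 / real (Suc n) \<and>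
          norm (T (\<pi> y \<zeta>) - E (\<pi> y \<zeta>)) < 1 / real (Suc n)" for n
        by (rule E_approximation2[of "1 / real (Suc n)"]) auto
      then show ?thesis using that by metis
    qed
    have "\<exists>N. cinner (A n (\<pi> (star x) \<zeta>')) (u (\<tau> N) (B n (\<pi> y \<zeta>))) =
        v \<rho> \<eta> * cinner (u (\<tau> N) (B n (\<pi> (star y) \<zeta>'))) (A n (\<pi> x \<zeta>))" for n
      using eventually_happens[OF asymptotic[OF A(1) B(1) x y \<zeta>]] by auto
    then obtain N where N: "\<And>n. cinner (A n (\<pi> (star x) \<zeta>')) (u (\<tau> (N n)) (B n (\<pi> y \<zeta>))) =
        v \<rho> \<eta> * cinner (u (\<tau> (N n)) (B n (\<pi> (star y) \<zeta>'))) (A n (\<pi> x \<zeta>))" by metis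
    have lim: "f \<longlonglongrightarrow> l" if "\<And>n. norm (f n - l) < 1 / real (Suc n)" for f :: "nat \<Rightarrow> 'v" and l
    proof (rule LIM_zero_cancel, rule tendsto_norm_zero_cancel)
      have "norm (norm (f n - l)) \<le> inverse (real (Suc n))" for n
        using that[of n] by (simp add: inverse_eq_divide)
      then show "(\<lambda>n. norm (f n - l)) \<longlonglongrightarrow> 0"
        by (intro Lim_null_comparison[OF _ LIMSEQ_inverse_real_of_nat] always_eventually allI)
    qed
    \<comment> \<open>This is what leaves the choice of \<open>N n\<close> free: limits at fixed
      vectors do not see the translation.\<close>
    have moved_close: "norm (u (\<tau> M) w - E z) = norm (w - E z)" for M w z
    proof -
      have "u (\<tau> M) (E z) = E z" using E_fixed \<tau> by (simp add: fixed_vectors_def)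
      then have "u (\<tau> M) w - E z = u (\<tau> M) (w - E z)"
        by (simp add: linear_diff[OF bounded_linear.linear[OF unitary_bounded_linear[OF unitary_u[OF \<tau>]]]])
      then show ?thesis by (simp add: unitary_norm unitary_u \<tau>)
    qed
    have "(\<lambda>n. cinner (A n (\<pi> (star x) \<zeta>')) (u (\<tau> (N n)) (B n (\<pi> y \<zeta>)))) \<longlonglongrightarrow>
        cinner (E (\<pi> (star x) \<zeta>')) (E (\<pi> y \<zeta>))"
      by (intro tendsto_cinner lim) (simp_all only: moved_close A B)
    moreover have "(\<lambda>n. v \<rho> \<eta> * cinner (u (\<tau> (N n)) (B n (\<pi> (star y) \<zeta>'))) (A n (\<pi> x \<zeta>))) \<longlonglongrightarrow>
        v \<rho> \<eta> * cinner (E (\<pi> (star y) \<zeta>')) (E (\<pi> x \<zeta>))"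
      by (intro tendsto_mult tendsto_const tendsto_cinner lim) (simp_all only: moved_close A B)
    ultimately have "cinner (E (\<pi> (star x) \<zeta>')) (E (\<pi> y \<zeta>)) = v \<rho> \<eta> * cinner (E (\<pi> (star y) \<zeta>')) (E (\<pi> x \<zeta>))"
      unfolding N by (rule LIMSEQ_unique)
    \<comment> \<open>E is a self-adjoint idempotent, so one of the two projections can be
      removed.\<close>
    moreover have "cinner (E w) (E z) = cinner w (E z)" for w z
      using cinner_E[OF E_fixed] by (metis cinner_commute)
    ultimately show ?thesis by (simp add: rep(6))
  qed

  have vanish: "E (\<pi> x \<zeta>) = 0" if x: "?word S \<rho> x" and "\<rho> \<notin> Delta v" and \<zeta>: "\<zeta> \<in> fixed_vectors" for x S \<rho> \<zeta>
  proof -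
    have \<rho>: "\<rho> \<in> dual_group" by (rule graded_word_dual_group[OF x])
    have sx: "?word S (\<lambda>g. cnj (\<rho> g)) (star x)" by (rule graded_word_star[OF \<gamma> i x])
    have norm: "cinner \<zeta> (\<pi> (star z) (E (\<pi> z \<zeta>))) = complex_of_real ((norm (E (\<pi> z \<zeta>)))\<^sup>2)" for z
      using cinner_E[OF E_fixed, of "\<pi> z \<zeta>" "\<pi> z \<zeta>"] unfolding cinner_self[symmetric]
      by (metis cinner_commute rep(7))
    have eq: "complex_of_real ((norm (E (\<pi> x \<zeta>)))\<^sup>2) =
        cnj (v \<rho> \<rho>) * complex_of_real ((norm (E (\<pi> (star x) \<zeta>)))\<^sup>2)"
      using exchange[OF sx x \<zeta> \<zeta>] norm[of x] norm[of "star x"]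
      by (simp add: bicharacter_cnj[OF bichar \<rho> \<rho>] star_star)
    have mod: "cmod (v \<rho> \<rho>) = 1" by (rule bicharacterD(1)[OF bichar \<rho> \<rho>])
    \<comment> \<open>v has modulus 1, so the two norms agree; a nonzero norm would force the factor
      to be 1.\<close>
    from arg_cong[OF eq, of cmod] mod have "(norm (E (\<pi> (star x) \<zeta>)))\<^sup>2 = (norm (E (\<pi> x \<zeta>)))\<^sup>2"
      by (simp add: norm_mult del: of_real_power)
    with eq have "(norm (E (\<pi> x \<zeta>)))\<^sup>2 = 0 \<or> cnj (v \<rho> \<rho>) = 1" by auto
    moreover have "cnj (v \<rho> \<rho>) \<noteq> 1" using \<open>\<rho> \<notin> Delta v\<close> \<rho> by (auto simp: Delta_def)
    ultimately show ?thesis by simp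
  qed

  have words: "cinner \<zeta>' (\<pi> x (E (\<pi> y \<zeta>))) = cinner \<zeta>' (\<pi> y (E (\<pi> x \<zeta>)))"
    if x: "?word S \<rho> x" and y: "?word T \<eta> y" and \<zeta>: "\<zeta> \<in> fixed_vectors" "\<zeta>' \<in> fixed_vectors"
    for x y S T \<rho> \<eta> \<zeta> \<zeta>'
  proof -
    note xy = exchange[OF x y \<zeta>] and yx = exchange[OF y x \<zeta>]
    have zero: "\<pi> z 0 = 0" for z using linear_0[OF clinear_linear[OF rep(1)]] .
    show ?thesis
    proof (cases "\<rho> \<in> Delta v \<and> \<eta> \<in> Delta v")
      case True
      then consider "v \<rho> \<eta> = 1" | "symmetrized v \<rho> \<eta> \<noteq> 1" using cond by blast
      then show ?thesis
      proof cases
        case 1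
        then show ?thesis using xy by simp
      next
        case 2
        have "cinner \<zeta>' (\<pi> x (E (\<pi> y \<zeta>))) = symmetrized v \<rho> \<eta> * cinner \<zeta>' (\<pi> x (E (\<pi> y \<zeta>)))"
          using xy yx by (simp add: symmetrized_def)
        with 2 have "cinner \<zeta>' (\<pi> x (E (\<pi> y \<zeta>))) = 0" by simp
        with yx show ?thesis by simp
      qed
    next
      case False
      \<comment> \<open>One of the two projected vectors is zero; it kills one side directly, and
        the exchange relation carries this over to the other side.\<close>
      then show ?thesis using vanish[OF x _ \<zeta>(1)] vanish[OF y _ \<zeta>(1)] xy yx zero by auto
    qed
  qed

  have total: "closure (span {x. \<exists>S \<rho>. ?word S \<rho> x}) = UNIV"
    using graded_words_total[OF graded tensor] dyadic_rationals_of_int by blast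
  have bounded_left: "bounded_linear (\<lambda>x. cinner \<zeta>' (\<pi> x \<zeta>))" for \<zeta> \<zeta>'
    by (rule bounded_linear_compose[OF bounded_bilinear.bounded_linear_right[OF bounded_bilinear_cinner]
        star_representation_bounded_linear[OF \<pi>]])
  have extend: "f x = g x"
    if f: "bounded_linear f" and g: "bounded_linear g" and words: "\<And>S \<rho> x. ?word S \<rho> x \<Longrightarrow> f x = g x"
    for f g :: "'b \<Rightarrow> complex" and x
  proof (rule eq_on_dense[OF total, of f g x])
    show "continuous_on UNIV f" "continuous_on UNIV g" by (intro linear_continuous_on f g)+
    show "f x = g x" if "x \<in> span {x. \<exists>S \<rho>. ?word S \<rho> x}" for x
      by (rule linear_eq_on_span[OF bounded_linear.linear[OF f] bounded_linear.linear[OF g] _ that])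
        (use words in blast)
  qed
  \<comment> \<open>Moving E to the other argument makes linearity and continuity in x visible
    without appeal to linearity of E.\<close>
  have E_linear_form: "cinner \<zeta>' (\<pi> y (E (\<pi> x \<zeta>))) = cinner (E (\<pi> (star y) \<zeta>')) (\<pi> x \<zeta>)" for x y \<zeta> \<zeta>'
    by (metis rep(6) cinner_E[OF E_fixed] cinner_commute)
  have all: "cinner \<zeta>' (\<pi> x (E (\<pi> y \<zeta>))) = cinner \<zeta>' (\<pi> y (E (\<pi> x \<zeta>)))"
    if \<zeta>: "\<zeta> \<in> fixed_vectors" "\<zeta>' \<in> fixed_vectors" for x y \<zeta> \<zeta>'
  proof -
    have half: "cinner \<zeta>' (\<pi> x (E (\<pi> y \<zeta>))) = cinner \<zeta>' (\<pi> y (E (\<pi> x \<zeta>)))" if y: "?word T \<eta> y" for x y T \<eta>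
    proof (rule extend[where f = "\<lambda>x. cinner \<zeta>' (\<pi> x (E (\<pi> y \<zeta>)))"])
      show "bounded_linear (\<lambda>x. cinner \<zeta>' (\<pi> y (E (\<pi> x \<zeta>))))"
        unfolding E_linear_form by (rule bounded_left)
    qed (use words[OF _ y \<zeta>] bounded_left in auto)
    show ?thesis
    proof (rule extend[where f = "\<lambda>y. cinner \<zeta>' (\<pi> x (E (\<pi> y \<zeta>)))"])
      show "bounded_linear (\<lambda>y. cinner \<zeta>' (\<pi> x (E (\<pi> y \<zeta>))))"
        unfolding E_linear_form by (rule bounded_left)
    qed (use half bounded_left in auto)
  qed

  fix x y
  show "(gns_invariant_projection dyadic_group \<alpha> \<pi> \<xi> \<circ> \<pi> x \<circ> gns_invariant_projection dyadic_group \<alpha> \<pi> \<xi>) \<circ>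
      (gns_invariant_projection dyadic_group \<alpha> \<pi> \<xi> \<circ> \<pi> y \<circ> gns_invariant_projection dyadic_group \<alpha> \<pi> \<xi>) =
      (gns_invariant_projection dyadic_group \<alpha> \<pi> \<xi> \<circ> \<pi> y \<circ> gns_invariant_projection dyadic_group \<alpha> \<pi> \<xi>) \<circ>
      (gns_invariant_projection dyadic_group \<alpha> \<pi> \<xi> \<circ> \<pi> x \<circ> gns_invariant_projection dyadic_group \<alpha> \<pi> \<xi>)"
    unfolding E
  proof
    fix w
    have EE: "E (E z) = E z" for z by (rule orthogonal_projection_eqI[OF E_fixed]) simp
    let ?a = "E (\<pi> x (E (\<pi> y (E w))))" and ?b = "E (\<pi> y (E (\<pi> x (E w))))"
    \<comment> \<open>The difference is a fixed vector, so it can test itself, and against it the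
      outer projections disappear.\<close>
    have fixed: "?a - ?b \<in> fixed_vectors" by (intro fixed_vectors_diff E_fixed)
    have "cinner (?a - ?b) (?a - ?b) = 0"
      unfolding cinner_diff_right[of "?a - ?b" ?a ?b] cinner_E[OF fixed] all[OF E_fixed fixed] by simp
    then show "((E \<circ> \<pi> x \<circ> E) \<circ> (E \<circ> \<pi> y \<circ> E)) w = ((E \<circ> \<pi> y \<circ> E) \<circ> (E \<circ> \<pi> x \<circ> E)) w"
      by (simp add: EE cinner_self)
  qed
qed

end
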